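(* There does not exist a logarithmic, non-dicritical, quasi-homogeneous foliation $\mathcal{F}$ on $\mathbb{P}^2_{\mathbb{C}}$ of degree $d$, with a unique singular point $p$, that admits an invariant reduced algebraic curve $C$ of degree $d_0\ge 2$ containing all separatrices passing through $p$.
   Context: A holomorphic foliation on $\mathbb{P}^2_{\mathbb{C}}$ of degree $d$ is given by a homogeneous 1-form $A\,dx+B\,dy+C\,dz$ with isolated singularities, where $A,B,C$ are homogeneous polynomials of degree $d+1$ with $xA+yB+zC=0$. A foliation $\mathcal{F}$ on $\mathbb{P}^2_{\mathbb{C}}$ is logarithmic if there exist homogeneous irreducible polynomials $f_1,\dots,f_m\in\mathbb{C}[x,y,z]$ of degrees $d_1,\dots,d_m$ and non-zero complex numbers $\lambda_1,\dots,\lambda_m$ with $\sum_{i=1}^m\lambda_id_i=0$ such that $\mathcal{F}$ is defined by $\Omega=f_1\cdots f_m\sum_{i=1}^m\lambda_i\frac{df_i}{f_i}$; then the degree of $\mathcal{F}$ is $\sum_{i=1}^m d_i-2$, and in particular the curve $C=\{f_1\cdots f_m=0\}$ has degree $\deg(\mathcal F)+2$. A separatrix at $p$ is an irreducible (possibly formal) invariant germ of curve at $p$. A foliation is non-dicritical at $p$ if it has only finitely many separatrices at $p$; here non-dicritical means non-dicritical at the unique singular point $p$. A non-dicritical foliation is quasi-homogeneous at $p$ if the union of all its separatrices through $p$ is a germ of curve given in some local coordinates by a quasi-homogeneous polynomial. *)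

theory Defs
  imports
    "HOL-Analysis.Analysis"
    "HOL-Library.Poly_Mapping"
    "HOL-Computational_Algebra.Computational_Algebra"
begin

section \<open>Polynomials in finitely many variables\<close>

text \<open>Complex polynomials with variables indexed by a finite type: finitely supported maps from
  monomials (exponent vectors) to coefficients.  The index type 3 is used for homogeneous
  coordinates (its elements are 1, 2 and 3 = 0), the index type 2 for local coordinates.\<close>

type_synonym 'i cpoly = "('i \<Rightarrow>\<^sub>0 nat) \<Rightarrow>\<^sub>0 complex"

definition weighted_homogeneous :: "('i::finite \<Rightarrow> nat) \<Rightarrow> nat \<Rightarrow> 'i cpoly \<Rightarrow> bool" where
  "weighted_homogeneous w n F \<longleftrightarrow>
     (\<forall>m \<in> Poly_Mapping.keys F. (\<Sum>i\<in>UNIV. w i * Poly_Mapping.lookup m i) = n)"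

text \<open>As usual, the zero polynomial is homogeneous of every degree.\<close>

definition homogeneous :: "nat \<Rightarrow> 'i::finite cpoly \<Rightarrow> bool" where
  "homogeneous n F \<longleftrightarrow> weighted_homogeneous (\<lambda>_. 1) n F"

definition pvar :: "'i \<Rightarrow> 'i cpoly" where
  "pvar i = Poly_Mapping.single (Poly_Mapping.single i 1) 1"

definition pconst :: "complex \<Rightarrow> 'i cpoly" where
  "pconst c = Poly_Mapping.single 0 c"

text \<open>The exponent subtraction is truncated only for monomials not containing the variable
  \<open>i\<close>, and their coefficient is multiplied by 0.\<close>

definition pdiff :: "'i \<Rightarrow> 'i cpoly \<Rightarrow> 'i cpoly" where
  "pdiff i F = (\<Sum>m \<in> Poly_Mapping.keys F.
     Poly_Mapping.single (m - Poly_Mapping.single i 1)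
       (of_nat (Poly_Mapping.lookup m i) * Poly_Mapping.lookup F m))"

text \<open>Substitution of elements \<open>x i\<close> of a commutative \<open>complex\<close>-algebra, with structure map
  \<open>c\<close>, for the variables.\<close>

definition psubst ::
  "(complex \<Rightarrow> 'r::comm_ring_1) \<Rightarrow> ('i::finite \<Rightarrow> 'r) \<Rightarrow> 'i cpoly \<Rightarrow> 'r" where
  "psubst c x F = (\<Sum>m \<in> Poly_Mapping.keys F.
     c (Poly_Mapping.lookup F m) * (\<Prod>i\<in>UNIV. x i ^ Poly_Mapping.lookup m i))"

definition peval :: "'i::finite cpoly \<Rightarrow> complex ^ 'i \<Rightarrow> complex" where
  "peval F v = psubst (\<lambda>a. a) (\<lambda>i. v $ i) F"

section \<open>Foliations on the complex projective plane\<close>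

text \<open>A point of the projective plane is the set of all its homogeneous coordinate vectors.\<close>

definition proj_point :: "complex ^ 3 \<Rightarrow> (complex ^ 3) set" where
  "proj_point v = {c *s v | c. c \<noteq> 0}"

text \<open>\<open>A :: 3 \<Rightarrow> 3 cpoly\<close> stands for the 1-form \<open>A 1 dx\<^sub>1 + A 2 dx\<^sub>2 + A 3 dx\<^sub>3\<close>.\<close>

definition singular_points :: "(3 \<Rightarrow> 3 cpoly) \<Rightarrow> (complex ^ 3) set set" where
  "singular_points A = {proj_point v | v. v \<noteq> 0 \<and> (\<forall>i. peval (A i) v = 0)}"

text \<open>The singular set is an algebraic subset of the compact projective plane, so isolated
  singularities means finitely many of them (in particular the form is nonzero).\<close>

definition foliation :: "nat \<Rightarrow> (3 \<Rightarrow> 3 cpoly) \<Rightarrow> bool" where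
  "foliation d A \<longleftrightarrow>
     (\<forall>i. homogeneous (d + 1) (A i)) \<and>
     (\<Sum>i\<in>UNIV. pvar i * A i) = 0 \<and>
     finite (singular_points A)"

text \<open>The \<open>j\<close>-th coefficient of \<open>f\<^sub>1 \<cdots> f\<^sub>m \<Sum>\<^sub>i \<mu>\<^sub>i df\<^sub>i / f\<^sub>i\<close>, with denominators cleared.
  Proportional forms define the same foliation, but a nonzero scalar factor is absorbed by the
  residues \<open>\<mu>\<close>.\<close>

definition logarithmic :: "(3 \<Rightarrow> 3 cpoly) \<Rightarrow> bool" where
  "logarithmic A \<longleftrightarrow> (\<exists>(m::nat) (f :: nat \<Rightarrow> 3 cpoly) (\<delta> :: nat \<Rightarrow> nat) (\<mu> :: nat \<Rightarrow> complex).
     (\<forall>i<m. irreducible (f i) \<and> homogeneous (\<delta> i) (f i) \<and> \<mu> i \<noteq> 0) \<and>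
     (\<Sum>i<m. \<mu> i * of_nat (\<delta> i)) = 0 \<and>
     (\<forall>j. A j = (\<Sum>i<m. pconst (\<mu> i) * (\<Prod>l\<in>{..<m} - {i}. f l) * pdiff j (f i))))"

text \<open>A reduced curve of degree \<open>n\<close> is given by a squarefree (hence nonzero) form \<open>G\<close> of degree
  \<open>n\<close>, and it is invariant iff \<open>G\<close> divides all coefficients of the 2-form \<open>\<Omega> \<and> dG\<close>.\<close>

definition reduced_curve :: "nat \<Rightarrow> 3 cpoly \<Rightarrow> bool" where
  "reduced_curve n G \<longleftrightarrow> homogeneous n G \<and> squarefree G"

definition invariant_curve :: "(3 \<Rightarrow> 3 cpoly) \<Rightarrow> 3 cpoly \<Rightarrow> bool" where
  "invariant_curve A G \<longleftrightarrow> (\<forall>i j. G dvd A i * pdiff j G - A j * pdiff i G)"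

section \<open>Germs at a point\<close>

text \<open>Formal power series \<open>\<Sum> a\<^sub>i\<^sub>j s\<^sup>i t\<^sup>j\<close> in two variables; \<open>a\<^sub>i\<^sub>j\<close> is
  \<open>fps_nth (fps_nth F i) j\<close>.\<close>

type_synonym series2 = "complex fps fps"

definition ser_const :: "complex \<Rightarrow> series2" where
  "ser_const c = fps_const (fps_const c)"

definition ser_s :: series2 where
  "ser_s = fps_X"

definition ser_t :: series2 where
  "ser_t = fps_const fps_X"

definition deriv_s :: "series2 \<Rightarrow> series2" where
  "deriv_s F = fps_deriv F"

definition deriv_t :: "series2 \<Rightarrow> series2" where
  "deriv_t F = Abs_fps (\<lambda>i. fps_deriv (fps_nth F i))"

definition ser_convergent :: "series2 \<Rightarrow> bool" where
  "ser_convergent F \<longleftrightarrow>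
     (\<exists>K r. r > 0 \<and> (\<forall>i j. norm (fps_nth (fps_nth F i) j) \<le> K * r ^ (i + j)))"

text \<open>Expansion of a form at the point \<open>p\<close> in the affine chart \<open>x\<^sub>k = 1\<close> (for \<open>p $ k \<noteq> 0\<close>), with
  affine coordinates centred at \<open>p\<close>: \<open>x\<^sub>k\<^sub>+\<^sub>1 = p\<^sub>k\<^sub>+\<^sub>1 / p\<^sub>k + s\<close> and \<open>x\<^sub>k\<^sub>+\<^sub>2 = p\<^sub>k\<^sub>+\<^sub>2 / p\<^sub>k + t\<close>.
  Indices are taken modulo 3, which is the arithmetic of the type 3.\<close>

definition germ_at :: "complex ^ 3 \<Rightarrow> 3 \<Rightarrow> 3 cpoly \<Rightarrow> series2" where
  "germ_at p k F = psubst ser_const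
     (\<lambda>i. ser_const (p $ i / p $ k) +
          (if i = k + 1 then ser_s else if i = k + 2 then ser_t else 0)) F"

text \<open>In the chart \<open>x\<^sub>k = 1\<close> the foliation is given by \<open>\<omega> = a ds + b dt\<close>, where \<open>a\<close>, \<open>b\<close> are the
  germs of \<open>A (k + 1)\<close>, \<open>A (k + 2)\<close>.  The formal curve \<open>g = 0\<close> is invariant iff \<open>g\<close> divides
  \<open>\<omega> \<and> dg = (a g\<^sub>t - b g\<^sub>s) ds \<and> dt\<close>.  Irreducible series are non-units, so they vanish at \<open>p\<close>.\<close>

definition separatrix :: "(3 \<Rightarrow> 3 cpoly) \<Rightarrow> complex ^ 3 \<Rightarrow> 3 \<Rightarrow> series2 \<Rightarrow> bool" where
  "separatrix A p k g \<longleftrightarrow> irreducible g \<and>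
     g dvd germ_at p k (A (k + 1)) * deriv_t g - germ_at p k (A (k + 2)) * deriv_s g"

text \<open>Two equations define the same germ of curve iff they generate the same ideal, so
  separatrices are counted by their ideals.\<close>

definition non_dicritical :: "(3 \<Rightarrow> 3 cpoly) \<Rightarrow> complex ^ 3 \<Rightarrow> 3 \<Rightarrow> bool" where
  "non_dicritical A p k \<longleftrightarrow> finite {{h. g dvd h} | g. separatrix A p k g}"

text \<open>Holomorphic coordinates \<open>(u, v)\<close> centred at the origin of the \<open>(s, t)\<close>-plane.\<close>

definition local_coordinates :: "series2 \<Rightarrow> series2 \<Rightarrow> bool" where
  "local_coordinates u v \<longleftrightarrow>
     ser_convergent u \<and> ser_convergent v \<and>
     fps_nth (fps_nth u 0) 0 = 0 \<and> fps_nth (fps_nth v 0) 0 = 0 \<and>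
     fps_nth (fps_nth u 1) 0 * fps_nth (fps_nth v 0) 1
       - fps_nth (fps_nth u 0) 1 * fps_nth (fps_nth v 1) 0 \<noteq> 0"

definition quasi_homogeneous_poly :: "2 cpoly \<Rightarrow> bool" where
  "quasi_homogeneous_poly Q \<longleftrightarrow>
     (\<exists>w n. (\<forall>i. w i > 0) \<and> n > 0 \<and> weighted_homogeneous w n Q)"

text \<open>The union of all separatrices is the reduced germ \<open>H = 0\<close>, with \<open>H = Q(u, v)\<close>: the
  irreducible factors of the squarefree series \<open>H\<close> are exactly the separatrices.\<close>

definition quasi_homogeneous_at :: "(3 \<Rightarrow> 3 cpoly) \<Rightarrow> complex ^ 3 \<Rightarrow> 3 \<Rightarrow> bool" where
  "quasi_homogeneous_at A p k \<longleftrightarrow>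
     (\<exists>Q u v. quasi_homogeneous_poly Q \<and> local_coordinates u v \<and>
       (let H = psubst ser_const (\<lambda>i::2. if i = 1 then u else v) Q in
          squarefree H \<and> (\<forall>g. irreducible g \<longrightarrow> (g dvd H \<longleftrightarrow> separatrix A p k g))))"

end

theory Submission
  imports Defs "HOL-Computational_Algebra.Field_as_Ring"
begin

text \<open>Let the foliation be defined by \<open>f\<^sub>1 \<cdots> f\<^sub>m \<Sum> \<mu>\<^sub>i df\<^sub>i / f\<^sub>i\<close>, with \<open>p\<close> the only singular point.  Two components
  meet exactly at \<open>p\<close>, because a common zero is singular.  Near \<open>p\<close> the germ of \<open>f\<^sub>1 \<cdots> f\<^sub>m\<close> is reduced and
  divides the quasi-homogeneous equation of the separatrices, so the weighted leading forms of the \<open>f\<^sub>i\<close> are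
  pairwise without common zeros; hence, along \<open>f\<^sub>i = 0\<close>, every other \<open>f\<^sub>j\<close> is comparable with a power of one and
  the same quasi-norm.  So for distinct \<open>i, j, l\<close> one of the functions \<open>f\<^sub>j\<^sup>a / f\<^sub>l\<^sup>b\<close>, \<open>f\<^sub>l\<^sup>b / f\<^sub>j\<^sup>a\<close> of degree 0
  is bounded on the projective curve \<open>f\<^sub>i = 0\<close>, hence constant, and \<open>f\<^sub>i\<close> divides the Jacobian determinant of
  \<open>f\<^sub>i, f\<^sub>j, f\<^sub>l\<close>.  Being divisible by \<open>f\<^sub>i f\<^sub>j f\<^sub>l\<close>, this determinant vanishes for degree reasons.  It follows that all
  members of the pencil spanned by suitable powers of \<open>f\<^sub>1\<close> and \<open>f\<^sub>2\<close> are invariant.  They all pass through \<open>p\<close>,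
  so the foliation is dicritical.\<close>

text \<open>Each summand of the form omits only one factor, so a zero common to two components is
  singular; likewise a repeated or shared irreducible factor of the germs would divide both local
  coefficients, which have no common factor. If two weighted leading forms had a common zero, both
  would vanish on its orbit under weighted scaling, and the square of the equation of the orbit
  closure would divide the squarefree equation of the separatrices. Along \<open>f i = 0\<close> the
  quotient of \<open>f j ^ \<delta> l\<close> by \<open>f l ^ \<delta> j\<close> is comparable with
  the quasi-norm to the power \<open>e j * \<delta> l - e l * \<delta> j\<close>; the sign of this
  exponent decides which quotient is bounded. The residue relation enters at the end: once the
  Jacobians vanish, contraction with the Euler field leaves a multiple of
  \<open>\<Sum>i<m. \<mu> i * of_nat (\<delta> i)\<close>. The separatrices are formal while
  boundedness concerns values. Polynomial truncations of the coordinates, exact to an order above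
  the weighted degree, mediate between the two.\<close>

no_notation fps_nth (infixl "$" 75)

section \<open>Polynomials and substitution\<close>

lemma poly_mapping_sum_single:
  fixes F :: "'a \<Rightarrow>\<^sub>0 'b::comm_monoid_add"
  shows "F = (\<Sum>m\<in>Poly_Mapping.keys F. Poly_Mapping.single m (Poly_Mapping.lookup F m))"
proof (rule poly_mapping_eqI)
  fix k
  have "Poly_Mapping.lookup (\<Sum>m\<in>Poly_Mapping.keys F. Poly_Mapping.single m (Poly_Mapping.lookup F m)) k
      = (\<Sum>m\<in>Poly_Mapping.keys F. if m = k then Poly_Mapping.lookup F m else 0)"
    by (simp add: lookup_sum lookup_single when_def)
  also have "\<dots> = Poly_Mapping.lookup F k"
    by (simp add: sum.delta' in_keys_iff)
  finally show "Poly_Mapping.lookup F k = Poly_Mapping.lookup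
      (\<Sum>m\<in>Poly_Mapping.keys F. Poly_Mapping.single m (Poly_Mapping.lookup F m)) k" by simp
qed

lemma poly_mapping_additive_induct [case_names single add]:
  fixes F :: "'a::zero \<Rightarrow>\<^sub>0 'b::comm_monoid_add"
  assumes "\<And>m a. P (Poly_Mapping.single m a)" and "\<And>F G. P F \<Longrightarrow> P G \<Longrightarrow> P (F + G)"
  shows "P F"
proof -
  have "P (\<Sum>m\<in>S. Poly_Mapping.single m (Poly_Mapping.lookup F m))" if "finite S" for S
    using that
  proof induction
    case empty
    have "P (Poly_Mapping.single 0 0)" by (rule assms(1))
    then show ?case by simp
  next
    case (insert x S)
    then show ?case by (simp add: assms)
  qed
  then show ?thesis using poly_mapping_sum_single[of F] by (metis finite_keys)
qed

text \<open>A predicate on functions, so that one set of rules \<open>hom_simps\<close> serves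
  evaluations, substitutions, germs and changes of polynomial model, which all appear as lambda
  terms.\<close>

definition ring_hom1 :: "('a::comm_ring_1 \<Rightarrow> 'b::comm_ring_1) \<Rightarrow> bool" where
  "ring_hom1 h \<longleftrightarrow> h 1 = 1 \<and> (\<forall>a b. h (a + b) = h a + h b) \<and> (\<forall>a b. h (a * b) = h a * h b)"

lemma ring_hom1I:
  "h 1 = 1 \<Longrightarrow> (\<And>a b. h (a + b) = h a + h b) \<Longrightarrow> (\<And>a b. h (a * b) = h a * h b) \<Longrightarrow> ring_hom1 h"
  by (auto simp: ring_hom1_def)

context
  fixes h :: "'a::comm_ring_1 \<Rightarrow> 'b::comm_ring_1"
  assumes h: "ring_hom1 h"
begin

lemma hom_one: "h 1 = 1" and hom_add: "h (a + b) = h a + h b" and hom_mult: "h (a * b) = h a * h b"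
  using h by (auto simp: ring_hom1_def)

lemma hom_zero: "h 0 = 0"
  using hom_add[of 0 0] by simp

lemma hom_minus: "h (- a) = - h a"
  using hom_add[of a "- a"] hom_zero by (simp add: add_eq_0_iff)

lemma hom_diff: "h (a - b) = h a - h b"
  using hom_add[of a "- b"] hom_minus by simp

lemma hom_power: "h (a ^ n) = h a ^ n"
  by (induction n) (simp_all add: hom_one hom_mult)

lemma hom_sum: "h (sum f S) = (\<Sum>x\<in>S. h (f x))"
  by (induction S rule: infinite_finite_induct) (simp_all add: hom_zero hom_add)

lemma hom_prod: "h (prod f S) = (\<Prod>x\<in>S. h (f x))"
  by (induction S rule: infinite_finite_induct) (simp_all add: hom_one hom_mult)

lemma hom_of_nat: "h (of_nat n) = of_nat n"
  by (induction n) (simp_all add: hom_zero hom_one hom_add)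

lemma hom_dvd: "a dvd b \<Longrightarrow> h a dvd h b"
  by (auto simp: dvd_def hom_mult)

lemmas hom_simps = hom_zero hom_one hom_add hom_mult hom_minus hom_diff hom_power hom_sum hom_prod hom_of_nat

end

lemma ring_hom1_compose: "ring_hom1 g \<Longrightarrow> ring_hom1 h \<Longrightarrow> ring_hom1 (\<lambda>x. g (h x))"
  by (auto simp: ring_hom1_def)

lemma ring_hom1_ident: "ring_hom1 (\<lambda>a. a)"
  by (simp add: ring_hom1_def)

lemma ring_hom1_const_poly: "ring_hom1 (\<lambda>c. [:c:])"
  by (auto intro!: ring_hom1I simp: one_pCons)

lemma ring_hom1_poly: "ring_hom1 (\<lambda>q. poly q x)"
  by (auto intro!: ring_hom1I)

lemma ring_hom1_pconst: "ring_hom1 (pconst :: complex \<Rightarrow> 'i cpoly)"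
  by (auto intro!: ring_hom1I simp: pconst_def single_add mult_single)

lemma ring_hom1_ser_const: "ring_hom1 ser_const"
  by (auto intro!: ring_hom1I simp: ser_const_def)

section \<open>Substitution as a ring homomorphism\<close>

lemma psubst_superset:
  assumes "finite S" "Poly_Mapping.keys F \<subseteq> S" "c 0 = 0"
  shows "psubst c x F = (\<Sum>m\<in>S. c (Poly_Mapping.lookup F m) * (\<Prod>i\<in>UNIV. x i ^ Poly_Mapping.lookup m i))"
  unfolding psubst_def using assms
  by (intro sum.mono_neutral_left) (auto simp: in_keys_iff)

lemma psubst_single:
  "c 0 = 0 \<Longrightarrow> psubst c x (Poly_Mapping.single m a) = c a * (\<Prod>i\<in>UNIV. x i ^ Poly_Mapping.lookup m i)"
  by (subst psubst_superset[of "{m}"]) auto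

context
  fixes c :: "complex \<Rightarrow> 'r::comm_ring_1"
  assumes c: "ring_hom1 c"
begin

lemma psubst_add: "psubst c x (F + G) = psubst c x F + psubst c x G"
proof -
  let ?S = "Poly_Mapping.keys F \<union> Poly_Mapping.keys G"
  have *: "psubst c x H = (\<Sum>m\<in>?S. c (Poly_Mapping.lookup H m) * (\<Prod>i\<in>UNIV. x i ^ Poly_Mapping.lookup m i))"
    if "Poly_Mapping.keys H \<subseteq> ?S" for H
    by (rule psubst_superset) (use that hom_zero[OF c] in auto)
  show ?thesis
    using Poly_Mapping.keys_add[of F G]
    by (simp add: * lookup_add hom_add[OF c] distrib_right sum.distrib)
qed

lemma psubst_pconst: "psubst c x (pconst a) = c a"
  unfolding pconst_def by (simp add: psubst_single hom_zero[OF c])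

lemma psubst_pvar: "psubst c x (pvar i) = x i"
proof -
  have "(\<Prod>j\<in>UNIV. x j ^ (1 when i = j)) = (\<Prod>j\<in>UNIV. if i = j then x j else 1)"
    by (intro prod.cong) auto
  then show ?thesis
    unfolding pvar_def by (simp add: psubst_single hom_zero[OF c] hom_one[OF c] lookup_single)
qed

lemma psubst_mult_single:
  "psubst c x (Poly_Mapping.single m a * G) = psubst c x (Poly_Mapping.single m a) * psubst c x G"
proof (induction G rule: poly_mapping_additive_induct)
  case (single m' a')
  then show ?case
    by (simp add: mult_single psubst_single hom_zero[OF c] hom_mult[OF c] lookup_add power_add prod.distrib mult_ac)
next
  case (add F G)
  then show ?case by (simp add: distrib_left psubst_add)
qed

lemma psubst_mult: "psubst c x (F * G) = psubst c x F * psubst c x G"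
proof (induction F rule: poly_mapping_additive_induct)
  case (single m a)
  then show ?case by (rule psubst_mult_single)
next
  case (add F H)
  then show ?case by (simp add: distrib_right psubst_add)
qed

lemma ring_hom1_psubst: "ring_hom1 (psubst c x)"
proof (rule ring_hom1I)
  show "psubst c x 1 = 1"
    using psubst_pconst[of x 1] by (simp add: pconst_def hom_one[OF c])
qed (simp_all add: psubst_add psubst_mult)

end

text \<open>A homomorphism is determined on polynomials by its values on scalars and variables.
  Every comparison below between evaluations, germs and iterated polynomials is an instance.\<close>

lemma hom_psubst:
  assumes "ring_hom1 h"
  shows "h (psubst c x F) = psubst (\<lambda>a. h (c a)) (\<lambda>i. h (x i)) F"
  unfolding psubst_def using assms by (simp add: hom_simps)

lemma psubst_pconst_pvar [simp]: "psubst pconst pvar F = F"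
proof (induction F rule: poly_mapping_additive_induct)
  case (single m a)
  have pow: "pvar i ^ n = Poly_Mapping.single (Poly_Mapping.single i n) (1::complex)" for i :: 'a and n
    by (induction n) (simp_all add: pvar_def mult_single flip: single_add)
  have pr: "(\<Prod>i\<in>S. pvar i ^ Poly_Mapping.lookup m i) =
    Poly_Mapping.single (\<Sum>i\<in>S. Poly_Mapping.single i (Poly_Mapping.lookup m i)) (1::complex)" for S :: "'a set"
    by (induction S rule: infinite_finite_induct) (simp_all add: pow mult_single)
  have m: "(\<Sum>i\<in>UNIV. Poly_Mapping.single i (Poly_Mapping.lookup m i)) = m"
    by (rule poly_mapping_eqI) (simp add: lookup_sum lookup_single when_def)
  show ?case
    by (simp add: psubst_single hom_zero[OF ring_hom1_pconst] pr m) (simp add: pconst_def mult_single)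
next
  case (add F G)
  then show ?case by (simp add: psubst_add ring_hom1_pconst)
qed

section \<open>Evaluation at points\<close>

lemma ring_hom1_peval: "ring_hom1 (\<lambda>F. peval F v)"
  unfolding peval_def by (rule ring_hom1_psubst[OF ring_hom1_ident])

lemmas peval_simps = hom_simps[OF ring_hom1_peval]

lemma peval_pconst [simp]: "peval (pconst c) v = c"
  unfolding peval_def by (rule psubst_pconst[OF ring_hom1_ident])

lemma peval_pvar [simp]: "peval (pvar i) v = v $ i"
  unfolding peval_def by (rule psubst_pvar[OF ring_hom1_ident])

lemma peval_eq_sum:
  "peval F v = (\<Sum>m\<in>Poly_Mapping.keys F. Poly_Mapping.lookup F m * (\<Prod>i\<in>UNIV. v $ i ^ Poly_Mapping.lookup m i))"
  by (simp add: peval_def psubst_def)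

lemma continuous_on_peval: "continuous_on S (peval F)"
  unfolding peval_eq_sum by (intro continuous_intros)

lemma peval_scale:
  assumes "homogeneous n F"
  shows "peval F (c *s v) = c ^ n * peval F v"
proof -
  have "(\<Prod>i\<in>UNIV. (c *s v) $ i ^ Poly_Mapping.lookup m i)
      = c ^ n * (\<Prod>i\<in>UNIV. v $ i ^ Poly_Mapping.lookup m i)" if "m \<in> Poly_Mapping.keys F" for m
    using that assms
    by (simp add: homogeneous_def weighted_homogeneous_def power_mult_distrib prod.distrib flip: power_sum)
  then show ?thesis
    by (simp add: peval_eq_sum sum_distrib_left algebra_simps)
qed

text \<open>Forms are studied line by line: the roots of this polynomial in the line parameter will
  be the fibre of a projection.\<close>

lemma psubst_peval_poly:
  "poly (psubst (\<lambda>c. [:c:]) (\<lambda>i. [:a i, b i:]) F) y = peval F (\<chi> i. a i + y * b i)"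
  unfolding peval_def by (subst hom_psubst[OF ring_hom1_poly]) (auto intro!: arg_cong[where f = "\<lambda>x. psubst (\<lambda>a. a) x F"])

text \<open>Kronecker substitution \<open>x\<^sub>i \<mapsto> t ^ (N ^ e i)\<close> with \<open>N\<close> larger than all exponents.\<close>

lemma peval_eq_0_imp_eq_0:
  assumes "\<And>v. peval F v = 0"
  shows "F = (0 :: 'i::finite cpoly)"
proof (rule ccontr)
  assume "F \<noteq> 0"
  then obtain m0 where m0: "m0 \<in> Poly_Mapping.keys F"
    by (metis keys_eq_empty ex_in_conv poly_mapping_eqI lookup_zero in_keys_iff)
  obtain e :: "'i \<Rightarrow> nat" where e: "bij_betw e UNIV {0..<CARD('i)}"
    using ex_bij_betw_finite_nat[of "UNIV :: 'i set"] by auto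
  let ?C = "CARD('i)"
  define g where "g = inv_into UNIV e"
  have g: "bij_betw g {0..<?C} UNIV" unfolding g_def by (rule bij_betw_inv_into[OF e])
  \<comment> \<open>One more than the sum of all exponents of \<open>F\<close>, hence larger than
    each of them: exponents become digits in base \<open>N\<close>.\<close>
  define N where "N = Suc (\<Sum>m\<in>Poly_Mapping.keys F. \<Sum>i\<in>UNIV. Poly_Mapping.lookup m i)"
  have bound: "Poly_Mapping.lookup m i < N" if "m \<in> Poly_Mapping.keys F" for m i
  proof -
    have "Poly_Mapping.lookup m i \<le> (\<Sum>i\<in>UNIV. Poly_Mapping.lookup m i)"
      by (rule member_le_sum) auto
    also have "\<dots> \<le> (\<Sum>m\<in>Poly_Mapping.keys F. \<Sum>i\<in>UNIV. Poly_Mapping.lookup m i)"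
      by (rule member_le_sum) (use that in auto)
    finally show ?thesis by (simp add: N_def)
  qed
  define K where "K = (\<lambda>m. \<Sum>i\<in>UNIV. N ^ e i * Poly_Mapping.lookup m i)"
  \<comment> \<open>Uniqueness of base \<open>N\<close> expansions: the top digit and the rest are
    recovered by \<open>div\<close> and \<open>mod\<close> with \<open>N ^ n\<close>. Distinct
    monomials of \<open>F\<close> therefore receive distinct powers of \<open>t\<close>.\<close>
  have inj: "inj_on (\<lambda>d. \<Sum>j<n. N ^ j * d j) (PiE {..<n} (\<lambda>_. {..<N}))" for n
  proof (induction n)
    case 0
    then show ?case by (auto simp: inj_on_def)
  next
    case (Suc n)
    show ?case
    proof (rule inj_onI)
      fix d d' assume d: "d \<in> PiE {..<Suc n} (\<lambda>_. {..<N})" "d' \<in> PiE {..<Suc n} (\<lambda>_. {..<N})"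
        and eq: "(\<Sum>j<Suc n. N ^ j * d j) = (\<Sum>j<Suc n. N ^ j * d' j)"
      have lt: "(\<Sum>j<n. N ^ j * f j) < N ^ n" if "\<forall>j<n. f j < N" for f
        using that
      proof (induction n)
        case (Suc n)
        have "(\<Sum>j<Suc n. N ^ j * f j) < N ^ n + N ^ n * f n" using Suc by simp
        also have "\<dots> = N ^ n * Suc (f n)" by simp
        also have "\<dots> \<le> N ^ n * N" by (intro mult_le_mono2) (use Suc in \<open>auto simp: Suc_le_eq\<close>)
        finally show ?case by (simp add: mult.commute)
      qed simp
      have Npos: "N > 0" by (simp add: N_def)
      have l1: "(\<Sum>j<n. N ^ j * d j) < N ^ n" "(\<Sum>j<n. N ^ j * d' j) < N ^ n"
        using d by (auto intro!: lt simp: PiE_iff)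
      have *: "(\<Sum>j<n. N ^ j * d j) + N ^ n * d n = (\<Sum>j<n. N ^ j * d' j) + N ^ n * d' n"
        using eq by simp
      have s: "(\<Sum>j<n. N ^ j * d j) = (\<Sum>j<n. N ^ j * d' j)" "d n = d' n"
        using l1 arg_cong[where f = "\<lambda>t. t mod N ^ n", OF *]
          arg_cong[where f = "\<lambda>t. t div N ^ n", OF *] Npos by simp_all
      have "restrict d {..<n} = restrict d' {..<n}"
        using s(1) d by (intro inj_onD[OF Suc.IH]) (auto simp: PiE_iff)
      then have "d j = d' j" if "j < n" for j using that by (metis lessThan_iff restrict_apply')
      then show "d = d'" using d s(2) by (intro ext) (metis PiE_arb lessThan_iff less_Suc_eq)
    qed
  qed
  have Kinj: "inj_on K (Poly_Mapping.keys F)"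
  proof (rule inj_onI)
    fix m m' assume m: "m \<in> Poly_Mapping.keys F" "m' \<in> Poly_Mapping.keys F" "K m = K m'"
    have K: "K m = (\<Sum>j<?C. N ^ j * (\<lambda>j\<in>{..<?C}. Poly_Mapping.lookup m (g j)) j)" for m
    proof -
      have "K m = (\<Sum>j\<in>{0..<?C}. N ^ e (g j) * Poly_Mapping.lookup m (g j))"
        unfolding K_def by (rule sum.reindex_bij_betw[OF g, symmetric])
      also have "\<dots> = (\<Sum>j<?C. N ^ j * (\<lambda>j\<in>{..<?C}. Poly_Mapping.lookup m (g j)) j)"
        using e by (intro sum.cong) (auto simp: g_def bij_betw_def f_inv_into_f)
      finally show ?thesis .
    qed
    have "(\<lambda>j\<in>{..<?C}. Poly_Mapping.lookup m (g j)) = (\<lambda>j\<in>{..<?C}. Poly_Mapping.lookup m' (g j))"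
      using m bound by (intro inj_onD[OF inj[of ?C]]) (auto simp: K split: if_splits)
    then have "Poly_Mapping.lookup m (g j) = Poly_Mapping.lookup m' (g j)" if "j < ?C" for j
      using that by (metis lessThan_iff restrict_apply')
    then show "m = m'" using g by (intro poly_mapping_eqI) (metis UNIV_I atLeastLessThan_iff bij_betw_def imageE)
  qed
  define q where "q = (\<Sum>m\<in>Poly_Mapping.keys F. monom (Poly_Mapping.lookup F m) (K m))"
  have "poly q t = peval F (\<chi> i. t ^ (N ^ e i))" for t
    by (simp add: q_def peval_eq_sum poly_sum poly_monom K_def power_sum power_mult)
  then have "q = 0" using assms by (simp add: poly_all_0_iff_0[symmetric])
  moreover have "coeff q (K m0) = Poly_Mapping.lookup F m0"
  proof -
    have "coeff q (K m0) = (\<Sum>m\<in>Poly_Mapping.keys F. if m = m0 then Poly_Mapping.lookup F m else 0)"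
      unfolding q_def coeff_sum using Kinj m0 by (intro sum.cong) (auto simp: inj_on_def)
    then show ?thesis using m0 by simp
  qed
  ultimately show False using m0 by (simp add: in_keys_iff)
qed

section \<open>Unique factorization of power series in two variables\<close>

text \<open>An ideal of \<open>k[[t]][[s]]\<close> that is saturated with respect to \<open>s\<close> is principal: take an element
  whose constant coefficient generates the ideal of all constant coefficients, and divide
  successively by it.\<close>

lemma fps_saturated_ideal_principal:
  fixes I :: "'a::field fps fps set"
  assumes add: "\<And>a b. a \<in> I \<Longrightarrow> b \<in> I \<Longrightarrow> a + b \<in> I"
    and mult: "\<And>a c. a \<in> I \<Longrightarrow> c * a \<in> I"
    and sat: "\<And>a. fps_X * a \<in> I \<Longrightarrow> a \<in> I"
    and ne: "I \<noteq> {}"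
  shows "\<exists>g\<in>I. \<forall>a\<in>I. g dvd a"
proof -
  have zero: "0 \<in> I" using ne mult[of _ 0] by auto
  have diff: "a - c * b \<in> I" if "a \<in> I" "b \<in> I" for a b c
    using add[OF that(1) mult[OF that(2), of "- c"]] by simp
  have "\<exists>g\<in>I. \<forall>a\<in>I. fps_nth g 0 dvd fps_nth a 0"
  proof (cases "\<forall>a\<in>I. fps_nth a 0 = 0")
    case True
    then show ?thesis using zero by auto
  next
    case False
    then obtain a0 where a0: "a0 \<in> I" "fps_nth a0 0 \<noteq> 0" by auto
    \<comment> \<open>The coefficient ring is a discrete valuation ring: a nonzero constant
      coefficient of least order divides all the others.\<close>
    define P where "P = (\<lambda>n. \<exists>a\<in>I. fps_nth a 0 \<noteq> 0 \<and> subdegree (fps_nth a 0) = n)"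
    have "P (subdegree (fps_nth a0 0))" using a0 by (auto simp: P_def)
    then have "P (LEAST n. P n)" by (rule LeastI)
    then obtain g where g: "g \<in> I" "fps_nth g 0 \<noteq> 0" "subdegree (fps_nth g 0) = (LEAST n. P n)"
      by (auto simp: P_def)
    have "fps_nth g 0 dvd fps_nth a 0" if "a \<in> I" for a
    proof (cases "fps_nth a 0 = 0")
      case False
      then have "P (subdegree (fps_nth a 0))" using that by (auto simp: P_def)
      then have "subdegree (fps_nth g 0) \<le> subdegree (fps_nth a 0)"
        unfolding g(3) by (rule Least_le)
      then show ?thesis using False g(2) by (simp add: fps_dvd_iff)
    qed simp
    then show ?thesis using g by auto
  qed
  then obtain g where g: "g \<in> I" "\<And>a. a \<in> I \<Longrightarrow> fps_nth g 0 dvd fps_nth a 0" by auto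
  have "g dvd a" if a: "a \<in> I" for a
  proof -
    \<comment> \<open>Subtracting a multiple of \<open>g\<close> removes the constant coefficient;
      saturation puts the quotient by \<open>fps_X\<close> back into \<open>I\<close>, so the
      division can be repeated.\<close>
    have step: "\<exists>c b'. b' \<in> I \<and> b = fps_const c * g + fps_X * b'" if "b \<in> I" for b
    proof -
      obtain c where c: "fps_nth b 0 = fps_nth g 0 * c" using g(2)[OF \<open>b \<in> I\<close>] by (rule dvdE)
      let ?r = "b - fps_const c * g"
      have r: "?r \<in> I" using diff[OF that g(1)] .
      have "fps_nth ?r 0 = 0" using c by (simp add: mult.commute)
      then have "?r = fps_X * fps_shift 1 ?r"
        by (intro fps_ext) (auto simp: fps_X_mult_nth gr0_conv_Suc)
      moreover from this r have "fps_shift 1 ?r \<in> I" using sat by metis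
      ultimately show ?thesis by (intro exI[of _ c] exI[of _ "fps_shift 1 ?r"]) (auto simp: algebra_simps)
    qed
    then obtain C B where CB: "\<And>b. b \<in> I \<Longrightarrow> B b \<in> I \<and> b = fps_const (C b) * g + fps_X * B b" by metis
    define r where "r = rec_nat a (\<lambda>_. B)"
    have rI: "r n \<in> I" for n by (induction n) (use a CB in \<open>auto simp: r_def\<close>)
    have r: "r 0 = a" "r n = fps_const (C (r n)) * g + fps_X * r (Suc n)" for n
      using CB[OF rI[of n]] by (auto simp: r_def)
    \<comment> \<open>The successive multipliers are the coefficients of the full quotient.\<close>
    define q where "q = Abs_fps (\<lambda>n. C (r n))"
    have exp: "a = (\<Sum>i<n. fps_const (C (r i)) * fps_X ^ i) * g + fps_X ^ n * r n" for n
    proof (induction n)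
      case 0
      then show ?case by (simp add: r(1))
    next
      case (Suc n)
      let ?q = "\<Sum>i<n. fps_const (C (r i)) * fps_X ^ i"
      have "a = ?q * g + fps_X ^ n * r n" by (rule Suc.IH)
      also have "fps_X ^ n * r n = fps_X ^ n * (fps_const (C (r n)) * g + fps_X * r (Suc n))"
        using r(2)[of n] by simp
      also have "?q * g + \<dots> = (?q + fps_const (C (r n)) * fps_X ^ n) * g + fps_X ^ Suc n * r (Suc n)"
        by (simp add: algebra_simps)
      finally show ?case by simp
    qed
    have *: "fps_nth a n = fps_nth (q * g) n" for n
    proof -
      \<comment> \<open>The remainder after \<open>Suc n\<close> divisions carries the factor
        \<open>fps_X ^ Suc n\<close> and does not reach coefficient \<open>n\<close>.\<close>
      have "fps_nth a n = fps_nth ((\<Sum>i<Suc n. fps_const (C (r i)) * fps_X ^ i) * g) n"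
        using arg_cong[OF exp[of "Suc n"], of "\<lambda>x. fps_nth x n"]
        by (simp only: fps_add_nth fps_X_power_mult_nth) simp
      also have "\<dots> = (\<Sum>j=0..n. fps_nth (\<Sum>i<Suc n. fps_const (C (r i)) * fps_X ^ i) j * fps_nth g (n - j))"
        by (rule fps_mult_nth)
      also have "\<dots> = (\<Sum>j=0..n. fps_nth q j * fps_nth g (n - j))"
      proof (intro sum.cong refl arg_cong2[where f = "(*)"])
        fix j assume "j \<in> {0..n}"
        have "fps_nth (\<Sum>i<Suc n. fps_const (C (r i)) * fps_X ^ i) j = (\<Sum>i<Suc n. if i = j then C (r i) else 0)"
          by (subst fps_sum_nth) (intro sum.cong, auto simp: fps_X_power_nth)
        then show "fps_nth (\<Sum>i<Suc n. fps_const (C (r i)) * fps_X ^ i) j = fps_nth q j"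
          using \<open>j \<in> {0..n}\<close> by (simp add: q_def del: sum.lessThan_Suc)
      qed
      finally show ?thesis by (simp add: fps_mult_nth)
    qed
    have "a = q * g" by (rule fps_ext) (rule *)
    then show "g dvd a" by simp
  qed
  then show ?thesis using g by auto
qed

lemma prime_elem_fps_X: "prime_elem (fps_X :: 'a::idom fps)"
proof -
  have iff: "(fps_X :: 'a fps) dvd f \<longleftrightarrow> fps_nth f 0 = 0" for f
  proof
    assume "fps_nth f 0 = 0"
    then have "f = fps_X * fps_shift 1 f"
      by (intro fps_ext) (auto simp: fps_X_mult_nth gr0_conv_Suc)
    then show "fps_X dvd f" by (metis dvd_triv_left)
  qed (auto simp: dvd_def)
  show ?thesis
    by (rule prime_elemI) (auto simp: iff fps_X_neq_zero)
qed

lemma idom_prime_elem_imp_irreducible: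
  assumes "prime_elem (g :: 'a::idom)"
  shows "irreducible g"
proof -
  have unit: "b dvd 1" if ab: "g = a * b" "g dvd a" for a b
  proof -
    obtain c where "a = g * c" using ab(2) by (rule dvdE)
    then have "g * (c * b) = g * 1" using ab(1) by (metis mult.assoc mult.right_neutral)
    then have "c * b = 1" using assms unfolding prime_elem_def by (metis mult_left_cancel)
    then show ?thesis by (metis dvd_triv_right)
  qed
  show ?thesis
  proof (rule irreducibleI)
    fix a b assume ab: "g = a * b"
    then have "g dvd a \<or> g dvd b" using assms by (metis dvd_refl prime_elem_dvd_mult_iff)
    then show "a dvd 1 \<or> b dvd 1" using unit[of a b] unit[of b a] ab by (auto simp: mult.commute)
  qed (use assms in \<open>auto simp: prime_elem_def\<close>)
qed

lemma dvd_of_eq_mult_unit: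
  assumes "(x :: 'a::comm_ring_1) = y * h" "h dvd 1"
  shows "x dvd y"
proof -
  obtain k where "1 = h * k" using assms(2) by (rule dvdE)
  then have "y = x * k" using assms(1) by (metis mult.assoc mult.right_neutral)
  then show ?thesis by simp
qed

text \<open>Bezout up to a power of \<open>fps_X\<close>: the elements that some power of
  \<open>fps_X\<close> multiplies into the ideal of \<open>g\<close> and \<open>a\<close> form a
  saturated ideal, so it has a generator \<open>\<pi>\<close>, which divides both. As
  \<open>g\<close> is irreducible, either \<open>\<pi>\<close> is an associate of \<open>g\<close>,
  and \<open>g dvd a\<close>, or \<open>\<pi>\<close> is a unit. In the latter case a power of
  \<open>fps_X\<close> is a combination of \<open>g\<close> and \<open>a\<close>, whence
  \<open>g dvd fps_X ^ n * b\<close>; the power cancels unless \<open>g\<close> is an associate of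
  the prime \<open>fps_X\<close>, a case treated separately.\<close>

lemma fps_fps_irreducible_imp_prime:
  fixes g :: "'a::field fps fps"
  assumes "irreducible g"
  shows "prime_elem g"
proof (rule prime_elemI)
  show "g \<noteq> 0" "\<not> g dvd 1" using assms by (auto simp: irreducible_def)
  fix a b assume gab: "g dvd a * b"
  note X = prime_elem_fps_X[where ?'a = "'a fps"]
  show "g dvd a \<or> g dvd b"
  proof (cases "g dvd fps_X")
    case True
    then obtain h where h: "fps_X = g * h" by (auto simp: dvd_def)
    have "irreducible (fps_X :: 'a fps fps)" using X by (rule idom_prime_elem_imp_irreducible)
    then have "h dvd 1" using h assms by (auto simp: irreducible_def)
    then have "fps_X dvd g" using h by (rule_tac dvd_of_eq_mult_unit)
    then have "fps_X dvd a * b" using gab by (rule dvd_trans)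
    then have "fps_X dvd a \<or> fps_X dvd b" using X by (simp add: prime_elem_dvd_mult_iff)
    then show ?thesis using True dvd_trans by blast
  next
    case gX: False
    have cancel: "g dvd b" if "g dvd fps_X ^ n * b" for n b
      using that
    proof (induction n arbitrary: b)
      case (Suc n)
      then obtain h where h: "fps_X * (fps_X ^ n * b) = g * h" by (auto simp: dvd_def mult_ac)
      have "fps_X dvd g * h" using h by (metis dvd_triv_left)
      moreover have "\<not> fps_X dvd g"
      proof
        assume "fps_X dvd g"
        then obtain k where k: "g = fps_X * k" by (auto simp: dvd_def)
        then have "k dvd 1" using assms X by (auto simp: irreducible_def prime_elem_def)
        then have "g dvd fps_X" using k by (rule_tac dvd_of_eq_mult_unit)
        then show False using gX by simp
      qed
      ultimately have "fps_X dvd h" using X by (simp add: prime_elem_dvd_mult_iff)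
      then obtain k where "h = fps_X * k" by (rule dvdE)
      then have "fps_X * (fps_X ^ n * b) = fps_X * (g * k)" using h by (simp add: mult_ac)
      then have "fps_X ^ n * b = g * k" by (simp add: fps_X_neq_zero)
      then show ?case using Suc.IH by simp
    qed simp
    define I where "I = {x. \<exists>n y z. fps_X ^ n * x = y * g + z * a}"
    have "\<exists>\<pi>\<in>I. \<forall>x\<in>I. \<pi> dvd x"
    proof (rule fps_saturated_ideal_principal)
      fix x x' assume "x \<in> I" "x' \<in> I"
      then obtain n y z n' y' z' where *: "fps_X ^ n * x = y * g + z * a" "fps_X ^ n' * x' = y' * g + z' * a"
        by (auto simp: I_def)
      have "fps_X ^ (n + n') * (x + x') = fps_X ^ n' * (fps_X ^ n * x) + fps_X ^ n * (fps_X ^ n' * x')"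
        by (simp add: algebra_simps power_add)
      also have "\<dots> = (fps_X ^ n' * y + fps_X ^ n * y') * g + (fps_X ^ n' * z + fps_X ^ n * z') * a"
        unfolding * by (simp add: algebra_simps)
      finally show "x + x' \<in> I" by (auto simp: I_def)
    next
      fix x c assume "x \<in> I"
      then obtain n y z where *: "fps_X ^ n * x = y * g + z * a" by (auto simp: I_def)
      have "fps_X ^ n * (c * x) = c * (fps_X ^ n * x)" by (simp add: algebra_simps)
      also have "\<dots> = (c * y) * g + (c * z) * a" unfolding * by (simp add: algebra_simps)
      finally show "c * x \<in> I" by (auto simp: I_def)
    next
      fix x assume "fps_X * x \<in> I"
      then obtain n y z where "fps_X ^ n * (fps_X * x) = y * g + z * a" by (auto simp: I_def)
      then have "fps_X ^ Suc n * x = y * g + z * a" by (simp add: mult_ac)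
      then show "x \<in> I" unfolding I_def by blast
    next
      have "fps_X ^ 0 * g = 1 * g + 0 * a" by simp
      then show "I \<noteq> {}" unfolding I_def by blast
    qed
    then obtain \<pi> where \<pi>: "\<pi> \<in> I" "\<And>x. x \<in> I \<Longrightarrow> \<pi> dvd x" by auto
    have "fps_X ^ 0 * g = 1 * g + 0 * a" "fps_X ^ 0 * a = 0 * g + 1 * a" by simp_all
    then have "g \<in> I" "a \<in> I" unfolding I_def by blast+
    then have "\<pi> dvd g" "\<pi> dvd a" using \<pi> by auto
    then obtain h where h: "g = \<pi> * h" by (auto simp: dvd_def)
    then have "\<pi> dvd 1 \<or> h dvd 1" using assms by (auto simp: irreducible_def)
    then show ?thesis
    proof
      assume "h dvd 1"
      then have "g dvd \<pi>" using h by (rule_tac dvd_of_eq_mult_unit)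
      then show ?thesis using \<open>\<pi> dvd a\<close> dvd_trans by blast
    next
      assume "\<pi> dvd 1"
      then obtain k where k: "1 = \<pi> * k" by (auto simp: dvd_def)
      obtain n y z where *: "fps_X ^ n * \<pi> = y * g + z * a" using \<pi>(1) by (auto simp: I_def)
      have "fps_X ^ n * b = (fps_X ^ n * \<pi>) * (k * b)" using k by (metis mult.assoc mult_1)
      also have "\<dots> = (y * k * b) * g + (z * k) * (a * b)" unfolding * by (simp add: algebra_simps)
      finally have "g dvd fps_X ^ n * b" using gab by simp
      then show ?thesis using cancel by blast
    qed
  qed
qed

text \<open>Not the total order of vanishing: for \<open>s + t ^ 2\<close> it is 2. It is the
  exponent sum of the lexicographically least monomial, hence additive on products and positive on
  nonzero non-units, which makes it a measure for factorization.\<close>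

definition fps2_order :: "'a::zero fps fps \<Rightarrow> nat" where
  "fps2_order F = subdegree F + subdegree (fps_nth F (subdegree F))"

lemma fps2_order_mult:
  fixes F G :: "'a::field fps fps"
  assumes "F \<noteq> 0" "G \<noteq> 0"
  shows "fps2_order (F * G) = fps2_order F + fps2_order G"
proof -
  have "fps_nth F (subdegree F) \<noteq> 0" "fps_nth G (subdegree G) \<noteq> 0" using assms by auto
  then show ?thesis
    using assms by (simp add: fps2_order_def subdegree_mult)
qed

lemma fps2_is_unit_iff: "(F :: 'a::field fps fps) dvd 1 \<longleftrightarrow> fps_nth (fps_nth F 0) 0 \<noteq> 0"
proof
  assume "F dvd 1"
  then obtain G where "1 = F * G" by (auto simp: dvd_def)
  then have "fps_nth (fps_nth (F * G) 0) 0 = 1" by simp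
  then show "fps_nth (fps_nth F 0) 0 \<noteq> 0" by auto
next
  assume "fps_nth (fps_nth F 0) 0 \<noteq> 0"
  then have "fps_nth F 0 * inverse (fps_nth F 0) = 1"
    by (simp add: inverse_mult_eq_1')
  then have "F * fps_right_inverse F (inverse (fps_nth F 0)) = 1"
    by (intro fps_right_inverse)
  then show "F dvd 1" by (metis dvd_triv_left)
qed

lemma fps2_order_pos:
  fixes F :: "'a::field fps fps"
  assumes "F \<noteq> 0" "\<not> F dvd 1"
  shows "fps2_order F > 0"
proof (rule ccontr)
  assume "\<not> fps2_order F > 0"
  then have "subdegree F = 0" "subdegree (fps_nth F 0) = 0" by (auto simp: fps2_order_def)
  moreover have "fps_nth F 0 \<noteq> 0" using assms(1) calculation(1) by (metis nth_subdegree_zero_iff)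
  ultimately have "fps_nth (fps_nth F 0) 0 \<noteq> 0" by (metis nth_subdegree_zero_iff)
  then show False using assms by (simp add: fps2_is_unit_iff)
qed

lemma fps2_irreducible_factor_exists:
  fixes F :: "'a::field fps fps"
  assumes "F \<noteq> 0" "\<not> F dvd 1"
  shows "\<exists>g. irreducible g \<and> g dvd F"
  using assms
proof (induction "fps2_order F" arbitrary: F rule: less_induct)
  case less
  show ?case
  proof (cases "irreducible F")
    case False
    then obtain a b where ab: "F = a * b" "\<not> a dvd 1" "\<not> b dvd 1"
      using less by (auto simp: irreducible_def)
    then have "a \<noteq> 0" "b \<noteq> 0" using less.prems by auto
    then have "fps2_order a < fps2_order F"
      using fps2_order_mult[of a b] fps2_order_pos[of b] ab by simp
    then have "\<exists>g. irreducible g \<and> g dvd a" using less.hyps[of a] \<open>a \<noteq> 0\<close> ab by simp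
    then show ?thesis using ab by auto
  qed auto
qed

text \<open>Split off an irreducible factor \<open>g\<close>. The rest divides \<open>H\<close> by
  induction and is not divisible by \<open>g\<close>, so the prime \<open>g\<close> must divide the
  cofactor.\<close>

lemma fps2_squarefree_dvd:
  fixes F H :: "'a::field fps fps"
  assumes "F \<noteq> 0"
    and "\<And>g. irreducible g \<Longrightarrow> g dvd F \<Longrightarrow> g dvd H"
    and "\<And>g. irreducible g \<Longrightarrow> \<not> g ^ 2 dvd F"
  shows "F dvd H"
  using assms
proof (induction "fps2_order F" arbitrary: F rule: less_induct)
  case less
  show ?case
  proof (cases "F dvd 1")
    case False
    then obtain g where g: "irreducible g" "g dvd F"
      using fps2_irreducible_factor_exists less.prems by blast
    then obtain F1 where F1: "F = g * F1" by (auto simp: dvd_def)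
    then have nz: "g \<noteq> 0" "F1 \<noteq> 0" using less.prems by auto
    have p: "prime_elem g" using g by (simp add: fps_fps_irreducible_imp_prime)
    have "fps2_order F1 < fps2_order F"
      using F1 nz fps2_order_mult[of g F1] fps2_order_pos[of g] p by (auto simp: prime_elem_def)
    then have "F1 dvd H"
    proof (rule less.hyps)
      fix h :: "'a fps fps" assume h: "irreducible h"
      { assume "h dvd F1"
        then have "h dvd F" using F1 by simp
        then show "h dvd H" using less.prems(2) h by blast }
      { have "F1 dvd F" using F1 by simp
        then show "\<not> h ^ 2 dvd F1" using less.prems(3)[OF h] dvd_trans by blast }
    qed (rule nz)
    then obtain H1 where H1: "H = F1 * H1" by (auto simp: dvd_def)
    have "g dvd F1 * H1" using less.prems(2) g H1 by simp
    moreover have "\<not> g dvd F1"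
      using less.prems(3)[OF g(1)] F1 by (simp add: power2_eq_square mult_dvd_mono)
    ultimately have "g dvd H1" using p by (simp add: prime_elem_dvd_mult_iff)
    then show ?thesis using F1 H1 by (simp add: mult.commute mult_dvd_mono)
  qed (use one_dvd dvd_trans in blast)
qed

section \<open>Products over the roots of a polynomial\<close>

text \<open>A property of functions, because a product over the roots of a varying polynomial is
  only given pointwise; closure under sums and products then yields the polynomial without writing
  it down.\<close>

definition poly_fun :: "(complex \<Rightarrow> complex) \<Rightarrow> bool" where
  "poly_fun f \<longleftrightarrow> (\<exists>R. \<forall>x. f x = poly R x)"

lemma poly_fun_const [intro]: "poly_fun (\<lambda>_. c)"
  unfolding poly_fun_def by (rule exI[of _ "[:c:]"]) simp

lemma poly_fun_ident [intro]: "poly_fun (\<lambda>x. x)"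
  unfolding poly_fun_def by (rule exI[of _ "[:0, 1:]"]) simp

lemma poly_fun_add [intro]: "poly_fun f \<Longrightarrow> poly_fun g \<Longrightarrow> poly_fun (\<lambda>x. f x + g x)"
  unfolding poly_fun_def by (metis poly_add)

lemma poly_fun_mult [intro]: "poly_fun f \<Longrightarrow> poly_fun g \<Longrightarrow> poly_fun (\<lambda>x. f x * g x)"
  unfolding poly_fun_def by (metis poly_mult)

lemma poly_fun_cmult [intro]: "poly_fun f \<Longrightarrow> poly_fun (\<lambda>x. c * f x)"
  by (intro poly_fun_mult poly_fun_const)

lemma poly_fun_minus [intro]: "poly_fun f \<Longrightarrow> poly_fun (\<lambda>x. - f x)"
  using poly_fun_cmult[of f "-1"] by simp

lemma poly_fun_sum [intro]: "(\<And>i. i \<in> I \<Longrightarrow> poly_fun (f i)) \<Longrightarrow> poly_fun (\<lambda>x. \<Sum>i\<in>I. f i x)"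
  by (induction I rule: infinite_finite_induct) auto

text \<open>The reversed monic polynomial with root multiset \<open>A\<close>: its coefficients are,
  up to sign, the elementary symmetric functions.\<close>

definition newton_prod :: "complex multiset \<Rightarrow> complex fps" where
  "newton_prod A = (\<Prod>a\<in>#A. 1 - fps_const a * fps_X)"

text \<open>The series of the sums of \<open>a * X / (1 - a * X)\<close>, which is why its constant
  coefficient is 0 and not the size of \<open>A\<close>.\<close>

definition power_sums :: "complex multiset \<Rightarrow> complex fps" where
  "power_sums A = Abs_fps (\<lambda>k. if k = 0 then 0 else \<Sum>a\<in>#A. a ^ k)"

text \<open>The logarithmic derivative of \<open>\<Prod>(1 - a X)\<close>.\<close>

lemma newton_identity: "fps_X * fps_deriv (newton_prod A) = - newton_prod A * power_sums A"
proof (induction A)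
  case empty
  have "power_sums {#} = 0" by (intro fps_ext) (simp add: power_sums_def)
  then show ?case by (simp add: newton_prod_def)
next
  case (add a A)
  define G where "G = Abs_fps (\<lambda>k. if k = 0 then 0 else a ^ k)"
  have P: "power_sums (add_mset a A) = G + power_sums A"
    by (intro fps_ext) (simp add: power_sums_def G_def)
  have E: "newton_prod (add_mset a A) = (1 - fps_const a * fps_X) * newton_prod A"
    by (simp add: newton_prod_def)
  have G: "(1 - fps_const a * fps_X) * G = fps_const a * fps_X"
  proof (rule fps_ext)
    fix n show "fps_nth ((1 - fps_const a * fps_X) * G) n = fps_nth (fps_const a * fps_X) n"
      by (cases n) (auto simp: G_def algebra_simps fps_mult_fps_X_deriv_shift simp flip: fps_mult_right_const_nth)
  qed
  have "fps_X * fps_deriv (newton_prod (add_mset a A))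
      = - (fps_const a * fps_X) * newton_prod A + (1 - fps_const a * fps_X) * (fps_X * fps_deriv (newton_prod A))"
    by (simp add: E algebra_simps)
  also have "\<dots> = - (1 - fps_const a * fps_X) * newton_prod A * (G + power_sums A)"
  proof -
    have "- (1 - fps_const a * fps_X) * newton_prod A * (G + power_sums A)
        = - ((1 - fps_const a * fps_X) * G) * newton_prod A
          - (1 - fps_const a * fps_X) * (newton_prod A * power_sums A)"
      by (simp add: algebra_simps)
    then show ?thesis unfolding add.IH G by simp
  qed
  finally show ?case unfolding P E by (simp only: mult_minus_left)
qed

lemma newton_prod_nth_0: "fps_nth (newton_prod A) 0 = 1"
  by (induction A) (auto simp: newton_prod_def)

lemma newton_identity_nth:
  "of_nat n * fps_nth (newton_prod A) n
     = - (\<Sum>k<n. fps_nth (newton_prod A) k * fps_nth (power_sums A) (n - k))"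
proof -
  have "of_nat n * fps_nth (newton_prod A) n = fps_nth (fps_X * fps_deriv (newton_prod A)) n"
    by (cases n) auto
  also have "\<dots> = - (\<Sum>k\<in>{0..n}. fps_nth (newton_prod A) k * fps_nth (power_sums A) (n - k))"
    by (subst newton_identity) (simp add: fps_mult_nth sum_negf)
  also have "{0..n} = insert n {..<n}" by auto
  finally show ?thesis by (simp add: power_sums_def)
qed

lemma poly_fun_power_sums:
  assumes "\<And>k. poly_fun (\<lambda>x. fps_nth (newton_prod (A x)) k)"
  shows "poly_fun (\<lambda>x. fps_nth (power_sums (A x)) n)"
proof (induction n rule: less_induct)
  case (less n)
  show ?case
  proof (cases "n = 0")
    case True
    then show ?thesis by (simp add: power_sums_def poly_fun_const)
  next
    case False
    \<comment> \<open>Newton's identity solved for the term \<open>k = 0\<close>, in which the power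
      sum has coefficient 1.\<close>
    have eq: "fps_nth (power_sums (A x)) n = - (of_nat n * fps_nth (newton_prod (A x)) n)
       + - (\<Sum>k\<in>{0<..<n}. fps_nth (newton_prod (A x)) k * fps_nth (power_sums (A x)) (n - k))" for x
    proof -
      have *: "{..<n} = insert 0 {0<..<n}" using False by auto
      show ?thesis
        by (subst newton_identity_nth, subst *) (simp add: newton_prod_nth_0)
    qed
    show ?thesis unfolding eq
      by (intro poly_fun_add poly_fun_minus poly_fun_cmult poly_fun_sum poly_fun_mult assms less) auto
  qed
qed

lemma poly_fun_newton_prod:
  assumes "\<And>k. poly_fun (\<lambda>x. fps_nth (power_sums (A x)) k)"
  shows "poly_fun (\<lambda>x. fps_nth (newton_prod (A x)) n)"
proof (induction n rule: less_induct)
  case (less n)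
  show ?case
  proof (cases "n = 0")
    case True
    then show ?thesis by (simp add: newton_prod_nth_0 poly_fun_const)
  next
    case False
    \<comment> \<open>The same identity read in the other direction; characteristic 0 allows the
      division by \<open>n\<close>.\<close>
    have eq: "fps_nth (newton_prod (A x)) n = inverse (of_nat n) *
       (- (\<Sum>k\<in>{..<n}. fps_nth (newton_prod (A x)) k * fps_nth (power_sums (A x)) (n - k)))" for x
      using newton_identity_nth[of n "A x"] False by (simp add: field_simps)
    show ?thesis unfolding eq
      by (intro poly_fun_add poly_fun_minus poly_fun_cmult poly_fun_sum poly_fun_mult assms less) auto
  qed
qed

lemma degree_prod_mset_linear: "degree (\<Prod>a\<in>#A. [:- a, 1::complex:]) = size A"
proof (induction A)
  case (add a A)
  have "(\<Prod>a\<in>#A. [:- a, 1::complex:]) \<noteq> 0" by (auto simp: prod_mset_zero_iff)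
  with add show ?case by (simp add: degree_mult_eq del: mult_pCons_left)
qed simp

lemma newton_prod_nth:
  "fps_nth (newton_prod A) n = (if n \<le> size A then coeff (\<Prod>a\<in>#A. [:- a, 1:]) (size A - n) else 0)"
proof -
  have "newton_prod A = fps_of_poly (reflect_poly (\<Prod>a\<in>#A. [:- a, 1:]))"
  proof (induction A)
    case (add a A)
    have "reflect_poly [:- a, 1:] = [:1, - a:]"
      by (rule poly_eqI) (auto simp: coeff_reflect_poly coeff_pCons split: nat.splits)
    with add show ?case
      by (simp add: newton_prod_def reflect_poly_mult fps_of_poly_mult fps_of_poly_pCons
            del: mult_pCons_left)
  qed (simp add: newton_prod_def)
  then show ?thesis by (simp add: coeff_reflect_poly degree_prod_mset_linear)
qed

text \<open>Symmetric functions take the place of a resultant. The coefficients of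
  \<open>F x\<close> give the power sums of the roots; expanding the powers of \<open>S x\<close>
  gives the power sums of the values at the roots; Newton's identities backwards give their
  elementary symmetric functions, the top one being the product up to sign. The fixed degree and
  leading coefficient keep the number of roots constant and the division by \<open>L\<close>
  harmless.\<close>

lemma poly_fun_prod_roots:
  assumes F: "\<And>x. degree (F x) = e" "\<And>x. lead_coeff (F x) = L" "L \<noteq> 0"
      "\<And>n. poly_fun (\<lambda>x. coeff (F x) n)"
    and S: "\<And>x. degree (S x) \<le> D" "\<And>n. poly_fun (\<lambda>x. coeff (S x) n)"
  shows "poly_fun (\<lambda>x. \<Prod>y\<in>#proots (F x). poly (S x) y)"
proof -
  define A where "A = (\<lambda>x. proots (F x))"
  have size: "size (A x) = e" for x unfolding A_def by (simp add: size_proots_complex F)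
  have "smult L (\<Prod>y\<in>#A x. [:- y, 1:]) = F x" for x
    using complex_poly_decompose_multiset[of "F x"] F by (simp add: A_def)
  then have coeff: "coeff (\<Prod>y\<in>#A x. [:- y, 1:]) n = inverse L * coeff (F x) n" for x n
    using F(3) by (metis coeff_smult inverse_nonzero_iff_nonzero left_inverse mult.assoc mult_1)
  have "poly_fun (\<lambda>x. fps_nth (newton_prod (A x)) k)" for k
    unfolding newton_prod_nth size coeff
    by (cases "k \<le> e") (auto intro: F(4))
  then have ps: "poly_fun (\<lambda>x. fps_nth (power_sums (A x)) n)" for n by (rule poly_fun_power_sums)
  have ps': "poly_fun (\<lambda>x. \<Sum>y\<in>#A x. y ^ n)" for n
  proof (cases "n = 0")
    case True
    then show ?thesis by (simp add: size poly_fun_const)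
  next
    case False
    then show ?thesis using ps[of n] by (simp add: power_sums_def)
  qed
  define B where "B = (\<lambda>x. image_mset (poly (S x)) (A x))"
  have coeff_power: "poly_fun (\<lambda>x. coeff (S x ^ k) n)" for k n
  proof (induction k arbitrary: n)
    case (Suc k)
    then show ?case by (simp add: coeff_mult) (intro poly_fun_sum poly_fun_mult S)
  qed (auto simp: poly_fun_const)
  have "poly_fun (\<lambda>x. fps_nth (power_sums (B x)) k)" for k
  proof (cases "k = 0")
    case True
    then show ?thesis by (simp add: power_sums_def poly_fun_const)
  next
    case False
    have "(\<Sum>b\<in>#B x. b ^ k) = (\<Sum>n\<le>k * D. coeff (S x ^ k) n * (\<Sum>y\<in>#A x. y ^ n))" for x
    proof -
      have "degree (S x ^ k) \<le> k * D"
        using degree_power_le[of "S x" k] S(1)[of x] by (metis le_trans mult.commute mult_le_mono1)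
      then have "poly (S x ^ k) y = (\<Sum>n\<le>k * D. coeff (S x ^ k) n * y ^ n)" for y
        unfolding poly_altdef by (intro sum.mono_neutral_left) (auto simp: coeff_eq_0)
      then have "(\<Sum>b\<in>#B x. b ^ k) = (\<Sum>y\<in>#A x. \<Sum>n\<le>k * D. coeff (S x ^ k) n * y ^ n)"
        by (simp add: B_def image_mset.compositionality o_def)
      also have "\<dots> = (\<Sum>n\<le>k * D. coeff (S x ^ k) n * (\<Sum>y\<in>#A x. y ^ n))"
      proof -
        have "(\<Sum>y\<in>#M. \<Sum>n\<le>k * D. coeff (S x ^ k) n * y ^ n)
            = (\<Sum>n\<le>k * D. coeff (S x ^ k) n * (\<Sum>y\<in>#M. y ^ n))" for M
          by (induction M) (simp_all add: sum.distrib distrib_left)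
        then show ?thesis .
      qed
      finally show ?thesis .
    qed
    then show ?thesis using False
      by (simp add: power_sums_def) (intro poly_fun_sum poly_fun_mult coeff_power ps')
  qed
  then have "poly_fun (\<lambda>x. fps_nth (newton_prod (B x)) e)" by (rule poly_fun_newton_prod)
  moreover have "fps_nth (newton_prod (B x)) e = (-1) ^ e * (\<Prod>y\<in>#A x. poly (S x) y)" for x
  proof -
    have "fps_nth (newton_prod (B x)) e = poly (\<Prod>b\<in>#B x. [:- b, 1:]) 0"
      by (subst newton_prod_nth) (simp add: B_def size poly_0_coeff_0)
    also have "\<dots> = (\<Prod>b\<in>#B x. (-1) * b)" by (simp add: poly_prod_mset)
    also have "\<dots> = (-1) ^ size (B x) * (\<Prod>b\<in>#B x. b)" by (simp only: prod_mset.distrib) simp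
    finally show ?thesis by (simp add: B_def size)
  qed
  ultimately have "poly_fun (\<lambda>x. (-1) ^ e * (\<Prod>y\<in>#A x. poly (S x) y))" by simp
  then have "poly_fun (\<lambda>x. (-1) ^ e * ((-1) ^ e * (\<Prod>y\<in>#A x. poly (S x) y)))"
    by (rule poly_fun_cmult)
  moreover have "(-1) ^ e * ((-1) ^ e * t) = t" for t :: complex
    by (simp add: mult.assoc[symmetric] flip: power_mult_distrib)
  ultimately show ?thesis by (simp add: A_def)
qed

section \<open>Unique factorization of polynomials in three variables\<close>

text \<open>Over a domain only pseudo-division is available. A nonzero element of least degree in
  the ideal leaves pseudo-remainder 0, so it divides both generators after multiplication by the
  constants \<open>c\<close> and \<open>d\<close>.\<close>

lemma poly_ideal_min_degree:
  fixes f g :: "'a::idom poly"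
  assumes "f \<noteq> 0 \<or> g \<noteq> 0"
  shows "\<exists>h u v c d q r. h \<noteq> 0 \<and> h = u * f + v * g \<and> c \<noteq> 0 \<and> d \<noteq> 0 \<and>
    smult c f = h * q \<and> smult d g = h * r"
proof -
  define P where "P = (\<lambda>h. h \<noteq> 0 \<and> (\<exists>u v. h = u * f + v * g))"
  have "P f \<or> P g"
  proof -
    have "f = 1 * f + 0 * g" "g = 0 * f + 1 * g" by simp_all
    then show ?thesis using assms unfolding P_def by blast
  qed
  then obtain h where h: "P h" "\<And>k. P k \<Longrightarrow> degree h \<le> degree k"
    using ex_has_least_nat[of P _ degree] by blast
  then obtain u v where uv: "h \<noteq> 0" "h = u * f + v * g" by (auto simp: P_def)
  have div: "\<exists>c q. c \<noteq> 0 \<and> smult c k = h * q" if k: "k = s * f + t * g" for k s t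
  proof -
    obtain c q where c: "c \<noteq> 0" "smult c k = h * q + pseudo_mod k h"
      using pseudo_mod(1)[OF uv(1), of k] by blast
    have "pseudo_mod k h = smult c k - h * q" using c(2) by simp
    also have "\<dots> = (smult c s - q * u) * f + (smult c t - q * v) * g"
      unfolding k by (subst uv(2)) (simp add: algebra_simps smult_add_right)
    finally have "pseudo_mod k h = 0 \<or> P (pseudo_mod k h)" unfolding P_def by blast
    then have "pseudo_mod k h = 0"
      using pseudo_mod(2)[OF uv(1), of k] h(2)[of "pseudo_mod k h"] by auto
    then show ?thesis using c by auto
  qed
  have "f = 1 * f + 0 * g" "g = 0 * f + 1 * g" by simp_all
  with div[of f 1 0] div[of g 0 1] uv show ?thesis by blast
qed

text \<open>Let \<open>h\<close> be an ideal element of least degree, with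
  \<open>smult c f = h * q\<close>. If \<open>f\<close> divided \<open>h\<close>, it would divide
  \<open>g\<close> up to a constant, and a prime of positive degree divides no nonzero constant.
  Hence \<open>f\<close> divides \<open>q\<close>, and \<open>h\<close> is a factor of the constant
  \<open>c\<close>.\<close>

lemma prime_poly_bezout:
  fixes f g :: "'a::idom poly"
  assumes f: "prime_elem f" "degree f > 0" and g: "\<not> f dvd g"
  shows "\<exists>u v D. D \<noteq> 0 \<and> u * f + v * g = [:D:]"
proof -
  have f0: "f \<noteq> 0" using f by auto
  then obtain h u v c d q r where h: "h \<noteq> 0" "h = u * f + v * g" "c \<noteq> 0" "d \<noteq> 0"
      "smult c f = h * q" "smult d g = h * r"
    using poly_ideal_min_degree[of f g] by blast
  have const: "\<not> f dvd [:a:]" if "a \<noteq> 0" for a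
    using f(2) that dvd_imp_degree_le[of f "[:a:]"] by auto
  have "\<not> f dvd h"
  proof
    assume "f dvd h"
    then have "f dvd smult d g" using h(6) by simp
    then have "f dvd [:d:] * g" by simp
    then show False using f(1) const[OF h(4)] g by (metis prime_elem_dvd_mult_iff)
  qed
  moreover have "f dvd h * q" using h(5) by (metis dvd_smult dvd_refl)
  ultimately have "f dvd q" using f(1) by (simp add: prime_elem_dvd_mult_iff)
  then obtain k where k: "q = f * k" by (rule dvdE)
  have "f * [:c:] = f * (h * k)" using h(5) k by (simp add: mult_ac)
  then have "[:c:] = h * k" using f0 by (metis mult_left_cancel)
  then have "degree (h * k) = 0" "h * k \<noteq> 0" using h(3) by (metis degree_pCons_0, metis pCons_eq_0_iff)
  then have "degree h = 0" by (metis add_is_0 degree_mult_eq mult_zero_left mult_zero_right)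
  then obtain D where "h = [:D:]" by (rule degree_eq_zeroE)
  with h show ?thesis by (intro exI[of _ u] exI[of _ v] exI[of _ D]) auto
qed

section \<open>Three variables as iterated univariate polynomials\<close>

lemma ring_hom1_map_poly:
  assumes "ring_hom1 h"
  shows "ring_hom1 (map_poly h)"
proof (rule ring_hom1I)
  show "map_poly h 1 = 1" by (simp add: one_pCons map_poly_pCons hom_simps[OF assms])
qed (auto intro!: poly_eqI simp: coeff_map_poly coeff_mult hom_simps[OF assms])

lemma ring_hom1_poly_ext:
  assumes "ring_hom1 g" "ring_hom1 h" "\<And>a. g [:a:] = h [:a:]" "g [:0, 1:] = h [:0, 1:]"
  shows "g q = h q"
proof (induction q)
  case 0
  then show ?case by (simp add: hom_zero assms(1,2))
next
  case (pCons a q)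
  have "pCons a q = [:a:] + [:0, 1:] * q" by simp
  then show ?case using pCons assms by (simp add: hom_add hom_mult del: mult_pCons_left)
qed

text \<open>Transfers forms to a ring that is already known to be factorial. The matrix is left free
  so that the outermost variable, which gets the third column, can be the direction of a
  projection.\<close>

definition nest :: "complex ^ 3 ^ 3 \<Rightarrow> 3 cpoly \<Rightarrow> complex poly poly poly" where
  "nest M = psubst (\<lambda>c. [:[:[:c:]:]:])
     (\<lambda>i. [:[:[:M $ i $ 1:]:]:] * [:[:[:0, 1:]:]:] + [:[:[:M $ i $ 2:]:]:] * [:[:0, 1:]:]
        + [:[:[:M $ i $ 3:]:]:] * [:0, 1:])"

definition unnest :: "complex ^ 3 ^ 3 \<Rightarrow> complex poly poly poly \<Rightarrow> 3 cpoly" where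
  "unnest W G = (let l = (\<lambda>i. \<Sum>j\<in>UNIV. pconst (W $ i $ j) * pvar j) in
     poly (map_poly (\<lambda>q. poly (map_poly (\<lambda>r. poly (map_poly pconst r) (l 1)) q) (l 2)) G) (l 3))"

lemma ring_hom1_const3: "ring_hom1 (\<lambda>c. [:[:[:c:]:]:])"
  by (intro ring_hom1_compose[OF ring_hom1_const_poly] ring_hom1_const_poly)

lemma ring_hom1_nest: "ring_hom1 (nest M)"
  unfolding nest_def by (rule ring_hom1_psubst[OF ring_hom1_const3])

lemma ring_hom1_pev: "ring_hom1 h \<Longrightarrow> ring_hom1 (\<lambda>q. poly (map_poly h q) y)"
  by (rule ring_hom1_compose[OF ring_hom1_poly ring_hom1_map_poly])

lemma ring_hom1_unnest: "ring_hom1 (unnest W)"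
  unfolding unnest_def Let_def by (intro ring_hom1_pev ring_hom1_pconst)

lemma unnest_simps:
  "unnest W [:[:[:c:]:]:] = pconst c"
  "unnest W [:[:[:0, 1:]:]:] = (\<Sum>j\<in>UNIV. pconst (W $ 1 $ j) * pvar j)"
  "unnest W [:[:0, 1:]:] = (\<Sum>j\<in>UNIV. pconst (W $ 2 $ j) * pvar j)"
  "unnest W [:0, 1:] = (\<Sum>j\<in>UNIV. pconst (W $ 3 $ j) * pvar j)"
  by (simp_all add: unnest_def map_poly_pCons hom_simps[OF ring_hom1_pconst] one_pCons)

lemma unnest_nest:
  assumes "M ** W = mat 1"
  shows "unnest W (nest M F) = F"
proof -
  have "(\<Sum>k\<in>UNIV. M $ i $ k * W $ k $ j) = (if i = j then 1 else 0)" for i j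
    using assms by (simp add: matrix_matrix_mult_def mat_def vec_eq_iff)
  then have MW: "M $ i $ 1 * W $ 1 $ j + M $ i $ 2 * W $ 2 $ j + M $ i $ 3 * W $ 3 $ j = (if i = j then 1 else 0)" for i j
    by (simp add: sum_3)
  have "unnest W ([:[:[:M $ i $ 1:]:]:] * [:[:[:0, 1:]:]:] + [:[:[:M $ i $ 2:]:]:] * [:[:0, 1:]:]
        + [:[:[:M $ i $ 3:]:]:] * [:0, 1:])
      = (\<Sum>j\<in>UNIV. (pconst (M $ i $ 1 * W $ 1 $ j + M $ i $ 2 * W $ 2 $ j + M $ i $ 3 * W $ 3 $ j)) * pvar j)" for i
    unfolding hom_add[OF ring_hom1_unnest] hom_mult[OF ring_hom1_unnest] unnest_simps
    unfolding hom_add[OF ring_hom1_pconst] hom_mult[OF ring_hom1_pconst] sum_3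
    by (simp only: distrib_left distrib_right mult.assoc add_ac)
  also have "\<dots> i = pvar i" for i
  proof -
    have "(\<Sum>j\<in>UNIV. pconst (if i = j then 1 else 0) * pvar j) = (\<Sum>j\<in>UNIV. if i = j then pvar j else 0)" for i :: 3
      by (intro sum.cong refl) (auto simp: hom_zero[OF ring_hom1_pconst] hom_one[OF ring_hom1_pconst])
    then show ?thesis unfolding MW by simp
  qed
  finally show ?thesis
    unfolding nest_def by (subst hom_psubst[OF ring_hom1_unnest]) (simp add: unnest_simps(1))
qed

lemma nest_unnest:
  assumes "W ** M = mat 1"
  shows "nest M (unnest W G) = G"
proof -
  have WM: "(\<Sum>k\<in>UNIV. W $ i $ k * M $ k $ j) = (if i = j then 1 else 0)" for i j
    using assms by (simp add: matrix_matrix_mult_def mat_def vec_eq_iff)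
  have c: "nest M (pconst a) = [:[:[:a:]:]:]" for a
    unfolding nest_def by (rule psubst_pconst[OF ring_hom1_const3])
  have v: "nest M (pvar i) = [:[:[:M $ i $ 1:]:]:] * [:[:[:0, 1:]:]:] + [:[:[:M $ i $ 2:]:]:] * [:[:0, 1:]:]
        + [:[:[:M $ i $ 3:]:]:] * [:0, 1:]" for i
    unfolding nest_def by (rule psubst_pvar[OF ring_hom1_const3])
  define cc where "cc = (\<lambda>c::complex. [:[:[:c:]:]:])"
  have cc: "ring_hom1 cc" unfolding cc_def by (rule ring_hom1_const3)
  have ccf: "[:[:[:c:]:]:] = cc c" for c by (simp add: cc_def)
  have l: "nest M (\<Sum>j\<in>UNIV. pconst (W $ i $ j) * pvar j)
      = cc (\<Sum>j\<in>UNIV. W $ i $ j * M $ j $ 1) * [:[:[:0, 1:]:]:]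
      + cc (\<Sum>j\<in>UNIV. W $ i $ j * M $ j $ 2) * [:[:0, 1:]:]
      + cc (\<Sum>j\<in>UNIV. W $ i $ j * M $ j $ 3) * [:0, 1:]" for i
    unfolding sum_3 hom_add[OF ring_hom1_nest] hom_mult[OF ring_hom1_nest] c v ccf
      hom_add[OF cc] hom_mult[OF cc]
    by (simp only: distrib_left distrib_right mult.assoc add_ac)
  have cc01: "cc 0 = 0" "cc 1 = 1" by (simp_all add: hom_simps[OF cc])
  note h = ring_hom1_compose[OF ring_hom1_nest ring_hom1_unnest]
  note h1 = ring_hom1_compose[OF h ring_hom1_const_poly]
  note h2 = ring_hom1_compose[OF h1 ring_hom1_const_poly]
  have 1: "nest M (unnest W [:[:r:]:]) = [:[:r:]:]" for r
    using ring_hom1_poly_ext[of "\<lambda>r. nest M (unnest W [:[:r:]:])" "\<lambda>r. [:[:r:]:]" r, OF h2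
        ring_hom1_compose[OF ring_hom1_const_poly ring_hom1_const_poly]]
    by (simp only: unnest_simps c l WM cc01) (simp add: cc01)
  have 2: "nest M (unnest W [:q:]) = [:q:]" for q
    using ring_hom1_poly_ext[of "\<lambda>r. nest M (unnest W [:r:])" "\<lambda>r. [:r:]" q, OF h1
        ring_hom1_const_poly]
    by (simp only: unnest_simps 1 l WM cc01) (simp add: cc01)
  show ?thesis
    using ring_hom1_poly_ext[of "\<lambda>r. nest M (unnest W r)" "\<lambda>r. r" G, OF h ring_hom1_ident]
    by (simp only: unnest_simps 2 l WM cc01) (simp add: cc01)
qed

text \<open>\<open>nest\<close> and \<open>unnest\<close> are mutually inverse, so irreducibility
  passes to the iterated polynomial ring, where it implies primality.\<close>

lemma prime_elem_nest:
  assumes "irreducible f" "M ** W = mat 1" "W ** M = mat 1"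
  shows "prime_elem (nest M f)"
proof -
  have inj: "nest M F = 0 \<longleftrightarrow> F = 0" for F
    using unnest_nest[OF assms(2), of F] hom_zero[OF ring_hom1_unnest, of W] hom_zero[OF ring_hom1_nest, of M] by metis
  have "irreducible (nest M f)"
  proof (rule irreducibleI)
    show "nest M f \<noteq> 0" using inj assms(1) by (auto simp: irreducible_def)
    show "\<not> nest M f dvd 1"
      using hom_dvd[OF ring_hom1_unnest, of "nest M f" 1 W] assms(1)
      by (auto simp: unnest_nest[OF assms(2)] hom_one[OF ring_hom1_unnest] irreducible_def)
    fix a b assume ab: "nest M f = a * b"
    then have "f = unnest W a * unnest W b"
      using unnest_nest[OF assms(2), of f] by (simp add: hom_mult[OF ring_hom1_unnest])
    then have "unnest W a dvd 1 \<or> unnest W b dvd 1" using assms(1) by (auto simp: irreducible_def)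
    then show "a dvd 1 \<or> b dvd 1"
      using hom_dvd[OF ring_hom1_nest, of _ 1 M] by (metis hom_one ring_hom1_nest nest_unnest assms(3))
  qed
  then show ?thesis by (rule irreducible_imp_prime_elem)
qed

lemma irreducible_imp_prime_elem_cpoly3:
  assumes "irreducible (f :: 3 cpoly)"
  shows "prime_elem f"
proof -
  let ?I = "mat 1 :: complex ^ 3 ^ 3"
  have I: "?I ** ?I = mat 1" by simp
  have p: "prime_elem (nest ?I f)" using assms I I by (rule prime_elem_nest)
  have dvd: "a dvd b" if "nest ?I a dvd nest ?I b" for a b
    using hom_dvd[OF ring_hom1_unnest that, of ?I] by (simp add: unnest_nest[OF I])
  show ?thesis
  proof (rule prime_elemI)
    fix a b assume "f dvd a * b"
    then have "nest ?I f dvd nest ?I a * nest ?I b"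
      using hom_dvd[OF ring_hom1_nest, of f "a * b" ?I] by (simp add: hom_mult[OF ring_hom1_nest])
    then show "f dvd a \<or> f dvd b" using p dvd by (metis prime_elem_dvd_mult_iff)
  qed (use assms in \<open>auto simp: irreducible_def\<close>)
qed

lemma nest_eval:
  "poly (poly (poly (nest M F) [:[:y:]:]) [:x:]) z = peval F (M *v vector [z, x, y])"
proof -
  have h: "ring_hom1 (\<lambda>G. poly (poly (poly G [:[:y:]:]) [:x:]) z)"
    by (intro ring_hom1_compose[OF ring_hom1_poly] ring_hom1_poly)
  show ?thesis
    unfolding nest_def peval_def
    by (subst hom_psubst[OF h])
      (auto intro!: arg_cong[where f = "\<lambda>x. psubst (\<lambda>a. a) x F"] simp: matrix_vector_mult_def sum_3 mult_ac add_ac)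
qed

text \<open>Elimination of the last coordinate: if \<open>f\<close> does not divide
  \<open>S\<close>, a combination of the two is a nonzero polynomial \<open>D\<close> in the first
  two coordinates. A common zero over every pair with \<open>z\<close> nonzero forces
  \<open>D\<close> to vanish there, hence identically.\<close>

lemma common_root_imp_dvd:
  fixes M W :: "complex ^ 3 ^ 3"
  assumes f: "irreducible f" "homogeneous e f" "e > 0"
    and M: "M ** W = mat 1" "W ** M = mat 1"
    and b: "peval f (M *v vector [0, 0, 1]) \<noteq> 0"
    and root: "\<And>z x. z \<noteq> 0 \<Longrightarrow> \<exists>y. peval f (M *v vector [z, x, y]) = 0 \<and> peval S (M *v vector [z, x, y]) = 0"
  shows "f dvd S"
proof (rule ccontr)
  assume ndvd: "\<not> f dvd S"
  have "\<not> nest M f dvd nest M S"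
    using hom_dvd[OF ring_hom1_unnest, of "nest M f" "nest M S" W] ndvd by (auto simp: unnest_nest[OF M(1)])
  moreover have "degree (nest M f) > 0"
  proof (rule ccontr)
    assume "\<not> degree (nest M f) > 0"
    then obtain D where D: "nest M f = [:D:]" by (auto elim: degree_eq_zeroE)
    \<comment> \<open>Without the last variable, \<open>f\<close> takes the same value at the third
      basis vector and at the origin, where a form of positive degree vanishes.\<close>
    have "peval f (M *v vector [0, 0, y]) = poly (poly D [:0:]) 0" for y
      unfolding nest_eval[symmetric] D by simp
    from this[of 0] this[of 1] have "peval f (M *v vector [0, 0, 0]) \<noteq> 0" using b by simp
    moreover have "(vector [0, 0, 0] :: complex ^ 3) = 0 *s 0" by (simp add: vec_eq_iff forall_3)
    ultimately show False
      using peval_scale[OF f(2), of 0 0] f(3) by (simp add: zero_power)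
  qed
  ultimately obtain u v D where D: "D \<noteq> 0" "u * nest M f + v * nest M S = [:D:]"
    using prime_poly_bezout[OF prime_elem_nest[OF f(1) M]] by blast
  have ev: "poly (poly D [:x:]) z = 0" if z: "z \<noteq> 0" for x z
  proof -
    obtain y where y: "peval f (M *v vector [z, x, y]) = 0" "peval S (M *v vector [z, x, y]) = 0"
      using root[OF z, of x] by blast
    have "poly (poly D [:x:]) z = poly (poly (poly [:D:] [:[:y:]:]) [:x:]) z" by simp
    also have "\<dots> = 0" unfolding D(2)[symmetric] by (simp add: nest_eval y)
    finally show ?thesis .
  qed
  have "poly D [:x:] = 0" for x
  proof (rule ccontr)
    assume "poly D [:x:] \<noteq> 0"
    then have "finite {z. poly (poly D [:x:]) z = 0}" by (rule poly_roots_finite)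
    moreover have "- {0} \<subseteq> {z. poly (poly D [:x:]) z = 0}" using ev by auto
    moreover have "infinite (- {0::complex})" by (simp add: infinite_UNIV_char_0)
    ultimately show False using finite_subset by blast
  qed
  then have "range (\<lambda>x. [:x:]) \<subseteq> {q. poly D q = 0}" by auto
  moreover have "infinite (range (\<lambda>x::complex. [:x:]))"
    using finite_imageD[of "\<lambda>x::complex. [:x:]" UNIV] by (auto simp: inj_def infinite_UNIV_char_0)
  ultimately show False using poly_roots_finite[OF D(1)] finite_subset by blast
qed

section \<open>A Liouville theorem on plane curves\<close>

lemma homogeneous_iff:
  "homogeneous n F \<longleftrightarrow> (\<forall>m\<in>Poly_Mapping.keys F. (\<Sum>i\<in>UNIV. Poly_Mapping.lookup m i) = n)"
  by (simp add: homogeneous_def weighted_homogeneous_def)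

lemma homogeneous_add: "homogeneous n F \<Longrightarrow> homogeneous n G \<Longrightarrow> homogeneous n (F + G)"
  unfolding homogeneous_iff using Poly_Mapping.keys_add[of F G] by blast

lemma homogeneous_mult:
  assumes "homogeneous n F" "homogeneous k G"
  shows "homogeneous (n + k) (F * G)"
  unfolding homogeneous_iff
proof
  fix m assume "m \<in> Poly_Mapping.keys (F * G)"
  then obtain a b where "m = a + b" "a \<in> Poly_Mapping.keys F" "b \<in> Poly_Mapping.keys G"
    using keys_mult[of F G] by blast
  then show "(\<Sum>i\<in>UNIV. Poly_Mapping.lookup m i) = n + k"
    using assms by (simp add: homogeneous_iff lookup_add sum.distrib)
qed

lemma homogeneous_pconst: "homogeneous 0 (pconst c)"
  by (auto simp: homogeneous_iff pconst_def)

lemma homogeneous_pvar: "homogeneous 1 (pvar i)"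
  by (auto simp: homogeneous_iff pvar_def lookup_single when_def)

lemma homogeneous_power: "homogeneous n F \<Longrightarrow> homogeneous (k * n) (F ^ k)"
proof (induction k)
  case 0
  then show ?case using homogeneous_pconst[of 1] by (simp add: hom_one[OF ring_hom1_pconst])
next
  case (Suc k)
  then show ?case using homogeneous_mult[of n F "k * n" "F ^ k"] by simp
qed

lemma homogeneous_diff_cmult:
  assumes "homogeneous n F" "homogeneous n G"
  shows "homogeneous n (F - pconst c * G)"
proof -
  have "F - pconst c * G = F + pconst (- c) * G" by (simp add: hom_minus[OF ring_hom1_pconst])
  moreover have "homogeneous (0 + n) (pconst (- c) * G)" by (intro homogeneous_mult homogeneous_pconst assms)
  ultimately show ?thesis using homogeneous_add[OF assms(1)] by (metis add_0)
qed

section \<open>Restriction of forms to lines\<close>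

lemma coeff_mult_top:
  assumes "degree p \<le> m" "degree q \<le> n"
  shows "coeff (p * q) (m + n) = coeff p m * coeff q (n :: nat)"
proof -
  have "coeff (p * q) (m + n) = (\<Sum>i\<le>m + n. if i = m then coeff p m * coeff q n else 0)"
    unfolding coeff_mult
  proof (intro sum.cong refl)
    fix i assume "i \<in> {..m + n}"
    then show "coeff p i * coeff q (m + n - i) = (if i = m then coeff p m * coeff q n else 0)"
      using assms by (cases "i < m"; cases "i = m") (auto simp: coeff_eq_0)
  qed
  then show ?thesis by simp
qed

lemma degree_coeff_power_top:
  assumes "degree p \<le> 1"
  shows "degree (p ^ k) \<le> k \<and> coeff (p ^ k) k = coeff p 1 ^ k"
proof (induction k)
  case (Suc k)
  then show ?case
    using coeff_mult_top[of p 1 "p ^ k" k] degree_mult_le[of p "p ^ k"] assms by auto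
qed simp

lemma degree_coeff_prod_top:
  assumes "\<And>i. i \<in> S \<Longrightarrow> degree (p i) \<le> k i"
  shows "degree (\<Prod>i\<in>S. p i) \<le> (\<Sum>i\<in>S. k i) \<and> coeff (\<Prod>i\<in>S. p i) (\<Sum>i\<in>S. k i) = (\<Prod>i\<in>S. coeff (p i) (k i))"
  using assms
proof (induction S rule: infinite_finite_induct)
  case (insert i S)
  then have "degree (p i) \<le> k i" "degree (\<Prod>i\<in>S. p i) \<le> (\<Sum>i\<in>S. k i)" by auto
  then show ?case
    using coeff_mult_top[of "p i" "k i" "\<Prod>i\<in>S. p i" "\<Sum>i\<in>S. k i"] insert
      order_trans[OF degree_mult_le[of "p i" "\<Prod>i\<in>S. p i"] add_mono] by auto
qed auto

text \<open>The top coefficient sees only the direction \<open>b\<close>. If the form does not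
  vanish at \<open>b\<close>, all parallel lines give polynomials of the same degree and leading
  coefficient, as products over roots require.\<close>

lemma psubst_line:
  fixes F :: "'i::finite cpoly"
  assumes "homogeneous n F"
  shows "degree (psubst (\<lambda>c. [:c:]) (\<lambda>i. [:a i, b $ i:]) F) \<le> n"
    and "coeff (psubst (\<lambda>c. [:c:]) (\<lambda>i. [:a i, b $ i:]) F) n = peval F b"
proof -
  have *: "degree (\<Prod>i\<in>UNIV. [:a i, b $ i:] ^ Poly_Mapping.lookup m i) \<le> n \<and>
     coeff (\<Prod>i\<in>UNIV. [:a i, b $ i:] ^ Poly_Mapping.lookup m i) n = (\<Prod>i\<in>UNIV. b $ i ^ Poly_Mapping.lookup m i)"
    if "m \<in> Poly_Mapping.keys F" for m
  proof -
    have d: "degree [:a i, b $ i:] \<le> 1" for i by simp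
    have n: "(\<Sum>i\<in>UNIV. Poly_Mapping.lookup m i) = n" using assms that by (simp add: homogeneous_iff)
    show ?thesis
      using degree_coeff_prod_top[of UNIV "\<lambda>i. [:a i, b $ i:] ^ Poly_Mapping.lookup m i" "Poly_Mapping.lookup m"]
        degree_coeff_power_top[OF d] by (simp add: n)
  qed
  show "degree (psubst (\<lambda>c. [:c:]) (\<lambda>i. [:a i, b $ i:]) F) \<le> n"
    unfolding psubst_def using * by (intro degree_sum_le) (auto intro: order_trans[OF degree_smult_le])
  show "coeff (psubst (\<lambda>c. [:c:]) (\<lambda>i. [:a i, b $ i:]) F) n = peval F b"
    unfolding psubst_def peval_eq_sum coeff_sum using * by (intro sum.cong) auto
qed

lemma poly_fun_coeff_psubst:
  fixes F :: "'i::finite cpoly"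
  shows "poly_fun (\<lambda>x. coeff (psubst (\<lambda>c. [:c:]) (\<lambda>i. [:p i + x * a i, b i:]) F) n)"
proof -
  define cf where "cf = (\<lambda>q. \<forall>n. poly_fun (\<lambda>x. coeff (q x) n))"
  have mult: "cf (\<lambda>x. q x * r x)" if "cf q" "cf r" for q r
    using that by (auto simp: cf_def coeff_mult intro!: poly_fun_sum poly_fun_mult)
  have one: "cf (\<lambda>x. 1)" by (auto simp: cf_def poly_fun_const)
  have power: "cf (\<lambda>x. q x ^ k)" if "cf q" for q k
    by (induction k) (simp_all add: one mult that)
  have prod: "cf (\<lambda>x. \<Prod>i\<in>S. q i x)" if "\<And>i. cf (q i)" for q and S :: "'i set"
    by (induction S rule: infinite_finite_induct) (simp_all add: one mult that)
  have lin: "cf (\<lambda>x. [:p i + x * a i, b i:])" for i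
    unfolding cf_def
  proof
    fix n show "poly_fun (\<lambda>x. coeff [:p i + x * a i, b i:] n)"
      by (cases n; cases "n - 1") (auto simp: coeff_pCons intro!: poly_fun_add poly_fun_mult split: nat.splits)
  qed
  have "cf (\<lambda>x. \<Prod>i\<in>UNIV. [:p i + x * a i, b i:] ^ Poly_Mapping.lookup m i)" for m
    by (intro prod power lin)
  then show ?thesis
    by (auto simp: cf_def psubst_def coeff_sum intro!: poly_fun_sum poly_fun_cmult)
qed

section \<open>Bounded rational functions of one variable\<close>

lemma poly_split_zero:
  assumes "R \<noteq> (0 :: complex poly)"
  obtains q n where "R = monom 1 n * q" "poly q 0 \<noteq> 0"
proof -
  obtain q where q: "R = [:- 0, 1:] ^ order 0 R * q" "\<not> [:- 0, 1:] dvd q"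
    using order_decomp[OF assms, of 0] by blast
  then have "poly q 0 \<noteq> 0" using poly_eq_0_iff_dvd[of q 0] by simp
  moreover have "R = monom 1 (order 0 R) * q" using q(1) by (simp add: monom_altdef)
  ultimately show ?thesis by (rule that[rotated])
qed

lemma bounded_poly_const:
  assumes "\<And>x. norm x \<ge> 1 \<Longrightarrow> norm (poly q x) \<le> (K::real)"
  shows "degree (q :: complex poly) = 0"
proof (rule ccontr)
  assume d: "degree q \<noteq> 0"
  obtain a p where q: "q = pCons a p" by (rule pCons_cases)
  then have p: "p \<noteq> 0" using d by auto
  obtain r where r: "\<And>z. r \<le> cmod z \<Longrightarrow> \<bar>K\<bar> + 1 \<le> cmod (poly (pCons a p) z)"
    using poly_infinity[OF p, of "\<bar>K\<bar> + 1" a] by blast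
  let ?z = "of_real (max 1 r) :: complex"
  have "\<bar>K\<bar> + 1 \<le> cmod (poly q ?z)" unfolding q by (rule r) auto
  moreover have "cmod (poly q ?z) \<le> K" by (rule assms) simp
  ultimately show False by linarith
qed

text \<open>Having no zero except possibly 0, \<open>T\<close> is a constant times a power of
  \<open>x\<close>. So \<open>R / T\<close> is a polynomial in \<open>x\<close> and its inverse that
  is bounded near 0 and at infinity, hence constant, and it vanishes at \<open>x1\<close>.\<close>

lemma poly_dominated_by_power:
  fixes R T :: "complex poly"
  assumes T: "\<And>x. x \<noteq> 0 \<Longrightarrow> poly T x \<noteq> 0"
    and le: "\<And>x. x \<noteq> 0 \<Longrightarrow> norm (poly R x) \<le> K * norm (poly T x)"
    and root: "poly R x1 = 0" "x1 \<noteq> 0"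
  shows "R = 0"
proof (rule ccontr)
  assume R0: "R \<noteq> 0"
  have T0: "T \<noteq> 0" using T[of 1] by auto
  obtain t m where t: "T = monom 1 m * t" "poly t 0 \<noteq> 0" using poly_split_zero[OF T0] .
  obtain q n where q: "R = monom 1 n * q" "poly q 0 \<noteq> 0" using poly_split_zero[OF R0] .
  have "poly t x \<noteq> 0" for x using t T[of x] by (cases "x = 0") (auto simp: poly_monom)
  then have "degree t = 0" by (metis fundamental_theorem_of_algebra constant_degree)
  then obtain \<kappa> where \<kappa>: "t = [:\<kappa>:]" by (rule degree_eq_zeroE)
  define L where "L = K * norm \<kappa>"
  have b: "norm x ^ n * norm (poly q x) \<le> L * norm x ^ m" if "x \<noteq> 0" for x
    using le[OF that] unfolding q t \<kappa> L_def by (simp add: poly_monom norm_mult norm_power mult_ac)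
  \<comment> \<open>Boundedness near 0: otherwise \<open>poly q\<close> would tend to 0 there,
    against \<open>poly q 0 \<noteq> 0\<close>.\<close>
  have nm: "m \<le> n"
  proof (rule ccontr)
    assume "\<not> m \<le> n"
    then have mn: "m = n + (m - n)" "m - n > 0" by auto
    have le: "norm (poly q x) \<le> L * norm x ^ (m - n)" if "x \<noteq> 0" for x
    proof -
      have "norm x ^ n * norm (poly q x) \<le> norm x ^ n * (L * norm x ^ (m - n))"
        using b[OF that] mn(1) by (metis mult.left_commute power_add)
      then show ?thesis using that by simp
    qed
    have "(\<lambda>x. L * norm x ^ (m - n)) \<midarrow>(0::complex)\<rightarrow> L * norm (0::complex) ^ (m - n)"
      by (intro tendsto_intros)
    then have l: "(\<lambda>x. L * norm x ^ (m - n)) \<midarrow>(0::complex)\<rightarrow> 0" using mn by (simp add: power_0_left)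
    have "(\<lambda>x. poly q x) \<midarrow>0\<rightarrow> 0"
      by (rule Lim_null_comparison[OF _ l]) (use le in \<open>auto simp: eventually_at intro!: exI[of _ 1]\<close>)
    moreover have "(\<lambda>x. poly q x) \<midarrow>0\<rightarrow> poly q 0" by (intro tendsto_intros)
    ultimately show False using q(2) LIM_unique by blast
  qed
  have L0: "L \<ge> 0" using order_trans[OF norm_ge_zero b[of 1, simplified]] by simp
  have "norm (poly q x) \<le> L" if x: "norm x \<ge> 1" for x
  proof -
    have "norm x ^ n * norm (poly q x) \<le> L * norm x ^ m" using x by (intro b) auto
    also have "\<dots> \<le> L * norm x ^ n" using L0 x nm by (intro mult_left_mono power_increasing) auto
    finally have "norm x ^ n * norm (poly q x) \<le> norm x ^ n * L" by (simp add: mult.commute)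
    then show ?thesis using x by (metis less_le_trans mult_le_cancel_left_pos zero_less_one zero_less_power)
  qed
  then have "degree q = 0" by (rule bounded_poly_const)
  then obtain c where "q = [:c:]" by (rule degree_eq_zeroE)
  then show False using q root by (auto simp: poly_monom)
qed

lemma extend_to_basis3:
  fixes p b :: "complex ^ 3"
  assumes p: "p \<noteq> 0" and b: "\<And>c. b \<noteq> c *s p"
  obtains a and M W :: "complex ^ 3 ^ 3" where "M ** W = mat 1" "W ** M = mat 1"
    "\<And>z x y. M *v vector [z, x, y] = z *s p + x *s a + y *s b"
proof -
  \<comment> \<open>The cross product of \<open>p\<close> and \<open>b\<close>. With its complex
    conjugate as third vector the determinant is minus a sum of squared moduli, so it is nonzero
    when \<open>p\<close> and \<open>b\<close> are independent.\<close>
  define c1 where "c1 = p $ 2 * b $ 3 - p $ 3 * b $ 2"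
  define c2 where "c2 = p $ 3 * b $ 1 - p $ 1 * b $ 3"
  define c3 where "c3 = p $ 1 * b $ 2 - p $ 2 * b $ 1"
  define a :: "complex ^ 3" where "a = vector [cnj c1, cnj c2, cnj c3]"
  define M :: "complex ^ 3 ^ 3" where "M = (\<chi> i. vector [p $ i, a $ i, b $ i])"
  have "det M = - (c1 * cnj c1 + c2 * cnj c2 + c3 * cnj c3)"
    unfolding det_3 by (simp add: M_def a_def c1_def c2_def c3_def algebra_simps)
  also have "c1 * cnj c1 + c2 * cnj c2 + c3 * cnj c3 = of_real (cmod c1 ^ 2 + cmod c2 ^ 2 + cmod c3 ^ 2)"
    by (simp only: complex_norm_square of_real_add)
  finally have det: "det M = - of_real (cmod c1 ^ 2 + cmod c2 ^ 2 + cmod c3 ^ 2)" .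
  have "det M \<noteq> 0"
  proof
    assume "det M = 0"
    then have "cmod c1 ^ 2 + cmod c2 ^ 2 + cmod c3 ^ 2 = 0" unfolding det by (simp only: neg_equal_0_iff_equal of_real_eq_0_iff)
    then have "cmod c1 ^ 2 = 0" "cmod c2 ^ 2 = 0" "cmod c3 ^ 2 = 0"
      by (smt (verit) zero_le_power2)+
    then have "c1 = 0" "c2 = 0" "c3 = 0" by simp_all
    then have c: "p $ 2 * b $ 3 = p $ 3 * b $ 2" "p $ 3 * b $ 1 = p $ 1 * b $ 3" "p $ 1 * b $ 2 = p $ 2 * b $ 1"
      by (simp_all add: c1_def c2_def c3_def)
    obtain i where i: "p $ i \<noteq> 0" using p by (auto simp: vec_eq_iff)
    then have "b = (b $ i / p $ i) *s p"
      using c exhaust_3[of i] by (auto simp: vec_eq_iff forall_3 field_simps)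
    then show False using b by blast
  qed
  then have "invertible M" by (simp add: invertible_det_nz)
  then obtain W where W: "M ** W = mat 1" "W ** M = mat 1" by (auto simp: invertible_def)
  have "M *v vector [z, x, y] = z *s p + x *s a + y *s b" for z x y
    by (simp add: vec_eq_iff matrix_vector_mult_def sum_3 M_def mult_ac)
  with W show ?thesis by (rule that)
qed

text \<open>A Liouville theorem on a plane curve: a rational function of degree 0 whose only pole on the curve
  could be \<open>p\<close>, and which is bounded near \<open>p\<close>, is constant on the curve.  Projecting from a point outside
  the curve, the product of its values over a fibre is a bounded rational function of one variable.\<close>

lemma curve_liouville:
  fixes f P P' :: "3 cpoly"
  assumes f: "irreducible f" "homogeneous e f" "e > 0"
    and p: "p \<noteq> 0" "peval f p = 0"
    and P: "homogeneous D P" "homogeneous D P'"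
    and nz: "\<And>v. peval f v = 0 \<Longrightarrow> (\<And>c. v \<noteq> c *s p) \<Longrightarrow> peval P' v \<noteq> 0"
    and le: "\<And>v. peval f v = 0 \<Longrightarrow> (\<And>c. v \<noteq> c *s p) \<Longrightarrow> norm (peval P v) \<le> K * norm (peval P' v)"
  shows "\<exists>c. f dvd P - pconst c * P'"
proof -
  have "f \<noteq> 0" using f by (auto simp: irreducible_def)
  then obtain b where b: "peval f b \<noteq> 0" using peval_eq_0_imp_eq_0 by blast
  \<comment> \<open>The centre \<open>b\<close> of the projection lies off the curve, whereas every
    multiple of \<open>p\<close> is a zero of \<open>f\<close>.\<close>
  have bp: "b \<noteq> c *s p" for c using b p peval_scale[OF f(2), of c p] by auto
  obtain a and M W :: "complex ^ 3 ^ 3" where M: "M ** W = mat 1" "W ** M = mat 1"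
    "\<And>z x y. M *v vector [z, x, y] = z *s p + x *s a + y *s b"
    using extend_to_basis3[OF p(1) bp] by metis
  have inj: "(vector [z, x, y] :: complex ^ 3) = vector [z', x', y']"
    if "z *s p + x *s a + y *s b = z' *s p + x' *s a + y' *s b" for z x y z' x' y'
  proof -
    have "W *v (M *v vector [z, x, y]) = W *v (M *v vector [z', x', y'])" using that by (simp add: M(3))
    then show ?thesis by (simp add: matrix_vector_mul_assoc M(2))
  qed
  \<comment> \<open>For fixed \<open>x\<close> this is a line through \<open>b\<close> in the
    projective plane; the fibre \<open>x = 0\<close> is the only one that can meet
    \<open>p\<close>.\<close>
  define v where "v = (\<lambda>x y. p + x *s a + y *s b)"
  have vp: "v x y \<noteq> c *s p" if "x \<noteq> 0" for x y c
  proof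
    assume "v x y = c *s p"
    then have "1 *s p + x *s a + y *s b = c *s p + 0 *s a + 0 *s b" by (simp add: v_def)
    from arg_cong[where f = "\<lambda>w. w $ 2", OF inj[OF this]] that show False by simp
  qed
  define ln where "ln = (\<lambda>G x. psubst (\<lambda>c. [:c:]) (\<lambda>i. [:p $ i + x * a $ i, b $ i:]) G)"
  have ln: "poly (ln G x) y = peval G (v x y)" for G x y
    unfolding ln_def psubst_peval_poly v_def
    by (rule arg_cong[where f = "peval G"]) (simp add: vec_eq_iff)
  have ln_poly_fun: "poly_fun (\<lambda>x. coeff (ln G x) n)" for G n
    unfolding ln_def by (rule poly_fun_coeff_psubst)
  have top: "degree (ln f x) \<le> e" "coeff (ln f x) e = peval f b" for x
    unfolding ln_def using psubst_line[OF f(2)] by auto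
  have deg: "degree (ln f x) = e" for x
    using top[of x] b by (metis le_antisym le_degree)
  have lead: "lead_coeff (ln f x) = peval f b" for x by (simp add: deg top)
  have lnf0: "ln f x \<noteq> 0" for x using lead[of x] b by auto
  have fiber: "poly_fun (\<lambda>x. \<Prod>y\<in>#proots (ln f x). poly (ln G x) y)" if "homogeneous D G" for G
  proof (rule poly_fun_prod_roots[of _ e "peval f b" _ D])
    show "degree (ln G x) \<le> D" for x unfolding ln_def by (rule psubst_line(1)[OF that])
  qed (simp_all add: deg top b ln_poly_fun)
  have "\<not> constant (poly (ln f 1))" using deg[of 1] f(3) by (simp add: constant_degree)
  then obtain y1 where y1: "poly (ln f 1) y1 = 0" using fundamental_theorem_of_algebra by blast
  \<comment> \<open>The value of the rational function at one point of the fibre over 1, chosen to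
    force a zero of the product over that fibre.\<close>
  define c where "c = peval P (v 1 y1) / peval P' (v 1 y1)"
  define S where "S = P - pconst c * P'"
  have S: "homogeneous D S" unfolding S_def by (intro homogeneous_diff_cmult P)
  have evS: "peval S w = peval P w - c * peval P' w" for w by (simp add: S_def peval_simps)
  obtain R T where R: "\<And>x. (\<Prod>y\<in>#proots (ln f x). poly (ln S x) y) = poly R x"
    and T: "\<And>x. (\<Prod>y\<in>#proots (ln f x). poly (ln P' x) y) = poly T x"
    using fiber[OF S] fiber[OF P(2)] unfolding poly_fun_def by blast
  have on: "peval f (v x y) = 0" if "y \<in># proots (ln f x)" for x y
    using that lnf0[of x] by (simp add: ln[symmetric])
  \<comment> \<open>Away from \<open>x = 0\<close> the fibre avoids \<open>p\<close>, so
    \<open>T\<close> has no zero there and the factorwise bounds multiply to a bound of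
    \<open>R\<close> by \<open>T\<close>.\<close>
  have "R = 0"
  proof (rule poly_dominated_by_power)
    fix x :: complex assume x: "x \<noteq> 0"
    have "peval P' (v x y) \<noteq> 0" if "y \<in># proots (ln f x)" for y
      using nz[OF on[OF that]] vp[OF x] by blast
    then show "poly T x \<noteq> 0" by (auto simp: T[symmetric] prod_mset_zero_iff ln)
    have each: "norm (poly (ln S x) y) \<le> (K + norm c) * norm (poly (ln P' x) y)" if "y \<in># proots (ln f x)" for y
    proof -
      have "norm (poly (ln S x) y) \<le> norm (peval P (v x y)) + norm c * norm (peval P' (v x y))"
        unfolding ln evS by (metis norm_mult norm_triangle_ineq4)
      then show ?thesis using le[OF on[OF that]] vp[OF x] by (fastforce simp: ln algebra_simps)
    qed
    have "norm (\<Prod>y\<in>#A. poly (ln S x) y) \<le> (K + norm c) ^ size A * norm (\<Prod>y\<in>#A. poly (ln P' x) y)"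
      if "A \<subseteq># proots (ln f x)" for A using that
    proof (induction A)
      case (add y A)
      have A: "A \<subseteq># proots (ln f x)" "y \<in># proots (ln f x)"
        using add.prems by (auto dest: mset_subset_eq_insertD simp: subset_mset.less_imp_le)
      have "norm (\<Prod>y\<in>#add_mset y A. poly (ln S x) y)
          \<le> ((K + norm c) * norm (poly (ln P' x) y)) * ((K + norm c) ^ size A * norm (\<Prod>y\<in>#A. poly (ln P' x) y))"
        unfolding image_mset_add_mset prod_mset.add_mset norm_mult
        by (intro mult_mono add.IH A each order_trans[OF norm_ge_zero each[OF A(2)]] norm_ge_zero)
      then show ?case by (simp add: norm_mult mult_ac)
    qed simp
    from this[of "proots (ln f x)"]
    show "norm (poly R x) \<le> (K + norm c) ^ e * norm (poly T x)"
      by (simp add: R T size_proots_complex deg)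
  next
    have y1': "y1 \<in># proots (ln f 1)" using y1 lnf0[of 1] by simp
    then have "peval P' (v 1 y1) \<noteq> 0" using nz[OF on[OF y1']] vp[of 1] by simp
    then have "peval S (v 1 y1) = 0" by (simp add: evS c_def)
    then show "poly R 1 = 0"
      unfolding R[symmetric] using y1' by (auto simp: prod_mset_zero_iff ln)
  qed simp
  have root: "\<exists>y. peval f (v x y) = 0 \<and> peval S (v x y) = 0" for x
  proof -
    have "(\<Prod>y\<in>#proots (ln f x). poly (ln S x) y) = 0" by (simp add: R \<open>R = 0\<close>)
    then obtain y where "y \<in># proots (ln f x)" "poly (ln S x) y = 0" by (auto simp: prod_mset_zero_iff)
    then show ?thesis using on[of y x] by (auto simp: ln)
  qed
  have "f dvd S"
  proof (rule common_root_imp_dvd[OF f M(1,2)])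
    show "peval f (M *v vector [0, 0, 1]) \<noteq> 0" using b by (simp add: M(3))
    fix z x :: complex assume z: "z \<noteq> 0"
    obtain y where y: "peval f (v (x / z) y) = 0" "peval S (v (x / z) y) = 0" using root by blast
    \<comment> \<open>By homogeneity the common roots found in the slice \<open>z = 1\<close> give
      common roots for every nonzero \<open>z\<close>.\<close>
    have "M *v vector [z, x, z * y] = z *s v (x / z) y"
      using z by (simp add: M(3) v_def vec_eq_iff algebra_simps)
    then have "peval f (M *v vector [z, x, z * y]) = 0 \<and> peval S (M *v vector [z, x, z * y]) = 0"
      using y by (simp add: peval_scale[OF f(2)] peval_scale[OF S])
    then show "\<exists>y. peval f (M *v vector [z, x, y]) = 0 \<and> peval S (M *v vector [z, x, y]) = 0" by blast
  qed
  then show ?thesis unfolding S_def by blast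
qed

section \<open>Formal coordinates\<close>

lemma homogeneous_0: "homogeneous n 0"
  by (simp add: homogeneous_iff)

lemma homogeneous_sum: "(\<And>i. i \<in> S \<Longrightarrow> homogeneous n (f i)) \<Longrightarrow> homogeneous n (\<Sum>i\<in>S. f i)"
  by (induction S rule: infinite_finite_induct) (auto intro: homogeneous_add homogeneous_0)

text \<open>Membership in the \<open>N\<close>-th power of the maximal ideal; congruence modulo that
  power is written \<open>ser_ord_ge N (F - G)\<close>.\<close>

definition ser_ord_ge :: "nat \<Rightarrow> series2 \<Rightarrow> bool" where
  "ser_ord_ge N F \<longleftrightarrow> (\<forall>i j. i + j < N \<longrightarrow> fps_nth (fps_nth F i) j = 0)"

lemma ser_ord_ge_add: "ser_ord_ge N F \<Longrightarrow> ser_ord_ge N G \<Longrightarrow> ser_ord_ge N (F + G)"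
  and ser_ord_ge_diff: "ser_ord_ge N F \<Longrightarrow> ser_ord_ge N G \<Longrightarrow> ser_ord_ge N (F - G)"
  and ser_ord_ge_0: "ser_ord_ge N 0"
  and ser_ord_ge_triv: "ser_ord_ge 0 F"
  and ser_ord_ge_mono: "ser_ord_ge N F \<Longrightarrow> M \<le> N \<Longrightarrow> ser_ord_ge M F"
  by (auto simp: ser_ord_ge_def)

lemma ser_ord_ge_mult:
  assumes "ser_ord_ge M F" "ser_ord_ge N G"
  shows "ser_ord_ge (M + N) (F * G)"
  unfolding ser_ord_ge_def
proof (intro allI impI)
  fix i j :: nat assume ij: "i + j < M + N"
  have "fps_nth (fps_nth F a) b * fps_nth (fps_nth G (i - a)) (j - b) = 0" if "a \<le> i" "b \<le> j" for a b
  proof (cases "a + b < M")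
    case False
    then have "(i - a) + (j - b) < N" using that ij by linarith
    then show ?thesis using assms(2) by (simp add: ser_ord_ge_def)
  qed (use assms(1) in \<open>simp add: ser_ord_ge_def\<close>)
  then show "fps_nth (fps_nth (F * G) i) j = 0"
    unfolding fps_mult_nth fps_sum_nth by (intro sum.neutral ballI) simp
qed

lemma ser_ord_ge_mult_left: "ser_ord_ge N G \<Longrightarrow> ser_ord_ge N (F * G)"
  using ser_ord_ge_mult[OF ser_ord_ge_triv, of N G F] by simp

lemma ser_ord_ge_sum: "(\<And>i. i \<in> S \<Longrightarrow> ser_ord_ge N (f i)) \<Longrightarrow> ser_ord_ge N (\<Sum>i\<in>S. f i)"
  by (induction S rule: infinite_finite_induct) (auto intro: ser_ord_ge_add ser_ord_ge_0)

lemma ser_ord_ge_power: "ser_ord_ge 1 F \<Longrightarrow> ser_ord_ge k (F ^ k)"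
proof (induction k)
  case (Suc k)
  then show ?case using ser_ord_ge_mult[of 1 F k "F ^ k"] by simp
qed (simp add: ser_ord_ge_triv)

lemma ser_ord_ge_cong_mult:
  assumes "ser_ord_ge N (F - F')" "ser_ord_ge N (G - G')"
  shows "ser_ord_ge N (F * G - F' * G')"
proof -
  have "F * G - F' * G' = G * (F - F') + F' * (G - G')" by (simp add: algebra_simps)
  then show ?thesis using assms by (auto intro: ser_ord_ge_add ser_ord_ge_mult_left)
qed

lemma ser_ord_ge_cong_prod:
  assumes "\<And>l. l \<in> S \<Longrightarrow> ser_ord_ge N (F l - G l)"
  shows "ser_ord_ge N (prod F S - prod G S)"
  using assms
  by (induction S rule: infinite_finite_induct) (auto intro: ser_ord_ge_cong_mult ser_ord_ge_0)

text \<open>Telescoping gains one order: each term contains the difference, of order 2, and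
  \<open>k - 1\<close> factors of order 1. Hence the lowest part of a polynomial in the coordinates
  depends only on their linear parts.\<close>

lemma ser_ord_ge_cong_power:
  assumes "ser_ord_ge 2 (F - F')" "ser_ord_ge 1 F" "ser_ord_ge 1 F'"
  shows "ser_ord_ge (Suc k) (F ^ k - F' ^ k)"
proof (induction k)
  case (Suc k)
  have "F ^ Suc k - F' ^ Suc k = F * (F ^ k - F' ^ k) + (F - F') * F' ^ k" by (simp add: algebra_simps)
  moreover have "ser_ord_ge (1 + Suc k) (F * (F ^ k - F' ^ k))" by (intro ser_ord_ge_mult assms Suc)
  moreover have "ser_ord_ge (2 + k) ((F - F') * F' ^ k)" by (intro ser_ord_ge_mult assms ser_ord_ge_power)
  ultimately show ?case by (simp add: ser_ord_ge_add)
qed (simp add: ser_ord_ge_0)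

lemma ser_ord_ge_cong_power_mult:
  assumes "ser_ord_ge 2 (F - F')" "ser_ord_ge 1 F" "ser_ord_ge 1 F'"
    and "ser_ord_ge 2 (G - G')" "ser_ord_ge 1 G" "ser_ord_ge 1 G'"
  shows "ser_ord_ge (Suc (i + j)) (F ^ i * G ^ j - F' ^ i * G' ^ j)"
proof -
  have "F ^ i * G ^ j - F' ^ i * G' ^ j = (F ^ i - F' ^ i) * G ^ j + F' ^ i * (G ^ j - G' ^ j)"
    by (simp add: algebra_simps)
  moreover have "ser_ord_ge (Suc i + j) ((F ^ i - F' ^ i) * G ^ j)"
    by (intro ser_ord_ge_mult ser_ord_ge_cong_power ser_ord_ge_power assms)
  moreover have "ser_ord_ge (i + Suc j) (F' ^ i * (G ^ j - G' ^ j))"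
    by (intro ser_ord_ge_mult ser_ord_ge_cong_power ser_ord_ge_power assms)
  ultimately show ?thesis by (simp add: ser_ord_ge_add)
qed

definition pair2 :: "'a \<Rightarrow> 'a \<Rightarrow> 2 \<Rightarrow> 'a" where
  "pair2 a b = (\<lambda>i. if i = 1 then a else b)"

lemma pair2_simps [simp]: "pair2 a b 1 = a" "pair2 a b 2 = b"
  by (simp_all add: pair2_def)

lemma prod_2: "prod f (UNIV :: 2 set) = f 1 * f 2"
  unfolding UNIV_2 by simp

definition subst2 :: "series2 \<Rightarrow> series2 \<Rightarrow> 2 cpoly \<Rightarrow> series2" where
  "subst2 u v = psubst ser_const (pair2 u v)"

lemma ring_hom1_subst2: "ring_hom1 (subst2 u v)"
  unfolding subst2_def by (rule ring_hom1_psubst[OF ring_hom1_ser_const])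

lemma subst2_pvar: "subst2 u v (pvar 1) = u" "subst2 u v (pvar 2) = v"
  by (simp_all add: subst2_def psubst_pvar[OF ring_hom1_ser_const])

lemma subst2_pconst: "subst2 u v (pconst c) = ser_const c"
  by (simp add: subst2_def psubst_pconst[OF ring_hom1_ser_const])

lemma subst2_single:
  "subst2 u v (Poly_Mapping.single m c) = ser_const c * (u ^ Poly_Mapping.lookup m 1 * v ^ Poly_Mapping.lookup m 2)"
  by (simp add: subst2_def psubst_single hom_zero[OF ring_hom1_ser_const] prod_2)

lemma subst2_eq_sum:
  "subst2 u v P = (\<Sum>m\<in>Poly_Mapping.keys P. ser_const (Poly_Mapping.lookup P m) *
     (u ^ Poly_Mapping.lookup m 1 * v ^ Poly_Mapping.lookup m 2))"
  by (simp add: subst2_def psubst_def prod_2)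

definition mon2 :: "nat \<Rightarrow> nat \<Rightarrow> 2 \<Rightarrow>\<^sub>0 nat" where
  "mon2 i j = Poly_Mapping.single 1 i + Poly_Mapping.single 2 j"

lemma lookup_mon2 [simp]: "Poly_Mapping.lookup (mon2 i j) 1 = i" "Poly_Mapping.lookup (mon2 i j) 2 = j"
  by (auto simp: mon2_def lookup_add lookup_single when_def)

lemma mon2_eq: "m = mon2 (Poly_Mapping.lookup m 1) (Poly_Mapping.lookup m 2)"
proof (rule poly_mapping_eqI)
  fix k :: 2 show "Poly_Mapping.lookup m k = Poly_Mapping.lookup (mon2 (Poly_Mapping.lookup m 1) (Poly_Mapping.lookup m 2)) k"
    using exhaust_2[of k] by auto
qed

lemma mon2_eq_iff: "m = mon2 i j \<longleftrightarrow> Poly_Mapping.lookup m 1 = i \<and> Poly_Mapping.lookup m 2 = j"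
  using mon2_eq[of m] by auto

lemma ser_mon_nth:
  "fps_nth (fps_nth (ser_const c * (ser_s ^ a * ser_t ^ b)) i) j = (if i = a \<and> j = b then c else 0)"
proof -
  have "ser_const c * (ser_s ^ a * ser_t ^ b) = fps_X ^ a * fps_const (fps_const c * fps_X ^ b)"
    by (simp add: ser_const_def ser_s_def ser_t_def fps_const_power mult_ac)
  then show ?thesis by (auto simp: fps_X_power_mult_nth fps_X_power_mult_right_nth fps_X_power_nth mult_delta_right)
qed

lemma subst2_ser_nth:
  "fps_nth (fps_nth (subst2 ser_s ser_t P) i) j = Poly_Mapping.lookup P (mon2 i j)"
proof (induction P rule: poly_mapping_additive_induct)
  case (single m c)
  then show ?case
    by (auto simp: subst2_single ser_mon_nth lookup_single when_def mon2_eq_iff)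
next
  case (add F G)
  then show ?case by (simp add: hom_add[OF ring_hom1_subst2] lookup_add)
qed

definition ord_ge2 :: "nat \<Rightarrow> 2 cpoly \<Rightarrow> bool" where
  "ord_ge2 N P \<longleftrightarrow> (\<forall>m\<in>Poly_Mapping.keys P. N \<le> Poly_Mapping.lookup m 1 + Poly_Mapping.lookup m 2)"

lemma ser_ord_ge_subst2_ser_iff: "ser_ord_ge N (subst2 ser_s ser_t P) \<longleftrightarrow> ord_ge2 N P"
proof
  assume l: "ser_ord_ge N (subst2 ser_s ser_t P)"
  show "ord_ge2 N P"
    unfolding ord_ge2_def
  proof
    fix m assume "m \<in> Poly_Mapping.keys P"
    then have "fps_nth (fps_nth (subst2 ser_s ser_t P) (Poly_Mapping.lookup m 1)) (Poly_Mapping.lookup m 2) \<noteq> 0"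
      by (simp add: subst2_ser_nth flip: mon2_eq) (simp add: in_keys_iff)
    then show "N \<le> Poly_Mapping.lookup m 1 + Poly_Mapping.lookup m 2"
      using l unfolding ser_ord_ge_def by (meson not_le)
  qed
next
  assume r: "ord_ge2 N P"
  show "ser_ord_ge N (subst2 ser_s ser_t P)"
    unfolding ser_ord_ge_def subst2_ser_nth
  proof (intro allI impI)
    fix i j assume "i + j < N"
    then have "mon2 i j \<notin> Poly_Mapping.keys P" using r by (fastforce simp: ord_ge2_def)
    then show "Poly_Mapping.lookup P (mon2 i j) = 0" by (simp add: in_keys_iff)
  qed
qed

text \<open>Keeps the square \<open>i, j < N\<close>, which contains the triangle
  \<open>i + j < N\<close> tested by \<open>ser_ord_ge\<close>.\<close>

definition trunc2 :: "nat \<Rightarrow> series2 \<Rightarrow> 2 cpoly" where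
  "trunc2 N F = (\<Sum>i<N. \<Sum>j<N. Poly_Mapping.single (mon2 i j) (fps_nth (fps_nth F i) j))"

lemma ser_ord_ge_trunc2: "ser_ord_ge N (F - subst2 ser_s ser_t (trunc2 N F))"
  unfolding ser_ord_ge_def
proof (intro allI impI)
  fix i j assume "i + j < N"
  have "Poly_Mapping.lookup (trunc2 N F) (mon2 i j) = (\<Sum>a<N. \<Sum>b<N. if a = i \<and> b = j then fps_nth (fps_nth F a) b else 0)"
    by (simp add: trunc2_def lookup_sum lookup_single when_def mon2_eq_iff)
  also have "\<dots> = (\<Sum>a<N. if a = i then (\<Sum>b<N. if b = j then fps_nth (fps_nth F a) b else 0) else 0)"
    by (intro sum.cong refl) auto
  also have "\<dots> = fps_nth (fps_nth F i) j" using \<open>i + j < N\<close> by simp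
  finally show "fps_nth (fps_nth (F - subst2 ser_s ser_t (trunc2 N F)) i) j = 0"
    by (simp add: subst2_ser_nth)
qed

lemma ser_ord_ge_subst2:
  assumes "ser_ord_ge 1 u" "ser_ord_ge 1 v" "ord_ge2 N P"
  shows "ser_ord_ge N (subst2 u v P)"
  unfolding subst2_eq_sum
proof (rule ser_ord_ge_sum, rule ser_ord_ge_mult_left)
  fix m assume "m \<in> Poly_Mapping.keys P"
  then have "N \<le> Poly_Mapping.lookup m 1 + Poly_Mapping.lookup m 2" using assms by (simp add: ord_ge2_def)
  then show "ser_ord_ge N (u ^ Poly_Mapping.lookup m 1 * v ^ Poly_Mapping.lookup m 2)"
    by (rule ser_ord_ge_mono[rotated]) (intro ser_ord_ge_mult ser_ord_ge_power assms)
qed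

lemma ser_ord_ge_subst2_cong:
  assumes "ser_ord_ge N (u - u')" "ser_ord_ge N (v - v')"
  shows "ser_ord_ge N (subst2 u v P - subst2 u' v' P)"
proof -
  have "ser_ord_ge N (x ^ k - x' ^ k)" if "ser_ord_ge N (x - x')" for x x' k
    by (induction k) (auto intro: ser_ord_ge_cong_mult ser_ord_ge_0 that)
  then show ?thesis
    unfolding subst2_eq_sum sum_subtractf[symmetric]
    by (intro ser_ord_ge_sum ser_ord_ge_cong_mult assms) (auto simp: ser_ord_ge_0 assms)
qed

text \<open>Only the Jacobian matrix at the origin is named; its invertibility allows every argument
  to proceed degree by degree.\<close>

locale formal_coordinates =
  fixes u v :: series2 and a b c d :: complex
  assumes u: "ser_ord_ge 1 u" and v: "ser_ord_ge 1 v"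
    and coeffs: "fps_nth (fps_nth u 1) 0 = a" "fps_nth (fps_nth u 0) 1 = b"
      "fps_nth (fps_nth v 1) 0 = c" "fps_nth (fps_nth v 0) 1 = d"
    and det: "a * d - b * c \<noteq> 0"
begin

definition lin :: "complex \<Rightarrow> complex \<Rightarrow> 2 cpoly" where
  "lin x y = pconst x * pvar 1 + pconst y * pvar 2"

text \<open>The inverse of the linear part: \<open>ls\<close> and \<open>lt\<close> express
  \<open>s\<close> and \<open>t\<close> through \<open>u\<close> and \<open>v\<close> up to order
  2.\<close>

definition "D = a * d - b * c"
definition "ls = lin (d / D) (- b / D)"
definition "lt = lin (- c / D) (a / D)"

lemma subst2_lin: "subst2 x y (lin \<alpha> \<beta>) = ser_const \<alpha> * x + ser_const \<beta> * y"
  by (simp add: lin_def hom_add[OF ring_hom1_subst2] hom_mult[OF ring_hom1_subst2] subst2_pvar subst2_pconst)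

lemma ser_const_mult_nth: "fps_nth (fps_nth (ser_const \<alpha> * x) i) j = \<alpha> * fps_nth (fps_nth x i) j"
  by (simp add: ser_const_def)

lemma ser_s_t_nth: "fps_nth (fps_nth ser_s i) j = (if i = 1 \<and> j = 0 then 1 else 0)"
  "fps_nth (fps_nth ser_t i) j = (if i = 0 \<and> j = 1 then 1 else 0)"
  using ser_mon_nth[of 1 1 0] ser_mon_nth[of 1 0 1] by (simp_all add: hom_one[OF ring_hom1_ser_const])

lemma ord_ge_2_iff: "ser_ord_ge 2 F \<longleftrightarrow> fps_nth (fps_nth F 0) 0 = 0 \<and> fps_nth (fps_nth F 1) 0 = 0 \<and> fps_nth (fps_nth F 0) 1 = 0"
proof -
  have "i + j < 2 \<longleftrightarrow> (i = 0 \<and> j = 0) \<or> (i = 1 \<and> j = 0) \<or> (i = 0 \<and> j = 1)" for i j :: nat by auto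
  then show ?thesis unfolding ser_ord_ge_def by auto
qed

lemma D0: "D \<noteq> 0" using det by (simp add: D_def)

lemma uv0: "fps_nth (fps_nth u 0) 0 = 0" "fps_nth (fps_nth v 0) 0 = 0"
  using u v by (auto simp: ser_ord_ge_def)

lemma inverse_matrix:
  "d / D * a + - b / D * c = 1" "d / D * b + - b / D * d = 0"
  "- c / D * a + a / D * c = 0" "- c / D * b + a / D * d = 1"
  "a * (d / D) + b * (- c / D) = 1" "a * (- b / D) + b * (a / D) = 0"
  "c * (d / D) + d * (- c / D) = 0" "c * (- b / D) + d * (a / D) = 1"
  by (simp_all add: D0 divide_simps) (simp_all add: D_def algebra_simps)

lemma s_approx: "ser_ord_ge 2 (ser_s - subst2 u v ls)"
  unfolding ord_ge_2_iff ls_def subst2_lin fps_sub_nth fps_add_nth ser_const_mult_nth ser_s_t_nth coeffs uv0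
    inverse_matrix by simp

lemma t_approx: "ser_ord_ge 2 (ser_t - subst2 u v lt)"
  unfolding ord_ge_2_iff lt_def subst2_lin fps_sub_nth fps_add_nth ser_const_mult_nth ser_s_t_nth coeffs uv0
    inverse_matrix by simp

lemma st_ord: "ser_ord_ge 1 ser_s" "ser_ord_ge 1 ser_t"
  by (auto simp: ser_ord_ge_def ser_s_t_nth)

lemma lin_ord: "ser_ord_ge 1 (subst2 u v (lin x y))"
  unfolding subst2_lin by (intro ser_ord_ge_add ser_ord_ge_mult_left u v)

text \<open>Formal inversion one degree at a time: in the part of degree \<open>N\<close> of the
  error, replacing \<open>s\<close> and \<open>t\<close> by \<open>ls\<close> and \<open>lt\<close>
  taken at \<open>u\<close> and \<open>v\<close> changes only order \<open>N + 1\<close>.\<close>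

lemma approx_exists: "\<exists>T. ser_ord_ge N (F - subst2 u v T)"
proof (induction N)
  case 0
  then show ?case by (simp add: ser_ord_ge_triv)
next
  case (Suc N)
  then obtain T where T: "ser_ord_ge N (F - subst2 u v T)" by blast
  define G where "G = F - subst2 u v T"
  define T' where "T' = (\<Sum>i\<le>N. pconst (fps_nth (fps_nth G i) (N - i)) * (ls ^ i * lt ^ (N - i)))"
  define G' where "G' = (\<Sum>i\<le>N. ser_const (fps_nth (fps_nth G i) (N - i)) * (ser_s ^ i * ser_t ^ (N - i)))"
  have "ser_ord_ge (Suc N) (G - G')"
    unfolding ser_ord_ge_def
  proof (intro allI impI)
    fix i j :: nat assume ij: "i + j < Suc N"
    have "fps_nth (fps_nth G' i) j = (\<Sum>k\<le>N. if i = k \<and> j = N - k then fps_nth (fps_nth G k) (N - k) else 0)"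
      unfolding G'_def by (simp add: fps_sum_nth ser_mon_nth)
    also have "\<dots> = (\<Sum>k\<le>N. if k = i then (if j = N - i then fps_nth (fps_nth G i) j else 0) else 0)"
      by (intro sum.cong refl) auto
    also have "\<dots> = (if j = N - i then fps_nth (fps_nth G i) j else 0)" using ij by simp
    also have "\<dots> = fps_nth (fps_nth G i) j" using T ij unfolding G_def[symmetric] ser_ord_ge_def by auto
    finally show "fps_nth (fps_nth (G - G') i) j = 0" by simp
  qed
  moreover have "ser_ord_ge (Suc N) (G' - subst2 u v T')"
    unfolding G'_def T'_def hom_sum[OF ring_hom1_subst2] hom_mult[OF ring_hom1_subst2]
      hom_power[OF ring_hom1_subst2] subst2_pconst sum_subtractf[symmetric] right_diff_distrib[symmetric]
  proof (intro ser_ord_ge_sum ser_ord_ge_mult_left)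
    fix i assume "i \<in> {..N}"
    then have "Suc N = Suc (i + (N - i))" by simp
    then show "ser_ord_ge (Suc N) (ser_s ^ i * ser_t ^ (N - i) - subst2 u v ls ^ i * subst2 u v lt ^ (N - i))"
      using ser_ord_ge_cong_power_mult[OF s_approx st_ord(1) lin_ord[of "d / D" "- b / D", folded ls_def]
          t_approx st_ord(2) lin_ord[of "- c / D" "a / D", folded lt_def], of i "N - i"]
      by simp
  qed
  ultimately have "ser_ord_ge (Suc N) ((G - G') + (G' - subst2 u v T'))" by (rule ser_ord_ge_add)
  moreover have "(G - G') + (G' - subst2 u v T') = F - subst2 u v (T + T')"
    by (simp add: G_def hom_add[OF ring_hom1_subst2])
  ultimately have "ser_ord_ge (Suc N) (F - subst2 u v (T + T'))" by simp
  then show ?case by blast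
qed

lemma homogeneous_lin: "homogeneous 1 (lin x y)"
  using homogeneous_add[of 1 "pconst x * pvar 1" "pconst y * pvar 2"]
    homogeneous_mult[OF homogeneous_pconst homogeneous_pvar]
  by (auto simp: lin_def)

lemma subst_lin_inverse: "psubst pconst (pair2 ls lt) (psubst pconst (pair2 (lin a b) (lin c d)) W) = W"
proof -
  note ps = ring_hom1_psubst[OF ring_hom1_pconst]
  have pl: "psubst pconst (pair2 x y) (lin \<alpha> \<beta>) = pconst \<alpha> * x + pconst \<beta> * y" for x y :: "2 cpoly" and \<alpha> \<beta>
    by (simp add: lin_def hom_add[OF ps] hom_mult[OF ps] psubst_pvar[OF ring_hom1_pconst] psubst_pconst[OF ring_hom1_pconst])
  have ll: "pconst \<alpha> * lin x y + pconst \<beta> * lin z w = lin (\<alpha> * x + \<beta> * z) (\<alpha> * y + \<beta> * w)" for \<alpha> \<beta> x y z w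
    by (simp add: lin_def hom_add[OF ring_hom1_pconst] hom_mult[OF ring_hom1_pconst] algebra_simps)
  have 1: "psubst pconst (pair2 ls lt) (lin a b) = pvar 1" "psubst pconst (pair2 ls lt) (lin c d) = pvar 2"
    unfolding pl ls_def lt_def ll inverse_matrix
    by (simp_all add: lin_def hom_zero[OF ring_hom1_pconst] hom_one[OF ring_hom1_pconst])
  have "psubst pconst (pair2 ls lt) (pair2 (lin a b) (lin c d) i) = pvar i" for i
    using exhaust_2[of i] 1 by auto
  then show ?thesis
    by (subst hom_psubst[OF ps]) (simp add: psubst_pconst[OF ring_hom1_pconst])
qed

text \<open>Coordinates cannot raise the order of a polynomial: modulo higher order its lowest
  homogeneous part only undergoes the linear substitution, which is invertible and so cannot
  annihilate it.\<close>

lemma subst2_ord_imp: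
  assumes "ser_ord_ge N (subst2 u v W)"
  shows "ord_ge2 N W"
proof (rule ccontr)
  let ?dg = "\<lambda>m::2 \<Rightarrow>\<^sub>0 nat. Poly_Mapping.lookup m 1 + Poly_Mapping.lookup m 2"
  assume "\<not> ord_ge2 N W"
  then obtain m1 where m1: "m1 \<in> Poly_Mapping.keys W" "?dg m1 < N" by (auto simp: ord_ge2_def not_le)
  define k where "k = Min (?dg ` Poly_Mapping.keys W)"
  have kle: "k \<le> ?dg m" if "m \<in> Poly_Mapping.keys W" for m using that by (simp add: k_def)
  have "k \<in> ?dg ` Poly_Mapping.keys W" unfolding k_def by (rule Min_in) (use m1 in auto)
  then obtain m0 where m0: "m0 \<in> Poly_Mapping.keys W" "?dg m0 = k" by auto
  have kN: "k < N" using kle[OF m1(1)] m1(2) by simp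
  define Wk where "Wk = (\<Sum>m\<in>{m\<in>Poly_Mapping.keys W. ?dg m = k}. Poly_Mapping.single m (Poly_Mapping.lookup W m))"
  define W' where "W' = (\<Sum>m\<in>{m\<in>Poly_Mapping.keys W. ?dg m \<noteq> k}. Poly_Mapping.single m (Poly_Mapping.lookup W m))"
  have W: "W = Wk + W'"
  proof -
    have "W = (\<Sum>m\<in>Poly_Mapping.keys W. Poly_Mapping.single m (Poly_Mapping.lookup W m))" by (rule poly_mapping_sum_single)
    also have "Poly_Mapping.keys W = {m\<in>Poly_Mapping.keys W. ?dg m = k} \<union> {m\<in>Poly_Mapping.keys W. ?dg m \<noteq> k}" by auto
    finally show ?thesis unfolding Wk_def W'_def by (subst (asm) sum.union_disjoint) auto
  qed
  have keys_sum: "Poly_Mapping.keys (\<Sum>m\<in>S. Poly_Mapping.single m (f m)) \<subseteq> S" if "finite S" for S :: "(2 \<Rightarrow>\<^sub>0 nat) set" and f :: "_ \<Rightarrow> complex"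
    using that
  proof (induction S)
    case (insert x S)
    then show ?case using Poly_Mapping.keys_add[of "Poly_Mapping.single x (f x)" "\<Sum>m\<in>S. Poly_Mapping.single m (f m)"]
      by (auto simp: keys_single split: if_splits)
  qed simp
  have keysW': "Poly_Mapping.keys W' \<subseteq> {m\<in>Poly_Mapping.keys W. ?dg m \<noteq> k}"
    unfolding W'_def by (rule keys_sum) simp
  have keysWk: "Poly_Mapping.keys Wk \<subseteq> {m\<in>Poly_Mapping.keys W. ?dg m = k}"
    unfolding Wk_def by (rule keys_sum) simp
  have "ord_ge2 (Suc k) W'"
    unfolding ord_ge2_def using keysW' kle by (fastforce simp: Suc_le_eq order.strict_iff_order)
  then have "ser_ord_ge (Suc k) (subst2 u v W')" by (rule ser_ord_ge_subst2[OF u v])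
  moreover have "ser_ord_ge (Suc k) (subst2 u v W)" using assms kN by (auto intro: ser_ord_ge_mono)
  ultimately have 1: "ser_ord_ge (Suc k) (subst2 u v Wk)"
    using ser_ord_ge_diff[of "Suc k" "subst2 u v W" "subst2 u v W'"] by (simp add: W hom_add[OF ring_hom1_subst2])
  define U1 where "U1 = subst2 ser_s ser_t (lin a b)"
  define V1 where "V1 = subst2 ser_s ser_t (lin c d)"
  have lo: "ser_ord_ge 1 U1" "ser_ord_ge 1 V1" unfolding U1_def V1_def subst2_lin by (intro ser_ord_ge_add ser_ord_ge_mult_left st_ord)+
  have du: "ser_ord_ge 2 (u - U1)" "ser_ord_ge 2 (v - V1)"
    unfolding U1_def V1_def ord_ge_2_iff subst2_lin fps_sub_nth fps_add_nth ser_const_mult_nth ser_s_t_nth coeffs uv0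
    by simp_all
  have "ser_ord_ge (Suc k) (subst2 u v Wk - subst2 U1 V1 Wk)"
    unfolding subst2_eq_sum sum_subtractf[symmetric] right_diff_distrib[symmetric]
  proof (intro ser_ord_ge_sum ser_ord_ge_mult_left)
    fix m assume "m \<in> Poly_Mapping.keys Wk"
    then have "?dg m = k" using keysWk by auto
    then show "ser_ord_ge (Suc k) (u ^ Poly_Mapping.lookup m 1 * v ^ Poly_Mapping.lookup m 2 -
        U1 ^ Poly_Mapping.lookup m 1 * V1 ^ Poly_Mapping.lookup m 2)"
      using ser_ord_ge_cong_power_mult[OF du(1) u lo(1) du(2) v lo(2), of "Poly_Mapping.lookup m 1" "Poly_Mapping.lookup m 2"]
      by simp
  qed
  from ser_ord_ge_diff[OF 1 this] have 2: "ser_ord_ge (Suc k) (subst2 U1 V1 Wk)" by simp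
  define Z where "Z = psubst pconst (pair2 (lin a b) (lin c d)) Wk"
  have "subst2 ser_s ser_t Z = subst2 U1 V1 Wk"
  proof -
    have pp: "subst2 ser_s ser_t (pair2 (lin a b) (lin c d) i) = pair2 U1 V1 i" for i
      using exhaust_2[of i] by (auto simp: U1_def V1_def)
    show ?thesis unfolding Z_def hom_psubst[OF ring_hom1_subst2] subst2_pconst pp
      by (simp add: subst2_def)
  qed
  with 2 have Zord: "ord_ge2 (Suc k) Z" by (simp flip: ser_ord_ge_subst2_ser_iff)
  have "homogeneous k Z"
  proof -
    have "homogeneous k (pconst (Poly_Mapping.lookup Wk m) * (lin a b ^ Poly_Mapping.lookup m 1 * lin c d ^ Poly_Mapping.lookup m 2))"
      if "m \<in> Poly_Mapping.keys Wk" for m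
    proof -
      have "homogeneous (0 + (Poly_Mapping.lookup m 1 * 1 + Poly_Mapping.lookup m 2 * 1))
        (pconst (Poly_Mapping.lookup Wk m) * (lin a b ^ Poly_Mapping.lookup m 1 * lin c d ^ Poly_Mapping.lookup m 2))"
        by (intro homogeneous_mult homogeneous_pconst homogeneous_power homogeneous_lin)
      moreover have "?dg m = k" using that keysWk by auto
      ultimately show ?thesis by simp
    qed
    then show ?thesis unfolding Z_def psubst_def by (intro homogeneous_sum) (simp add: prod_2)
  qed
  \<comment> \<open>All monomials of \<open>Z\<close> have degree \<open>k\<close>, yet its order
    exceeds \<open>k\<close>.\<close>
  then have "Poly_Mapping.keys Z = {}" using Zord
    by (fastforce simp: homogeneous_iff ord_ge2_def sum_2)
  then have "Z = 0" by (metis ex_in_conv in_keys_iff lookup_zero poly_mapping_eqI)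
  then have "Wk = 0" using subst_lin_inverse[of Wk] by (simp add: Z_def hom_zero[OF ring_hom1_psubst[OF ring_hom1_pconst]])
  then have "Poly_Mapping.lookup W m0 = Poly_Mapping.lookup W' m0" using W by simp
  moreover have "m0 \<notin> Poly_Mapping.keys W'" using keysW' m0 by auto
  ultimately show False using m0 by (simp add: in_keys_iff)
qed

end

section \<open>Weighted leading forms\<close>

definition weight :: "(2 \<Rightarrow> nat) \<Rightarrow> (2 \<Rightarrow>\<^sub>0 nat) \<Rightarrow> nat" where
  "weight w m = w 1 * Poly_Mapping.lookup m 1 + w 2 * Poly_Mapping.lookup m 2"

lemma weighted_homogeneous_2:
  "weighted_homogeneous w n F \<longleftrightarrow> (\<forall>m\<in>Poly_Mapping.keys F. weight w m = n)"
  by (simp add: weighted_homogeneous_def weight_def sum_2)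

text \<open>The weighted scaling with a formal parameter: the coefficient of degree \<open>k\<close>
  is the weighted homogeneous component of weight \<open>k\<close>. Being a homomorphism into
  polynomials over a domain, it makes leading forms multiplicative.\<close>

definition grade :: "(2 \<Rightarrow> nat) \<Rightarrow> 2 cpoly \<Rightarrow> 2 cpoly poly" where
  "grade w = psubst (\<lambda>c. [:pconst c:]) (\<lambda>i. monom (pvar i) (w i))"

lemma ring_hom1_grade: "ring_hom1 (grade w)"
  unfolding grade_def
  by (intro ring_hom1_psubst ring_hom1_compose[OF ring_hom1_const_poly ring_hom1_pconst])

lemma grade_eq_sum:
  "grade w T = (\<Sum>m\<in>Poly_Mapping.keys T. monom (Poly_Mapping.single m (Poly_Mapping.lookup T m)) (weight w m))"
proof -
  have "[:pconst c:] * (\<Prod>i\<in>UNIV. monom (pvar i) (w i) ^ Poly_Mapping.lookup m i)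
      = monom (Poly_Mapping.single m c) (weight w m)" for m c
  proof -
    have "Poly_Mapping.single m c = pconst c * (pvar 1 ^ Poly_Mapping.lookup m 1 * pvar 2 ^ Poly_Mapping.lookup m 2)"
      using psubst_single[of pconst pvar m c] hom_zero[OF ring_hom1_pconst] by (simp add: prod_2)
    then show ?thesis
      by (simp add: prod_2 monom_power mult_monom weight_def smult_monom)
  qed
  then show ?thesis unfolding grade_def psubst_def by simp
qed

lemma coeff_grade:
  "coeff (grade w T) k = (\<Sum>m\<in>{m\<in>Poly_Mapping.keys T. weight w m = k}. Poly_Mapping.single m (Poly_Mapping.lookup T m))"
  unfolding grade_eq_sum coeff_sum by (simp add: sum.inter_filter)

lemma lookup_coeff_grade:
  "Poly_Mapping.lookup (coeff (grade w T) k) m = (if weight w m = k then Poly_Mapping.lookup T m else 0)"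
proof -
  have "Poly_Mapping.lookup (coeff (grade w T) k) m = (\<Sum>x\<in>{m\<in>Poly_Mapping.keys T. weight w m = k}. if x = m then Poly_Mapping.lookup T x else 0)"
    unfolding coeff_grade lookup_sum by (intro sum.cong) (auto simp: lookup_single when_def)
  then show ?thesis by (auto simp: in_keys_iff)
qed

lemma weighted_homogeneous_coeff_grade: "weighted_homogeneous w k (coeff (grade w T) k)"
  by (auto simp: weighted_homogeneous_2 in_keys_iff lookup_coeff_grade split: if_splits)

lemma grade_weighted_homogeneous: "weighted_homogeneous w n Q \<Longrightarrow> grade w Q = monom Q n"
  by (rule poly_eqI, rule poly_mapping_eqI)
    (auto simp: lookup_coeff_grade weighted_homogeneous_2 in_keys_iff split: if_splits)

lemma grade_eq_0_iff: "grade w T = 0 \<longleftrightarrow> T = 0"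
proof
  assume "grade w T = 0"
  then show "T = 0"
    by (intro poly_mapping_eqI) (metis coeff_0 lookup_coeff_grade lookup_zero)
qed (simp add: hom_zero[OF ring_hom1_grade])

lemma poly_split_X:
  assumes "p \<noteq> (0 :: 'a::idom poly)"
  shows "\<exists>k q. p = monom 1 k * q \<and> coeff q 0 \<noteq> 0"
  using assms
proof (induction p)
  case (pCons a p)
  show ?case
  proof (cases "a = 0")
    case True
    then obtain k q where "p = monom 1 k * q" "coeff q 0 \<noteq> 0" using pCons by auto
    then have "pCons a p = monom 1 (Suc k) * q" using True by (simp add: monom_Suc)
    then show ?thesis using \<open>coeff q 0 \<noteq> 0\<close> by blast
  next
    case False
    then show ?thesis by (intro exI[of _ 0] exI[of _ "pCons a p"]) simp
  qed
qed simp

lemma coeff_monom_mult': "coeff (monom (1::'a::comm_ring_1) k * q) n = (if k \<le> n then coeff q (n - k) else 0)"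
  by (simp add: coeff_monom_mult)

definition common_zero_free :: "2 cpoly \<Rightarrow> 2 cpoly \<Rightarrow> bool" where
  "common_zero_free P Q \<longleftrightarrow> (\<forall>v. peval P v = 0 \<longrightarrow> peval Q v = 0 \<longrightarrow> v = 0)"

lemma dvd_power_diff: "(x - y :: 'a::comm_ring_1) dvd x ^ k - y ^ k"
proof (induction k)
  case (Suc k)
  have "x ^ Suc k - y ^ Suc k = x * (x ^ k - y ^ k) + (x - y) * y ^ k" by (simp add: algebra_simps)
  then show ?case using Suc by (metis dvd_add dvd_mult dvd_triv_left)
qed simp

lemma dvd_sum_single:
  assumes "\<And>m. m \<in> Poly_Mapping.keys P \<Longrightarrow> L dvd Poly_Mapping.single m (Poly_Mapping.lookup P m)"
  shows "L dvd (P :: 2 cpoly)"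
proof -
  have "L dvd (\<Sum>m\<in>Poly_Mapping.keys P. Poly_Mapping.single m (Poly_Mapping.lookup P m))"
    by (intro dvd_sum assms)
  then show ?thesis by (simp flip: poly_mapping_sum_single)
qed

lemma single2: "Poly_Mapping.single (m :: 2 \<Rightarrow>\<^sub>0 nat) c = pconst c * (pvar 1 ^ Poly_Mapping.lookup m 1 * pvar 2 ^ Poly_Mapping.lookup m 2)"
  using psubst_single[of pconst pvar m c] hom_zero[OF ring_hom1_pconst] by (simp add: prod_2)

lemma peval_eq_sum2: "peval (F :: 2 cpoly) v = (\<Sum>m\<in>Poly_Mapping.keys F. Poly_Mapping.lookup F m *
    (v $ 1 ^ Poly_Mapping.lookup m 1 * v $ 2 ^ Poly_Mapping.lookup m 2))"
  unfolding peval_eq_sum by (simp add: prod_2)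

text \<open>The equation \<open>L\<close> of the closure of the orbit of \<open>v\<close> under the weighted action of the multiplicative
  group divides every weighted homogeneous polynomial that vanishes at \<open>v\<close>.\<close>

lemma weighted_homogeneous_orbit_factor:
  fixes v :: "complex ^ 2"
  assumes w: "\<And>i. w i > 0" and v: "v \<noteq> 0"
  shows "\<exists>L. ord_ge2 1 L \<and>
    (\<forall>n P. weighted_homogeneous w n P \<longrightarrow> peval P v = 0 \<longrightarrow> L dvd P)"
proof -
  have w12: "w 1 > 0" "w 2 > 0" using w by auto
  have ordpv: "ord_ge2 1 (pvar i)" for i :: 2
    using exhaust_2[of i] by (auto simp: ord_ge2_def pvar_def lookup_single)
  \<comment> \<open>On a coordinate axis the orbit equation is a variable. A monomial free of
    \<open>pvar i\<close> is determined by its weight; it would be the only one contributing to the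
    value at \<open>v\<close>, and that value would be nonzero.\<close>
  have axis: "pvar i dvd P"
    if vi: "v $ i = 0" "v $ j \<noteq> 0" and ij: "(i = 1 \<and> j = 2) \<or> (i = 2 \<and> j = 1)"
      and P: "weighted_homogeneous w n P" "peval P v = 0" for i j n P
  proof (rule dvd_sum_single)
    fix m assume m: "m \<in> Poly_Mapping.keys P"
    have "Poly_Mapping.lookup m i \<noteq> 0"
    proof
      assume m0: "Poly_Mapping.lookup m i = 0"
      have uniq: "m' = m" if "m' \<in> Poly_Mapping.keys P" "Poly_Mapping.lookup m' i = 0" for m'
      proof -
        have "weight w m' = weight w m" using P m that by (simp add: weighted_homogeneous_2)
        then have "Poly_Mapping.lookup m' j = Poly_Mapping.lookup m j"
          using m0 that ij w12 by (auto simp: weight_def)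
        then have "Poly_Mapping.lookup m' 1 = Poly_Mapping.lookup m 1 \<and> Poly_Mapping.lookup m' 2 = Poly_Mapping.lookup m 2"
          using m0 that ij by auto
        then show ?thesis by (metis mon2_eq)
      qed
      have "peval P v = (\<Sum>m'\<in>Poly_Mapping.keys P. if m' = m then Poly_Mapping.lookup P m * v $ j ^ Poly_Mapping.lookup m j else 0)"
        unfolding peval_eq_sum2
      proof (intro sum.cong refl)
        fix m' assume m': "m' \<in> Poly_Mapping.keys P"
        show "Poly_Mapping.lookup P m' * (v $ 1 ^ Poly_Mapping.lookup m' 1 * v $ 2 ^ Poly_Mapping.lookup m' 2) =
          (if m' = m then Poly_Mapping.lookup P m * v $ j ^ Poly_Mapping.lookup m j else 0)"
        proof (cases "m' = m")
          case True
          then show ?thesis using ij m0 by (elim disjE) simp_all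
        next
          case False
          then have "Poly_Mapping.lookup m' i \<noteq> 0" using uniq[OF m'] by blast
          then have "v $ i ^ Poly_Mapping.lookup m' i = 0" using vi by simp
          then show ?thesis using ij False by (elim disjE conjE) simp_all
        qed
      qed
      also have "\<dots> = Poly_Mapping.lookup P m * v $ j ^ Poly_Mapping.lookup m j" using m by simp
      finally show False using P m vi by (simp add: in_keys_iff)
    qed
    then have "pvar i dvd pvar i ^ Poly_Mapping.lookup m i" by (simp add: dvd_power)
    then show "pvar i dvd Poly_Mapping.single m (Poly_Mapping.lookup P m)"
      unfolding single2 using ij by auto
  qed
  show ?thesis
  proof (cases "v $ 1 = 0 \<or> v $ 2 = 0")
    case True
    then obtain i j where ij: "v $ i = 0" "v $ j \<noteq> 0" "(i = 1 \<and> j = 2) \<or> (i = 2 \<and> j = 1)"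
      using v by (auto simp: vec_eq_iff forall_2)
    show ?thesis
      by (rule exI[of _ "pvar i"]) (use axis[OF ij] ordpv in auto)
  next
    case False
    \<comment> \<open>Dividing by the common factor gives coprime weights \<open>p\<close> and
      \<open>q\<close>; the orbit closure is then the curve
      \<open>x ^ q = c * y ^ p\<close>.\<close>
    define g where "g = gcd (w 1) (w 2)"
    define p q where "p = w 1 div g" and "q = w 2 div g"
    have g: "g > 0" "w 1 = g * p" "w 2 = g * q" using w12 by (auto simp: g_def p_def q_def)
    have "p \<noteq> 0" using g(2) w12(1) by (cases "p = 0") simp_all
    moreover have "q \<noteq> 0" using g(3) w12(2) by (cases "q = 0") simp_all
    moreover have "coprime p q" unfolding p_def q_def g_def by (rule div_gcd_coprime) (use w12 in simp)
    ultimately have pq: "p > 0" "q > 0" "coprime p q" by simp_all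
    define c where "c = v $ 1 ^ q / v $ 2 ^ p"
    define L :: "2 cpoly" where "L = pvar 1 ^ q - pconst c * pvar 2 ^ p"
    have c: "v $ 1 ^ q = c * v $ 2 ^ p" using False by (simp add: c_def)
    have Lv: "peval L x = x $ 1 ^ q - c * x $ 2 ^ p" for x by (simp add: L_def peval_simps)
    have "L dvd P" if P: "weighted_homogeneous w n P" "peval P v = 0" for n P
    proof (cases "P = 0")
      case P0: False
      let ?K = "Poly_Mapping.keys P"
      have "?K \<noteq> {}" using P0 by (metis ex_in_conv in_keys_iff lookup_zero poly_mapping_eqI)
      then obtain m0 where m0: "m0 \<in> ?K" "\<And>m. m \<in> ?K \<Longrightarrow> Poly_Mapping.lookup m0 1 \<le> Poly_Mapping.lookup m 1"
        using ex_has_least_nat[of "\<lambda>m. m \<in> ?K" _ "\<lambda>m. Poly_Mapping.lookup m 1"] by blast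
      let ?i = "Poly_Mapping.lookup m0 1" and ?j = "Poly_Mapping.lookup m0 2"
      \<comment> \<open>Exponents of equal weight differ by multiples of \<open>(q, -p)\<close>,
        because \<open>p\<close> and \<open>q\<close> are coprime. Starting from the least first
        exponent keeps \<open>k\<close> a natural number.\<close>
      have "\<exists>k. Poly_Mapping.lookup m 1 = ?i + q * k \<and> ?j = Poly_Mapping.lookup m 2 + p * k" if m: "m \<in> ?K" for m
      proof -
        let ?i' = "Poly_Mapping.lookup m 1" and ?j' = "Poly_Mapping.lookup m 2"
        have "weight w m = weight w m0" using P m m0 by (simp add: weighted_homogeneous_2)
        then have eq: "p * ?i' + q * ?j' = p * ?i + q * ?j"
          using g by (simp add: weight_def mult.assoc distrib_left[symmetric] del: distrib_left)
        obtain t where t: "?i' = ?i + t" using m0(2)[OF m] le_iff_add by blast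
        then have eq2: "p * t + q * ?j' = q * ?j" using eq by (simp add: distrib_left)
        then have "q dvd p * t + q * ?j'" by simp
        then have "q dvd p * t" by (simp add: dvd_add_left_iff)
        then have "q dvd t" using pq(3) by (simp add: coprime_dvd_mult_right_iff coprime_commute)
        then obtain k where k: "t = q * k" by (rule dvdE)
        have "q * (p * k + ?j') = q * ?j" using eq2 k by (simp add: algebra_simps)
        then show ?thesis using t k pq by (intro exI[of _ k]) auto
      qed
      then obtain k where k: "\<And>m. m \<in> ?K \<Longrightarrow> Poly_Mapping.lookup m 1 = ?i + q * k m \<and> ?j = Poly_Mapping.lookup m 2 + p * k m"
        by metis
      \<comment> \<open>Modulo \<open>L\<close> every monomial of \<open>P\<close> reduces to a
        multiple of the same one, with total coefficient \<open>s\<close>. Evaluation at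
        \<open>v\<close>, where neither coordinate is 0, shows \<open>s = 0\<close>.\<close>
      define s where "s = (\<Sum>m\<in>?K. Poly_Mapping.lookup P m * c ^ k m)"
      have each: "L dvd Poly_Mapping.single m a - pconst (a * c ^ k m) * (pvar 1 ^ ?i * pvar 2 ^ ?j)"
        if m: "m \<in> ?K" for m a
      proof -
        have "Poly_Mapping.single m a - pconst (a * c ^ k m) * (pvar 1 ^ ?i * pvar 2 ^ ?j)
          = pconst a * (pvar 1 ^ ?i * pvar 2 ^ Poly_Mapping.lookup m 2) *
              ((pvar 1 ^ q) ^ k m - (pconst c * pvar 2 ^ p) ^ k m)"
          using k[OF m] unfolding single2
          by (simp add: hom_mult[OF ring_hom1_pconst] hom_power[OF ring_hom1_pconst] power_add power_mult
              power_mult_distrib algebra_simps)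
        then show ?thesis using dvd_power_diff[of "pvar 1 ^ q :: 2 cpoly" "pconst c * pvar 2 ^ p" "k m"] by (simp add: L_def)
      qed
      have "L dvd (\<Sum>m\<in>?K. Poly_Mapping.single m (Poly_Mapping.lookup P m)
          - pconst (Poly_Mapping.lookup P m * c ^ k m) * (pvar 1 ^ ?i * pvar 2 ^ ?j))"
        by (intro dvd_sum each)
      also have "\<dots> = P - pconst s * (pvar 1 ^ ?i * pvar 2 ^ ?j)"
        unfolding sum_subtractf poly_mapping_sum_single[symmetric] s_def
        by (simp add: hom_sum[OF ring_hom1_pconst] sum_distrib_right)
      finally have dv: "L dvd P - pconst s * (pvar 1 ^ ?i * pvar 2 ^ ?j)" .
      have "peval L v = 0" using c by (simp add: Lv)
      then have "peval (P - pconst s * (pvar 1 ^ ?i * pvar 2 ^ ?j)) v = 0"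
        using hom_dvd[OF ring_hom1_peval dv, of v] by (simp only: dvd_0_left_iff)
      then have "s * (v $ 1 ^ ?i * v $ 2 ^ ?j) = 0" using P(2) by (simp add: peval_simps)
      then have "s = 0" using False by simp
      then show ?thesis using dv by (simp add: hom_zero[OF ring_hom1_pconst])
    qed simp
    moreover have "ord_ge2 1 L"
    proof -
      have "(pvar 1 :: 2 cpoly) ^ q = Poly_Mapping.single (mon2 q 0) (1::complex)"
        "pconst c * pvar 2 ^ p = Poly_Mapping.single (mon2 0 p) c"
        unfolding single2 by (simp_all add: hom_one[OF ring_hom1_pconst])
      then have "L = Poly_Mapping.single (mon2 q 0) 1 - Poly_Mapping.single (mon2 0 p) c"
        by (simp add: L_def)
      then have "Poly_Mapping.keys L \<subseteq> {mon2 q 0, mon2 0 p}"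
        by (auto simp: in_keys_iff lookup_minus lookup_single when_def split: if_splits)
      then show ?thesis using pq by (auto simp: ord_ge2_def)
    qed
    ultimately show ?thesis by blast
  qed
qed


lemma ser_ord_ge_1_not_unit: "ser_ord_ge 1 F \<Longrightarrow> \<not> F dvd 1"
  by (simp add: fps2_is_unit_iff ser_ord_ge_def)

text \<open>Polynomial approximation modulo order \<open>n + 1\<close> is exact on all weights up to
  \<open>n\<close>. Comparing lowest coefficients of \<open>grade\<close> writes \<open>Q\<close> as
  the product of the leading forms of all the \<open>F l\<close> and of the cofactor, which also
  gives \<open>e l \<le> n\<close>. At a common zero of two of them, the square of the orbit
  equation would divide \<open>Q\<close>, and a non-unit square would divide the squarefree
  series.\<close>

lemma leading_forms:
  fixes F :: "nat \<Rightarrow> series2"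
  assumes uv: "formal_coordinates u v a b c d" and w: "\<And>i. w i > 0"
    and Q: "weighted_homogeneous w n Q" "squarefree (subst2 u v Q)"
    and F: "(\<Prod>l<m. F l) dvd subst2 u v Q"
  obtains T q e where
    "\<And>l. l < m \<Longrightarrow> ser_ord_ge (n + 1) (F l - subst2 u v (T l))"
    "\<And>l. l < m \<Longrightarrow> e l \<le> n"
    "\<And>l. l < m \<Longrightarrow> weighted_homogeneous w (e l) (q l)"
    "\<And>l \<mu>. l < m \<Longrightarrow> \<mu> \<in> Poly_Mapping.keys (T l - q l) \<Longrightarrow> e l < weight w \<mu>"
    "\<And>i j. i < m \<Longrightarrow> j < m \<Longrightarrow> i \<noteq> j \<Longrightarrow> common_zero_free (q i) (q j)"
proof -
  interpret formal_coordinates u v a b c d by (rule uv)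
  obtain K where K: "subst2 u v Q = (\<Prod>l<m. F l) * K" using F by (rule dvdE)
  obtain T where T: "\<And>l. ser_ord_ge (n + 1) (F l - subst2 u v (T l))"
  proof -
    have "\<exists>T. \<forall>l. ser_ord_ge (n + 1) (F l - subst2 u v (T l))" by (intro choice allI approx_exists)
    then show thesis using that by blast
  qed
  obtain TK where TK: "ser_ord_ge (n + 1) (K - subst2 u v TK)" using approx_exists by blast
  have Q0: "Q \<noteq> 0" using Q(2) by (auto simp: hom_zero[OF ring_hom1_subst2])
  define Y where "Y = (\<Prod>l<m. T l) * TK"
  have "ser_ord_ge (n + 1) ((\<Prod>l<m. F l) * K - (\<Prod>l<m. subst2 u v (T l)) * subst2 u v TK)"
    by (intro ser_ord_ge_cong_mult ser_ord_ge_cong_prod T TK)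
  then have "ser_ord_ge (n + 1) (subst2 u v (Q - Y))"
    by (simp add: K[symmetric] Y_def hom_diff[OF ring_hom1_subst2] hom_mult[OF ring_hom1_subst2] hom_prod[OF ring_hom1_subst2])
  then have QY: "ord_ge2 (n + 1) (Q - Y)" by (rule subst2_ord_imp)
  \<comment> \<open>Weights are at least 1, so errors of total degree above \<open>n\<close> also
    have weight above \<open>n\<close>.\<close>
  have wt: "Poly_Mapping.lookup \<mu> 1 + Poly_Mapping.lookup \<mu> 2 \<le> weight w \<mu>" for \<mu>
    using w[of 1] w[of 2] unfolding weight_def by (intro add_mono) (simp_all add: Suc_le_eq)
  have coeffY: "coeff (grade w Y) k = coeff (monom Q n) k" if "k \<le> n" for k
  proof (rule poly_mapping_eqI)
    fix \<mu>
    have "Poly_Mapping.lookup Q \<mu> = Poly_Mapping.lookup Y \<mu>" if "weight w \<mu> = k"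
    proof -
      have "\<mu> \<notin> Poly_Mapping.keys (Q - Y)"
        using QY wt[of \<mu>] \<open>k \<le> n\<close> that by (fastforce simp: ord_ge2_def)
      then show ?thesis by (simp add: in_keys_iff lookup_minus)
    qed
    then have "Poly_Mapping.lookup (coeff (grade w Y) k) \<mu> = Poly_Mapping.lookup (coeff (grade w Q) k) \<mu>"
      by (simp add: lookup_coeff_grade)
    then show "Poly_Mapping.lookup (coeff (grade w Y) k) \<mu> = Poly_Mapping.lookup (coeff (monom Q n) k) \<mu>"
      by (simp add: grade_weighted_homogeneous[OF Q(1)])
  qed
  have Y0: "Y \<noteq> 0" using coeffY[of n] Q0 by (auto simp: hom_zero[OF ring_hom1_grade])
  have "\<exists>k R. grade w (T l) = monom 1 k * R \<and> coeff R 0 \<noteq> 0" if "l < m" for l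
    by (rule poly_split_X) (use Y0 that in \<open>auto simp: Y_def grade_eq_0_iff\<close>)
  then obtain e R where R: "\<And>l. l < m \<Longrightarrow> grade w (T l) = monom 1 (e l) * R l \<and> coeff (R l) 0 \<noteq> 0" by metis
  have "\<exists>k R. grade w TK = monom 1 k * R \<and> coeff R 0 \<noteq> 0"
    by (rule poly_split_X) (use Y0 in \<open>auto simp: Y_def grade_eq_0_iff\<close>)
  then obtain eK RK where RK: "grade w TK = monom 1 eK * RK" "coeff RK 0 \<noteq> 0" by blast
  define E where "E = (\<Sum>l<m. e l) + eK"
  define S where "S = (\<Prod>l<m. R l) * RK"
  have gY: "grade w Y = monom 1 E * S"
  proof -
    have "(\<Prod>l<m. grade w (T l)) = (\<Prod>l<m. monom 1 (e l) * R l)" using R by (intro prod.cong) auto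
    also have "\<dots> = monom 1 (\<Sum>l<m. e l) * (\<Prod>l<m. R l)"
    proof -
      have "(\<Prod>l<k. monom 1 (e l) * R l) = monom 1 (\<Sum>l<k. e l) * (\<Prod>l<k. R l)" for k
      proof (induction k)
        case (Suc k)
        have "monom 1 ((\<Sum>l<k. e l) + e k) = monom (1 :: 2 cpoly) (\<Sum>l<k. e l) * monom 1 (e k)"
          by (simp add: mult_monom)
        then show ?case using Suc by (simp add: mult_ac)
      qed simp
      then show ?thesis .
    qed
    finally have *: "(\<Prod>l<m. grade w (T l)) = monom 1 (\<Sum>l<m. e l) * (\<Prod>l<m. R l)" .
    have "monom (1 :: 2 cpoly) E = monom 1 (\<Sum>l<m. e l) * monom 1 eK" by (simp add: mult_monom E_def)
    then show ?thesis
      unfolding Y_def hom_mult[OF ring_hom1_grade] hom_prod[OF ring_hom1_grade] * RK S_def by (simp add: mult_ac)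
  qed
  have prod0: "coeff (\<Prod>l<k. R l) 0 = (\<Prod>l<k. coeff (R l) 0)" for k
    by (induction k) (simp_all add: coeff_mult_0)
  have S0: "coeff S 0 = (\<Prod>l<m. coeff (R l) 0) * coeff RK 0"
    unfolding S_def coeff_mult_0 prod0 ..
  then have S0': "coeff S 0 \<noteq> 0" using R RK by simp
  \<comment> \<open>The lowest coefficient of the product is nonzero, and up to weight
    \<open>n\<close> the product agrees with \<open>Q\<close>, which lives in weight
    \<open>n\<close> alone.\<close>
  have "E = n"
  proof (rule ccontr)
    assume "E \<noteq> n"
    then consider "E < n" | "n < E" by linarith
    then show False
    proof cases
      case 1
      then have "coeff (monom Q n) E = coeff S 0" using coeffY[of E] by (simp add: gY coeff_monom_mult')
      then show False using S0' 1 by simp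
    next
      case 2
      then have "coeff (monom Q n) n = 0" using coeffY[of n] by (simp add: gY coeff_monom_mult')
      then show False using Q0 by simp
    qed
  qed
  then have QS: "Q = (\<Prod>l<m. coeff (R l) 0) * coeff RK 0"
    using coeffY[of n] S0 by (simp add: gY coeff_monom_mult')
  define q where "q = (\<lambda>l. coeff (R l) 0)"
  have qg: "q l = coeff (grade w (T l)) (e l)" if "l < m" for l
    using R[OF that] by (simp add: q_def coeff_monom_mult')
  show ?thesis
  proof (rule that)
    fix l assume l: "l < m"
    show "ser_ord_ge (n + 1) (F l - subst2 u v (T l))" by (rule T)
    have "e l \<le> (\<Sum>l<m. e l)" by (rule member_le_sum) (use l in auto)
    then show "e l \<le> n" using \<open>E = n\<close> by (simp add: E_def)
    show "weighted_homogeneous w (e l) (q l)"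
      unfolding qg[OF l] by (rule weighted_homogeneous_coeff_grade)
    fix \<mu> assume \<mu>: "\<mu> \<in> Poly_Mapping.keys (T l - q l)"
    have "weight w \<mu> \<noteq> e l"
      using \<mu> by (auto simp: in_keys_iff lookup_minus qg[OF l] lookup_coeff_grade)
    moreover have "\<not> weight w \<mu> < e l"
    proof
      assume lt: "weight w \<mu> < e l"
      then have "coeff (grade w (T l)) (weight w \<mu>) = 0" using R[OF l] by (simp add: coeff_monom_mult')
      then have "Poly_Mapping.lookup (T l) \<mu> = 0" using lookup_coeff_grade[of w "T l" "weight w \<mu>" \<mu>] by simp
      then show False using \<mu> lt by (simp add: in_keys_iff lookup_minus qg[OF l] lookup_coeff_grade)
    qed
    ultimately show "e l < weight w \<mu>" by linarith
  next
    fix i j assume ij: "i < m" "j < m" "i \<noteq> j"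
    show "common_zero_free (q i) (q j)"
      unfolding common_zero_free_def
    proof (intro allI impI, rule ccontr)
      fix x assume x: "peval (q i) x = 0" "peval (q j) x = 0" "x \<noteq> 0"
      obtain L where L: "ord_ge2 1 L" "\<And>k P. weighted_homogeneous w k P \<Longrightarrow> peval P x = 0 \<Longrightarrow> L dvd P"
        using weighted_homogeneous_orbit_factor[of w x] w x(3) by blast
      have wh: "weighted_homogeneous w (e l) (q l)" if "l < m" for l
        unfolding qg[OF that] by (rule weighted_homogeneous_coeff_grade)
      have "L dvd q i" "L dvd q j" using L(2) wh ij x by blast+
      then have "L * L dvd q i * q j" by (rule mult_dvd_mono)
      moreover have "q i * q j dvd (\<Prod>l<m. q l)"
      proof -
        have "(\<Prod>l<m. q l) = q i * (q j * (\<Prod>l\<in>{..<m} - {i} - {j}. q l))"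
          using ij by (subst prod.remove[of _ i], simp, simp, subst prod.remove[of _ j]) auto
        then show ?thesis by (simp add: mult.assoc[symmetric])
      qed
      ultimately have "L * L dvd Q" unfolding QS q_def[symmetric] by (meson dvd_mult2 dvd_trans)
      then have "subst2 u v L ^ 2 dvd subst2 u v Q"
        using hom_dvd[OF ring_hom1_subst2, of "L * L" Q u v] by (simp add: hom_mult[OF ring_hom1_subst2] power2_eq_square)
      then have "subst2 u v L dvd 1" using Q(2) by (simp add: squarefree_def)
      moreover have "ser_ord_ge 1 (subst2 u v L)" by (rule ser_ord_ge_subst2[OF u v L(1)])
      ultimately show False using ser_ord_ge_1_not_unit by blast
    qed
  qed
qed

section \<open>Growth along a component near the singular point\<close>

lemma peval_weight_bound:
  assumes "\<And>\<mu>. \<mu> \<in> Poly_Mapping.keys P \<Longrightarrow> N \<le> weight w \<mu>"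
  obtains C where "C > 0"
    "\<And>z \<rho>. 0 \<le> \<rho> \<Longrightarrow> \<rho> \<le> 1 \<Longrightarrow> norm (z $ 1) \<le> \<rho> ^ w 1 \<Longrightarrow> norm (z $ 2) \<le> \<rho> ^ w 2 \<Longrightarrow>
       norm (peval P z) \<le> C * \<rho> ^ N"
proof (rule that)
  \<comment> \<open>The summand 1 keeps the constant positive when \<open>P\<close> is 0.\<close>
  let ?C = "(\<Sum>\<mu>\<in>Poly_Mapping.keys P. norm (Poly_Mapping.lookup P \<mu>)) + 1"
  show "?C > 0" by (simp add: add_nonneg_pos sum_nonneg)
  fix z :: "complex ^ 2" and \<rho> :: real
  assume \<rho>: "0 \<le> \<rho>" "\<rho> \<le> 1" and z: "norm (z $ 1) \<le> \<rho> ^ w 1" "norm (z $ 2) \<le> \<rho> ^ w 2"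
  have "norm (peval P z) \<le> (\<Sum>\<mu>\<in>Poly_Mapping.keys P. norm (Poly_Mapping.lookup P \<mu>) * \<rho> ^ N)"
    unfolding peval_eq_sum2
  proof (intro order_trans[OF norm_sum] sum_mono)
    fix \<mu> assume \<mu>: "\<mu> \<in> Poly_Mapping.keys P"
    let ?i = "Poly_Mapping.lookup \<mu> 1" and ?j = "Poly_Mapping.lookup \<mu> 2"
    have "norm (z $ 1) ^ ?i * norm (z $ 2) ^ ?j \<le> (\<rho> ^ w 1) ^ ?i * (\<rho> ^ w 2) ^ ?j"
      using z \<rho> by (intro mult_mono power_mono) auto
    also have "\<dots> = \<rho> ^ weight w \<mu>" by (simp add: weight_def power_add power_mult)
    also have "\<dots> \<le> \<rho> ^ N" using assms[OF \<mu>] \<rho> by (intro power_decreasing) auto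
    finally show "norm (Poly_Mapping.lookup P \<mu> * (z $ 1 ^ ?i * z $ 2 ^ ?j)) \<le> norm (Poly_Mapping.lookup P \<mu>) * \<rho> ^ N"
      by (simp add: norm_mult norm_power mult_left_mono)
  qed
  also have "\<dots> \<le> ?C * \<rho> ^ N" using \<rho> by (simp add: distrib_right flip: sum_distrib_right)
  finally show "norm (peval P z) \<le> ?C * \<rho> ^ N" .
qed

lemma peval_ord_bound:
  assumes "ord_ge2 N P"
  obtains C where "C > 0"
    "\<And>z t. 0 \<le> t \<Longrightarrow> t \<le> 1 \<Longrightarrow> norm (z $ 1) \<le> t \<Longrightarrow> norm (z $ 2) \<le> t \<Longrightarrow> norm (peval P z) \<le> C * t ^ N"
proof -
  have "N \<le> weight (\<lambda>_. 1) \<mu>" if "\<mu> \<in> Poly_Mapping.keys P" for \<mu>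
    using assms that by (simp add: ord_ge2_def weight_def)
  from peval_weight_bound[OF this] obtain C where "C > 0"
    "\<And>z \<rho>. 0 \<le> \<rho> \<Longrightarrow> \<rho> \<le> 1 \<Longrightarrow> norm (z $ 1) \<le> \<rho> ^ 1 \<Longrightarrow> norm (z $ 2) \<le> \<rho> ^ 1 \<Longrightarrow> norm (peval P z) \<le> C * \<rho> ^ N"
    by metis
  then show thesis by (intro that[of C]) auto
qed

lemma peval_weighted_scale:
  fixes q :: "2 cpoly"
  assumes "weighted_homogeneous w e q"
  shows "peval q (vector [t ^ w 1 * x, t ^ w 2 * y]) = t ^ e * peval q (vector [x, y])"
  unfolding peval_eq_sum2 sum_distrib_left
proof (intro sum.cong refl)
  fix \<mu> assume "\<mu> \<in> Poly_Mapping.keys q"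
  then have "e = weight w \<mu>" using assms by (simp add: weighted_homogeneous_2)
  then have "t ^ e = (t ^ w 1) ^ Poly_Mapping.lookup \<mu> 1 * (t ^ w 2) ^ Poly_Mapping.lookup \<mu> 2"
    by (simp add: weight_def power_add power_mult)
  then show "Poly_Mapping.lookup q \<mu> * ((vector [t ^ w 1 * x, t ^ w 2 * y] :: complex ^ 2) $ 1 ^ Poly_Mapping.lookup \<mu> 1 *
      (vector [t ^ w 1 * x, t ^ w 2 * y] :: complex ^ 2) $ 2 ^ Poly_Mapping.lookup \<mu> 2) =
    t ^ e * (Poly_Mapping.lookup q \<mu> * ((vector [x, y] :: complex ^ 2) $ 1 ^ Poly_Mapping.lookup \<mu> 1 *
      (vector [x, y] :: complex ^ 2) $ 2 ^ Poly_Mapping.lookup \<mu> 2))"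
    by (simp add: power_mult_distrib mult_ac)
qed

text \<open>On the compact weighted unit sphere the sum of the two moduli has a positive minimum;
  weighted scaling carries the bound to radius \<open>\<rho>\<close>.\<close>

lemma common_zero_free_lower_bound:
  assumes "weighted_homogeneous w e q" "weighted_homogeneous w e' q'" "common_zero_free q q'"
  obtains \<delta> where "\<delta> > 0"
    "\<And>z \<rho>. \<rho> > 0 \<Longrightarrow> norm (z $ 1) \<le> \<rho> ^ w 1 \<Longrightarrow> norm (z $ 2) \<le> \<rho> ^ w 2 \<Longrightarrow>
      norm (z $ 1) = \<rho> ^ w 1 \<or> norm (z $ 2) = \<rho> ^ w 2 \<Longrightarrow>
      \<delta> * \<rho> ^ e \<le> norm (peval q z) \<or> \<delta> * \<rho> ^ e' \<le> norm (peval q' z)"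
proof -
  define S where "S = {z :: complex ^ 2. norm (z $ 1) \<le> 1 \<and> norm (z $ 2) \<le> 1 \<and> (norm (z $ 1) = 1 \<or> norm (z $ 2) = 1)}"
  have "closed S"
    unfolding S_def by (intro closed_Collect_conj closed_Collect_disj closed_Collect_le closed_Collect_eq continuous_intros)
  moreover have "bounded S"
  proof (rule boundedI)
    fix z assume "z \<in> S"
    then have le: "norm (z $ i) \<le> 1" for i using exhaust_2[of i] by (auto simp: S_def)
    have "(\<Sum>i\<in>UNIV. norm (z $ i)) \<le> (\<Sum>i\<in>(UNIV :: 2 set). 1)" by (rule sum_mono) (rule le)
    then show "norm z \<le> 2" 
      using L2_set_le_sum[of UNIV "\<lambda>i. norm (z $ i)"] by (simp add: sum_2 norm_vec_def)
  qed
  ultimately have "compact S" by (simp add: compact_eq_bounded_closed)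
  moreover have "vector [1, 1] \<in> S" by (simp add: S_def)
  moreover have "continuous_on S (\<lambda>z. norm (peval q z) + norm (peval q' z))"
    by (intro continuous_intros continuous_on_peval)
  ultimately obtain z0 where z0: "z0 \<in> S"
      "\<And>z. z \<in> S \<Longrightarrow> norm (peval q z0) + norm (peval q' z0) \<le> norm (peval q z) + norm (peval q' z)"
    using continuous_attains_inf[of S "\<lambda>z. norm (peval q z) + norm (peval q' z)"] by blast
  \<comment> \<open>Half of the minimum, since at each point one of the two summands reaches half of
    the sum.\<close>
  define \<delta> where "\<delta> = (norm (peval q z0) + norm (peval q' z0)) / 2"
  have "z0 \<noteq> 0" using z0(1) by (auto simp: S_def)
  then have "peval q z0 \<noteq> 0 \<or> peval q' z0 \<noteq> 0" using assms(3) by (auto simp: common_zero_free_def)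
  then have \<delta>: "\<delta> > 0" by (auto simp: \<delta>_def add_pos_nonneg add_nonneg_pos)
  show thesis
  proof (rule that[OF \<delta>])
    fix z :: "complex ^ 2" and \<rho> :: real
    assume \<rho>: "\<rho> > 0" and z: "norm (z $ 1) \<le> \<rho> ^ w 1" "norm (z $ 2) \<le> \<rho> ^ w 2"
      "norm (z $ 1) = \<rho> ^ w 1 \<or> norm (z $ 2) = \<rho> ^ w 2"
    define x where "x = z $ 1 / of_real \<rho> ^ w 1"
    define y where "y = z $ 2 / of_real \<rho> ^ w 2"
    have xy: "norm x = norm (z $ 1) / \<rho> ^ w 1" "norm y = norm (z $ 2) / \<rho> ^ w 2"
      using \<rho> by (simp_all add: x_def y_def norm_divide norm_power)
    have "vector [x, y] \<in> S" using z \<rho> by (auto simp: S_def xy divide_simps)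
    then have "2 * \<delta> \<le> norm (peval q (vector [x, y])) + norm (peval q' (vector [x, y]))"
      using z0(2) by (simp add: \<delta>_def)
    then have "\<delta> \<le> norm (peval q (vector [x, y])) \<or> \<delta> \<le> norm (peval q' (vector [x, y]))" by linarith
    moreover have "z = vector [of_real \<rho> ^ w 1 * x, of_real \<rho> ^ w 2 * y]"
      using \<rho> by (simp add: vec_eq_iff forall_2 x_def y_def)
    then have "norm (peval q z) = \<rho> ^ e * norm (peval q (vector [x, y]))"
      "norm (peval q' z) = \<rho> ^ e' * norm (peval q' (vector [x, y]))"
      using \<rho> by (simp_all add: peval_weighted_scale[OF assms(1)] peval_weighted_scale[OF assms(2)] norm_mult norm_power)
    ultimately show "\<delta> * \<rho> ^ e \<le> norm (peval q z) \<or> \<delta> * \<rho> ^ e' \<le> norm (peval q' z)"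
      using \<rho> by (auto simp: mult.commute)
  qed
qed

text \<open>The radius of the weighted sphere through \<open>z\<close>.\<close>

definition quasi_norm :: "(2 \<Rightarrow> nat) \<Rightarrow> complex ^ 2 \<Rightarrow> real" where
  "quasi_norm w z = max (root (w 1) (norm (z $ 1))) (root (w 2) (norm (z $ 2)))"

lemma quasi_norm:
  assumes w: "\<And>i. w i > 0"
  shows "norm (z $ 1) \<le> quasi_norm w z ^ w 1" "norm (z $ 2) \<le> quasi_norm w z ^ w 2"
    "norm (z $ 1) = quasi_norm w z ^ w 1 \<or> norm (z $ 2) = quasi_norm w z ^ w 2"
    "quasi_norm w z \<ge> 0" "z \<noteq> 0 \<Longrightarrow> quasi_norm w z > 0"
proof -
  have r: "root (w i) (norm (z $ i)) ^ w i = norm (z $ i)" "root (w i) (norm (z $ i)) \<ge> 0" for i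
    using w[of i] by simp_all
  show "norm (z $ 1) \<le> quasi_norm w z ^ w 1"
    using power_mono[of "root (w 1) (norm (z $ 1))" "quasi_norm w z" "w 1"] r[of 1] by (simp add: quasi_norm_def)
  show "norm (z $ 2) \<le> quasi_norm w z ^ w 2"
    using power_mono[of "root (w 2) (norm (z $ 2))" "quasi_norm w z" "w 2"] r[of 2] by (simp add: quasi_norm_def)
  show "norm (z $ 1) = quasi_norm w z ^ w 1 \<or> norm (z $ 2) = quasi_norm w z ^ w 2"
    using r[of 1] r[of 2] by (auto simp: quasi_norm_def max_def)
  show "quasi_norm w z \<ge> 0" using r(2)[of 1] by (simp add: quasi_norm_def le_max_iff_disj)
  assume "z \<noteq> 0"
  then have "z $ 1 \<noteq> 0 \<or> z $ 2 \<noteq> 0" by (auto simp: vec_eq_iff forall_2)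
  then show "quasi_norm w z > 0" using w by (auto simp: quasi_norm_def less_max_iff_disj)
qed

lemma quasi_norm_less:
  assumes w: "\<And>i. w i > 0" and "\<epsilon> > 0" "norm (z $ 1) < \<epsilon> ^ w 1" "norm (z $ 2) < \<epsilon> ^ w 2"
  shows "quasi_norm w z < \<epsilon>"
proof -
  have "root (w i) (norm (z $ i)) < \<epsilon>" if "norm (z $ i) < \<epsilon> ^ w i" for i
    using real_root_less_mono[OF w[of i] that] w[of i] \<open>\<epsilon> > 0\<close> by (simp add: real_root_power_cancel)
  then show ?thesis using assms by (simp add: quasi_norm_def)
qed

definition map2 :: "2 cpoly \<Rightarrow> 2 cpoly \<Rightarrow> complex ^ 2 \<Rightarrow> complex ^ 2" where
  "map2 U V z = vector [peval U z, peval V z]"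

lemma peval_psubst2: "peval (psubst pconst (pair2 U V) T) z = peval T (map2 U V z)"
proof -
  have pp: "peval (pair2 U V i) z = map2 U V z $ i" for i
    using exhaust_2[of i] by (auto simp: map2_def)
  show ?thesis
    unfolding hom_psubst[OF ring_hom1_peval] peval_pconst pp by (simp add: peval_def)
qed

lemma subst2_psubst2: "subst2 x y (psubst pconst (pair2 U V) T) = subst2 (subst2 x y U) (subst2 x y V) T"
proof -
  have "subst2 x y (pair2 U V i) = pair2 (subst2 x y U) (subst2 x y V) i" for i
    using exhaust_2[of i] by auto
  then show ?thesis
    unfolding hom_psubst[OF ring_hom1_subst2] subst2_pconst by (simp add: subst2_def)
qed

text \<open>At a zero of \<open>P i\<close> the leading form \<open>q i\<close> equals its error
  term, of size \<open>\<rho> ^ (e i + 1)\<close>, too small for the lower bound. So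
  \<open>q j\<close> satisfies the lower bound, and \<open>P j\<close> differs from it by less than
  half. One \<open>\<rho>\<close>, the quasi-norm of the truncated coordinates, serves all
  pairs.\<close>

lemma (in formal_coordinates) local_comparison:
  fixes P T q :: "nat \<Rightarrow> 2 cpoly" and e :: "nat \<Rightarrow> nat"
  assumes w: "\<And>i. w i > 0" and n: "n > 0"
    and T: "\<And>l. l < m \<Longrightarrow> ser_ord_ge (n + 1) (subst2 ser_s ser_t (P l) - subst2 u v (T l))"
    and e: "\<And>l. l < m \<Longrightarrow> e l \<le> n"
    and q: "\<And>l. l < m \<Longrightarrow> weighted_homogeneous w (e l) (q l)"
    and Tq: "\<And>l \<mu>. l < m \<Longrightarrow> \<mu> \<in> Poly_Mapping.keys (T l - q l) \<Longrightarrow> e l < weight w \<mu>"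
    and free: "\<And>i j. i < m \<Longrightarrow> j < m \<Longrightarrow> i \<noteq> j \<Longrightarrow> common_zero_free (q i) (q j)"
  shows "\<exists>\<rho>. \<forall>i<m. \<forall>j<m. i \<noteq> j \<longrightarrow> (\<exists>r>0. \<exists>c>0. \<exists>C>0. \<forall>z. z \<noteq> 0 \<longrightarrow> norm (z $ 1) < r \<longrightarrow> norm (z $ 2) < r \<longrightarrow>
    peval (P i) z = 0 \<longrightarrow> 0 < \<rho> z \<and> \<rho> z \<le> 1 \<and>
    c * \<rho> z ^ e j \<le> norm (peval (P j) z) \<and> norm (peval (P j) z) \<le> C * \<rho> z ^ e j)"
proof -
  \<comment> \<open>The truncation error has order \<open>n + 1\<close> in \<open>z\<close>; as
    \<open>norm z\<close> is bounded by a multiple of \<open>\<rho> z\<close> and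
    \<open>e l \<le> n\<close>, it is absorbed in \<open>\<rho> z ^ (e l + 1)\<close>.\<close>
  define N where "N = n + 1"
  have N: "2 \<le> N" "1 \<le> N" using n by (auto simp: N_def)
  define U where "U = trunc2 N u"
  define V where "V = trunc2 N v"
  define \<zeta> where "\<zeta> = map2 U V"
  define \<rho> where "\<rho> = (\<lambda>z. quasi_norm w (\<zeta> z))"
  have sU: "ser_ord_ge N (u - subst2 ser_s ser_t U)" and sV: "ser_ord_ge N (v - subst2 ser_s ser_t V)"
    unfolding U_def V_def by (rule ser_ord_ge_trunc2)+
  have oU: "ord_ge2 1 U"
    using ser_ord_ge_diff[OF u ser_ord_ge_mono[OF sU N(2)]] by (simp add: ser_ord_ge_subst2_ser_iff)
  have oV: "ord_ge2 1 V"
    using ser_ord_ge_diff[OF v ser_ord_ge_mono[OF sV N(2)]] by (simp add: ser_ord_ge_subst2_ser_iff)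
  have approx: "ord_ge2 M (X - psubst pconst (pair2 U V) Y)"
    if "ser_ord_ge M (subst2 ser_s ser_t X - subst2 u v Y)" "M \<le> N" for M X Y
  proof -
    have "ser_ord_ge N (subst2 u v Y - subst2 (subst2 ser_s ser_t U) (subst2 ser_s ser_t V) Y)"
      by (rule ser_ord_ge_subst2_cong[OF sU sV])
    from ser_ord_ge_add[OF that(1) ser_ord_ge_mono[OF this that(2)]]
    show ?thesis
      by (simp add: subst2_psubst2 hom_diff[OF ring_hom1_subst2] flip: ser_ord_ge_subst2_ser_iff)
  qed
  obtain CU where CU: "CU > 0" "\<And>z t. 0 \<le> t \<Longrightarrow> t \<le> 1 \<Longrightarrow> norm (z $ 1) \<le> t \<Longrightarrow> norm (z $ 2) \<le> t \<Longrightarrow> norm (peval U z) \<le> CU * t ^ 1"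
    using peval_ord_bound[OF oU] by metis
  obtain CV where CV: "CV > 0" "\<And>z t. 0 \<le> t \<Longrightarrow> t \<le> 1 \<Longrightarrow> norm (z $ 1) \<le> t \<Longrightarrow> norm (z $ 2) \<le> t \<Longrightarrow> norm (peval V z) \<le> CV * t ^ 1"
    using peval_ord_bound[OF oV] by metis
  have os: "ord_ge2 2 (pvar 1 - psubst pconst (pair2 U V) ls)"
    by (rule approx[OF _ N(1)]) (simp add: subst2_pvar s_approx)
  have ot: "ord_ge2 2 (pvar 2 - psubst pconst (pair2 U V) lt)"
    by (rule approx[OF _ N(1)]) (simp add: subst2_pvar t_approx)
  obtain Cs where Cs: "Cs > 0" "\<And>z t. 0 \<le> t \<Longrightarrow> t \<le> 1 \<Longrightarrow> norm (z $ 1) \<le> t \<Longrightarrow> norm (z $ 2) \<le> t \<Longrightarrow>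
      norm (peval (pvar 1 - psubst pconst (pair2 U V) ls) z) \<le> Cs * t ^ 2"
    using peval_ord_bound[OF os] by metis
  obtain Ct where Ct: "Ct > 0" "\<And>z t. 0 \<le> t \<Longrightarrow> t \<le> 1 \<Longrightarrow> norm (z $ 1) \<le> t \<Longrightarrow> norm (z $ 2) \<le> t \<Longrightarrow>
      norm (peval (pvar 2 - psubst pconst (pair2 U V) lt) z) \<le> Ct * t ^ 2"
    using peval_ord_bound[OF ot] by metis
  define B where "B = norm (d / D) + norm (b / D) + norm (c / D) + norm (a / D) + 1"
  have B: "B > 0" by (simp add: B_def add_nonneg_pos)
  define A where "A = max Cs Ct"
  \<comment> \<open>Below this radius the quadratic error satisfies
    \<open>A * t ^ 2 \<le> t / 2\<close>.\<close>
  define r0 where "r0 = min 1 (1 / (2 * A))"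
  have A: "A > 0" using Cs by (simp add: A_def)
  have r0: "r0 > 0" "r0 \<le> 1" using A by (auto simp: r0_def)
  have peval_lin: "peval (lin x y) z = x * z $ 1 + y * z $ 2" for x y z
    by (simp add: lin_def peval_simps)
  define mx where "mx = (\<lambda>z::complex ^ 2. max (norm (z $ 1)) (norm (z $ 2)))"
  \<comment> \<open>The inverse linear part recovers \<open>z\<close> from \<open>\<zeta> z\<close>
    up to a quadratic error, half of which bound is moved to the left: hence the factor 2.\<close>
  have small: "mx z \<le> 2 * B * mx (\<zeta> z)" if z: "mx z < r0" for z
  proof -
    define t where "t = mx z"
    have t: "0 \<le> t" "t \<le> 1" "norm (z $ 1) \<le> t" "norm (z $ 2) \<le> t" "t < r0"
      using z r0 by (auto simp: t_def mx_def le_max_iff_disj)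
    have "t * (2 * A) \<le> 1"
    proof -
      have "t * (2 * A) \<le> (1 / (2 * A)) * (2 * A)" using t(5) A by (intro mult_right_mono) (auto simp: r0_def)
      then show ?thesis using A by simp
    qed
    then have half: "A * t ^ 2 \<le> t / 2" using mult_right_mono[of "t * (2 * A)" 1 t] t(1) by (simp add: power2_eq_square algebra_simps)
    have b1: "norm (x * \<zeta> z $ 1 + y * \<zeta> z $ 2) \<le> (norm x + norm y) * mx (\<zeta> z)" for x y
    proof -
      have "norm (x * \<zeta> z $ 1 + y * \<zeta> z $ 2) \<le> norm x * norm (\<zeta> z $ 1) + norm y * norm (\<zeta> z $ 2)"
        by (metis norm_mult norm_triangle_ineq)
      also have "\<dots> \<le> norm x * mx (\<zeta> z) + norm y * mx (\<zeta> z)"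
        by (intro add_mono mult_left_mono) (auto simp: mx_def)
      finally show ?thesis by (simp add: distrib_right)
    qed
    have mx0: "mx (\<zeta> z) \<ge> 0" by (simp add: mx_def le_max_iff_disj)
    have "norm (z $ 1) \<le> norm (peval ls (\<zeta> z)) + Cs * t ^ 2"
      using Cs(2)[OF t(1-4)] norm_triangle_ineq2[of "z $ 1" "peval ls (\<zeta> z)"]
      by (simp add: peval_simps peval_psubst2 \<zeta>_def)
    also have "\<dots> \<le> B * mx (\<zeta> z) + A * t ^ 2"
      using b1[of "d / D" "- b / D"] mx0 mult_right_mono[of "norm (d / D) + norm (- b / D)" B "mx (\<zeta> z)"]
        mult_right_mono[of Cs A "t ^ 2"]
      by (auto simp: ls_def peval_lin A_def B_def)
    finally have 1: "norm (z $ 1) \<le> B * mx (\<zeta> z) + A * t ^ 2" .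
    have "norm (z $ 2) \<le> norm (peval lt (\<zeta> z)) + Ct * t ^ 2"
      using Ct(2)[OF t(1-4)] norm_triangle_ineq2[of "z $ 2" "peval lt (\<zeta> z)"]
      by (simp add: peval_simps peval_psubst2 \<zeta>_def)
    also have "\<dots> \<le> B * mx (\<zeta> z) + A * t ^ 2"
      using b1[of "- c / D" "a / D"] mx0 mult_right_mono[of "norm (- c / D) + norm (a / D)" B "mx (\<zeta> z)"]
        mult_right_mono[of Ct A "t ^ 2"]
      by (auto simp: lt_def peval_lin A_def B_def)
    finally have "t \<le> B * mx (\<zeta> z) + A * t ^ 2" using 1 by (simp add: t_def mx_def)
    then show ?thesis using half by (simp add: t_def)
  qed
  have wbound: "\<exists>C>0. \<forall>z. mx z < r0 \<longrightarrow> \<rho> z \<le> 1 \<longrightarrow> norm (peval (P l) z - peval (q l) (\<zeta> z)) \<le> C * \<rho> z ^ (e l + 1)"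
    if l: "l < m" for l
  proof -
    have "ord_ge2 N (P l - psubst pconst (pair2 U V) (T l))"
      using approx[of N "P l" "T l"] T[OF l] by (simp add: N_def)
    then obtain C1 where C1: "C1 > 0" "\<And>z t. 0 \<le> t \<Longrightarrow> t \<le> 1 \<Longrightarrow> norm (z $ 1) \<le> t \<Longrightarrow> norm (z $ 2) \<le> t \<Longrightarrow>
        norm (peval (P l - psubst pconst (pair2 U V) (T l)) z) \<le> C1 * t ^ N"
      using peval_ord_bound by metis
    have "e l + 1 \<le> weight w \<mu>" if "\<mu> \<in> Poly_Mapping.keys (T l - q l)" for \<mu>
      using Tq[OF l that] by simp
    from peval_weight_bound[OF this]
    obtain C2 where C2: "C2 > 0" "\<And>z \<rho>. 0 \<le> \<rho> \<Longrightarrow> \<rho> \<le> 1 \<Longrightarrow> norm (z $ 1) \<le> \<rho> ^ w 1 \<Longrightarrow> norm (z $ 2) \<le> \<rho> ^ w 2 \<Longrightarrow>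
        norm (peval (T l - q l) z) \<le> C2 * \<rho> ^ (e l + 1)"
      by metis
    have "norm (peval (P l) z - peval (q l) (\<zeta> z)) \<le> (C1 * (2 * B) ^ N + C2) * \<rho> z ^ (e l + 1)"
      if z: "mx z < r0" "\<rho> z \<le> 1" for z
    proof -
      have \<rho>0: "\<rho> z \<ge> 0" unfolding \<rho>_def by (rule quasi_norm(4)[OF w])
      have zl: "norm (\<zeta> z $ 1) \<le> \<rho> z ^ w 1" "norm (\<zeta> z $ 2) \<le> \<rho> z ^ w 2"
        unfolding \<rho>_def by (rule quasi_norm[OF w])+
      have "\<rho> z ^ w i \<le> \<rho> z" for i
        using power_decreasing[of 1 "w i" "\<rho> z"] w[of i] \<rho>0 z by simp
      then have "mx (\<zeta> z) \<le> \<rho> z" using zl by (auto simp: mx_def intro: order_trans)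
      then have t: "mx z \<le> 2 * B * \<rho> z" using small[OF z(1)] B mult_left_mono[of "mx (\<zeta> z)" "\<rho> z" "2 * B"] by linarith
      have mxz: "0 \<le> mx z" "mx z \<le> 1" "norm (z $ 1) \<le> mx z" "norm (z $ 2) \<le> mx z"
        using z r0 by (auto simp: mx_def le_max_iff_disj)
      have "norm (peval (P l) z - peval (T l) (\<zeta> z)) \<le> C1 * mx z ^ N"
        using C1(2)[OF mxz] by (simp add: peval_simps peval_psubst2 \<zeta>_def)
      also have "\<dots> \<le> C1 * ((2 * B) ^ N * \<rho> z ^ (e l + 1))"
      proof -
        have "mx z ^ N \<le> (2 * B) ^ N * \<rho> z ^ N"
          using power_mono[OF t mxz(1), of N] by (simp add: power_mult_distrib)
        also have "\<dots> \<le> (2 * B) ^ N * \<rho> z ^ (e l + 1)"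
          using e[OF l] \<rho>0 z B by (intro mult_left_mono power_decreasing) (auto simp: N_def)
        finally show ?thesis using C1(1) by simp
      qed
      finally have 1: "norm (peval (P l) z - peval (T l) (\<zeta> z)) \<le> C1 * ((2 * B) ^ N * \<rho> z ^ (e l + 1))" .
      have 2: "norm (peval (T l) (\<zeta> z) - peval (q l) (\<zeta> z)) \<le> C2 * \<rho> z ^ (e l + 1)"
        using C2(2)[OF \<rho>0 z(2) zl] by (simp add: peval_simps)
      have "norm (peval (P l) z - peval (q l) (\<zeta> z)) \<le>
          norm (peval (P l) z - peval (T l) (\<zeta> z)) + norm (peval (T l) (\<zeta> z) - peval (q l) (\<zeta> z))"
        using norm_triangle_ineq[of "peval (P l) z - peval (T l) (\<zeta> z)" "peval (T l) (\<zeta> z) - peval (q l) (\<zeta> z)"] by simp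
      also have "\<dots> \<le> C1 * ((2 * B) ^ N * \<rho> z ^ (e l + 1)) + C2 * \<rho> z ^ (e l + 1)"
        by (intro add_mono 1 2)
      finally show ?thesis by (simp add: distrib_right mult.assoc)
    qed
    moreover have "C1 * (2 * B) ^ N + C2 > 0" using C1 C2 B by (simp add: add_pos_pos)
    ultimately show ?thesis by blast
  qed
  have small_\<rho>: "\<exists>r>0. \<forall>z. mx z < r \<longrightarrow> \<rho> z < \<epsilon>" if "\<epsilon> > 0" for \<epsilon>
  proof -
    define h where "h = min (\<epsilon> ^ w 1) (\<epsilon> ^ w 2)"
    have h: "h > 0" using that by (simp add: h_def)
    define r where "r = min 1 (h / max CU CV)"
    have M: "max CU CV > 0" using CU by (simp add: less_max_iff_disj)
    have "\<rho> z < \<epsilon>" if z: "mx z < r" for z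
    proof -
      have mxz: "0 \<le> mx z" "mx z \<le> 1" "norm (z $ 1) \<le> mx z" "norm (z $ 2) \<le> mx z"
        using z by (auto simp: mx_def r_def le_max_iff_disj)
      have "max CU CV * mx z < h" using z M by (simp add: r_def pos_less_divide_eq mult.commute)
      moreover have "norm (\<zeta> z $ 1) \<le> max CU CV * mx z" "norm (\<zeta> z $ 2) \<le> max CU CV * mx z"
        using CU(2)[OF mxz] CV(2)[OF mxz] mult_right_mono[of CU "max CU CV" "mx z"]
          mult_right_mono[of CV "max CU CV" "mx z"] mxz by (auto simp: \<zeta>_def map2_def)
      ultimately have "norm (\<zeta> z $ 1) < \<epsilon> ^ w 1" "norm (\<zeta> z $ 2) < \<epsilon> ^ w 2" by (auto simp: h_def)
      then show ?thesis unfolding \<rho>_def by (intro quasi_norm_less w \<open>\<epsilon> > 0\<close>)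
    qed
    moreover have "r > 0" using h M by (simp add: r_def)
    ultimately show ?thesis by blast
  qed
  show ?thesis
  proof (intro exI[of _ \<rho>] allI impI)
    fix i j assume ij: "i < m" "j < m" "i \<noteq> j"
    obtain Ci where Ci: "Ci > 0" "\<And>z. mx z < r0 \<Longrightarrow> \<rho> z \<le> 1 \<Longrightarrow> norm (peval (P i) z - peval (q i) (\<zeta> z)) \<le> Ci * \<rho> z ^ (e i + 1)"
      using wbound[OF ij(1)] by blast
    obtain Cj where Cj: "Cj > 0" "\<And>z. mx z < r0 \<Longrightarrow> \<rho> z \<le> 1 \<Longrightarrow> norm (peval (P j) z - peval (q j) (\<zeta> z)) \<le> Cj * \<rho> z ^ (e j + 1)"
      using wbound[OF ij(2)] by blast
    have "e j \<le> weight w \<mu>" if "\<mu> \<in> Poly_Mapping.keys (q j)" for \<mu>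
      using q[OF ij(2)] that by (simp add: weighted_homogeneous_2)
    from peval_weight_bound[OF this]
    obtain Cq where Cq: "Cq > 0" "\<And>z \<rho>. 0 \<le> \<rho> \<Longrightarrow> \<rho> \<le> 1 \<Longrightarrow> norm (z $ 1) \<le> \<rho> ^ w 1 \<Longrightarrow> norm (z $ 2) \<le> \<rho> ^ w 2 \<Longrightarrow>
        norm (peval (q j) z) \<le> Cq * \<rho> ^ e j"
      by metis
    obtain \<delta> where \<delta>: "\<delta> > 0" "\<And>z \<rho>. \<rho> > 0 \<Longrightarrow> norm (z $ 1) \<le> \<rho> ^ w 1 \<Longrightarrow> norm (z $ 2) \<le> \<rho> ^ w 2 \<Longrightarrow>
      norm (z $ 1) = \<rho> ^ w 1 \<or> norm (z $ 2) = \<rho> ^ w 2 \<Longrightarrow>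
      \<delta> * \<rho> ^ e i \<le> norm (peval (q i) z) \<or> \<delta> * \<rho> ^ e j \<le> norm (peval (q j) z)"
      using common_zero_free_lower_bound[OF q[OF ij(1)] q[OF ij(2)] free[OF ij]] by metis
    \<comment> \<open>Below \<open>\<delta> / Ci\<close> the first alternative of the lower bound is
      excluded; below \<open>\<delta> / (2 * Cj)\<close> the error of \<open>P j\<close> uses up at
      most half of \<open>\<delta>\<close>.\<close>
    define \<epsilon> where "\<epsilon> = min 1 (min (\<delta> / Ci) (\<delta> / (2 * Cj)))"
    have \<epsilon>: "\<epsilon> > 0" using \<delta> Ci Cj by (simp add: \<epsilon>_def)
    obtain r1 where r1: "r1 > 0" "\<And>z. mx z < r1 \<Longrightarrow> \<rho> z < \<epsilon>" using small_\<rho>[OF \<epsilon>] by blast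
    define r where "r = min r0 r1"
    show "\<exists>r>0. \<exists>c>0. \<exists>C>0. \<forall>z. z \<noteq> 0 \<longrightarrow> norm (z $ 1) < r \<longrightarrow> norm (z $ 2) < r \<longrightarrow>
      peval (P i) z = 0 \<longrightarrow> 0 < \<rho> z \<and> \<rho> z \<le> 1 \<and>
      c * \<rho> z ^ e j \<le> norm (peval (P j) z) \<and> norm (peval (P j) z) \<le> C * \<rho> z ^ e j"
    proof (intro exI conjI allI impI)
      show "r > 0" "\<delta> / 2 > 0" "Cj + Cq > 0" using r0 r1 \<delta> Cj Cq by (auto simp: r_def)
      fix z :: "complex ^ 2" assume z: "z \<noteq> 0" "norm (z $ 1) < r" "norm (z $ 2) < r" "peval (P i) z = 0"
      have mr: "mx z < r0" "mx z < r1" using z by (auto simp: mx_def r_def)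
      have "mx z > 0" using z(1) by (auto simp: mx_def vec_eq_iff forall_2 less_max_iff_disj)
      then have "mx (\<zeta> z) > 0" using small[OF mr(1)] B
        by (metis less_le_trans zero_less_mult_pos mult_pos_pos zero_less_numeral)
      then have "\<zeta> z \<noteq> 0" by (auto simp: mx_def)
      then show \<rho>0: "\<rho> z > 0" unfolding \<rho>_def by (rule quasi_norm(5)[OF w])
      have \<rho>\<epsilon>: "\<rho> z < \<epsilon>" by (rule r1(2)[OF mr(2)])
      then show \<rho>1: "\<rho> z \<le> 1" by (simp add: \<epsilon>_def)
      have zl: "norm (\<zeta> z $ 1) \<le> \<rho> z ^ w 1" "norm (\<zeta> z $ 2) \<le> \<rho> z ^ w 2"
          "norm (\<zeta> z $ 1) = \<rho> z ^ w 1 \<or> norm (\<zeta> z $ 2) = \<rho> z ^ w 2"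
        unfolding \<rho>_def by (rule quasi_norm[OF w])+
      have "norm (peval (q i) (\<zeta> z)) \<le> Ci * \<rho> z ^ (e i + 1)" using Ci(2)[OF mr(1) \<rho>1] z(4) by simp
      also have "\<dots> = (Ci * \<rho> z) * \<rho> z ^ e i" by simp
      also have "\<dots> < \<delta> * \<rho> z ^ e i"
        using \<rho>\<epsilon> \<rho>0 Ci(1) by (intro mult_strict_right_mono) (auto simp: \<epsilon>_def pos_less_divide_eq mult.commute)
      finally have qj: "\<delta> * \<rho> z ^ e j \<le> norm (peval (q j) (\<zeta> z))" using \<delta>(2)[OF \<rho>0 zl] by linarith
      have "\<rho> z * (2 * Cj) < \<delta>" using \<rho>\<epsilon> Cj(1) by (simp add: \<epsilon>_def pos_less_divide_eq)
      then have "Cj * \<rho> z \<le> \<delta> / 2" by (simp add: mult_ac)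
      then have "(Cj * \<rho> z) * \<rho> z ^ e j \<le> \<delta> / 2 * \<rho> z ^ e j" using \<rho>0 by (intro mult_right_mono) auto
      moreover have Pj: "norm (peval (P j) z - peval (q j) (\<zeta> z)) \<le> (Cj * \<rho> z) * \<rho> z ^ e j"
        using Cj(2)[OF mr(1) \<rho>1] by (simp add: mult_ac)
      moreover have "norm (peval (q j) (\<zeta> z)) \<le> norm (peval (P j) z) + norm (peval (P j) z - peval (q j) (\<zeta> z))"
        by (metis norm_minus_commute norm_triangle_sub)
      ultimately show "\<delta> / 2 * \<rho> z ^ e j \<le> norm (peval (P j) z)" using qj by linarith
      have "norm (peval (P j) z) \<le> norm (peval (q j) (\<zeta> z)) + norm (peval (P j) z - peval (q j) (\<zeta> z))"
        by (metis norm_triangle_sub)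
      moreover have "norm (peval (q j) (\<zeta> z)) \<le> Cq * \<rho> z ^ e j" using \<rho>0 \<rho>1 zl by (intro Cq) auto
      moreover have "(Cj * \<rho> z) * \<rho> z ^ e j \<le> Cj * \<rho> z ^ e j"
        using \<rho>0 \<rho>1 Cj(1) by (intro mult_right_mono) (auto simp: mult_le_cancel_left2)
      ultimately show "norm (peval (P j) z) \<le> (Cj + Cq) * \<rho> z ^ e j" using Pj by (simp add: distrib_right)
    qed
  qed
qed

section \<open>Derivatives and separatrices\<close>

lemma cpoly_ring_induct [case_names pconst pvar add mult]:
  fixes F :: "'i::finite cpoly"
  assumes "\<And>c. P (pconst c)" "\<And>i. P (pvar i)"
    "\<And>F G. P F \<Longrightarrow> P G \<Longrightarrow> P (F + G)" "\<And>F G. P F \<Longrightarrow> P G \<Longrightarrow> P (F * G)"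
  shows "P F"
proof (induction F rule: poly_mapping_additive_induct)
  case (single m a)
  have one: "P 1" using assms(1)[of 1] by (simp add: hom_one[OF ring_hom1_pconst])
  have "P (pvar i ^ n)" for i n by (induction n) (simp_all add: one assms)
  then have "P (\<Prod>i\<in>S. pvar i ^ Poly_Mapping.lookup m i)" for S :: "'i set"
    by (induction S rule: infinite_finite_induct) (simp_all add: one assms)
  moreover have "Poly_Mapping.single m a = pconst a * (\<Prod>i\<in>UNIV. pvar i ^ Poly_Mapping.lookup m i)"
    using psubst_single[of pconst pvar m a] hom_zero[OF ring_hom1_pconst] by simp
  ultimately show ?case by (simp add: assms)
next
  case (add F G)
  then show ?case by (rule assms)
qed

lemma pdiff_superset:
  assumes "finite S" "Poly_Mapping.keys F \<subseteq> S"
  shows "pdiff i F = (\<Sum>m\<in>S. Poly_Mapping.single (m - Poly_Mapping.single i 1)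
       (of_nat (Poly_Mapping.lookup m i) * Poly_Mapping.lookup F m))"
  unfolding pdiff_def using assms
  by (intro sum.mono_neutral_left) (auto simp: in_keys_iff)

lemma pdiff_add: "pdiff i (F + G) = pdiff i F + pdiff i G"
proof -
  let ?S = "Poly_Mapping.keys F \<union> Poly_Mapping.keys G"
  have *: "pdiff i H = (\<Sum>m\<in>?S. Poly_Mapping.single (m - Poly_Mapping.single i 1)
       (of_nat (Poly_Mapping.lookup m i) * Poly_Mapping.lookup H m))"
    if "Poly_Mapping.keys H \<subseteq> ?S" for H
    by (rule pdiff_superset) (use that in auto)
  show ?thesis
    using Poly_Mapping.keys_add[of F G]
    by (simp add: * lookup_add distrib_left single_add sum.distrib)
qed

lemma pdiff_single: "pdiff i (Poly_Mapping.single m a) =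
    Poly_Mapping.single (m - Poly_Mapping.single i 1) (of_nat (Poly_Mapping.lookup m i) * a)"
  by (subst pdiff_superset[of "{m}"]) auto

lemma single_minus_add:
  assumes "Poly_Mapping.lookup m i \<noteq> 0"
  shows "(m - Poly_Mapping.single i 1) + m' = (m + m') - Poly_Mapping.single i (1::nat)"
  by (rule poly_mapping_eqI) (use assms in \<open>auto simp: lookup_add lookup_minus lookup_single when_def\<close>)

lemma pdiff_mult: "pdiff i (F * G) = F * pdiff i G + G * pdiff i F"
proof -
  have ss: "pdiff i (Poly_Mapping.single m a * Poly_Mapping.single m' b) =
      Poly_Mapping.single m a * pdiff i (Poly_Mapping.single m' b) + Poly_Mapping.single m' b * pdiff i (Poly_Mapping.single m a)"
    for m m' :: "'a \<Rightarrow>\<^sub>0 nat" and a b :: complex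
  proof -
    have 1: "Poly_Mapping.single m a * pdiff i (Poly_Mapping.single m' b)
      = Poly_Mapping.single (m + m' - Poly_Mapping.single i 1) (of_nat (Poly_Mapping.lookup m' i) * (a * b))" for m m' :: "'a \<Rightarrow>\<^sub>0 nat" and a b :: complex
      using single_minus_add[of m' i m]
      by (cases "Poly_Mapping.lookup m' i = 0") (simp_all add: pdiff_single mult_single add.commute mult_ac)
    have "Poly_Mapping.single m' b * pdiff i (Poly_Mapping.single m a)
      = Poly_Mapping.single (m + m' - Poly_Mapping.single i 1) (of_nat (Poly_Mapping.lookup m i) * (a * b))"
      using 1[of m' b m a] by (simp add: add.commute mult.commute)
    then show ?thesis
      unfolding 1 by (simp add: mult_single pdiff_single lookup_add distrib_right add.commute flip: single_add)
  qed
  have s: "pdiff i (Poly_Mapping.single m a * G) =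
      Poly_Mapping.single m a * pdiff i G + G * pdiff i (Poly_Mapping.single m a)" for m a G
  proof (induction G rule: poly_mapping_additive_induct)
    case (single m' b)
    show ?case by (rule ss)
  next
    case (add G H)
    then show ?case by (simp add: distrib_left distrib_right pdiff_add add_ac)
  qed
  show ?thesis
  proof (induction F rule: poly_mapping_additive_induct)
    case (single m a)
    show ?case by (rule s)
  next
    case (add F H)
    then show ?case by (simp add: distrib_left distrib_right pdiff_add add_ac)
  qed
qed

lemma pdiff_pconst [simp]: "pdiff i (pconst c) = 0"
  by (simp add: pconst_def pdiff_single)

lemma pdiff_pvar: "pdiff i (pvar j) = (if i = j then 1 else 0)"
  by (auto simp: pvar_def pdiff_single lookup_single when_def)

lemma pdiff_diff: "pdiff i (F - G) = pdiff i F - pdiff i G"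
  using pdiff_add[of i "F - G" G] by simp

lemma pdiff_power: "pdiff i (F ^ n) = of_nat n * F ^ (n - 1) * pdiff i F"
proof (induction n)
  case 0
  then show ?case using pdiff_pconst[of i 1] by (simp add: hom_one[OF ring_hom1_pconst])
next
  case (Suc n)
  then show ?case by (cases n) (simp_all add: pdiff_mult algebra_simps)
qed

lemma homogeneous_pdiff:
  assumes "homogeneous n F"
  shows "homogeneous (n - 1) (pdiff i F)"
  unfolding pdiff_def
proof (rule homogeneous_sum)
  fix m assume m: "m \<in> Poly_Mapping.keys F"
  show "homogeneous (n - 1) (Poly_Mapping.single (m - Poly_Mapping.single i 1) (of_nat (Poly_Mapping.lookup m i) * Poly_Mapping.lookup F m))"
  proof (cases "Poly_Mapping.lookup m i = 0")
    case False
    have "(\<Sum>j\<in>UNIV. Poly_Mapping.lookup (m - Poly_Mapping.single i 1) j) + 1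
        = (\<Sum>j\<in>UNIV. Poly_Mapping.lookup (m - Poly_Mapping.single i 1 + Poly_Mapping.single i 1) j)"
      by (simp add: lookup_add sum.distrib lookup_single when_def)
    also have "m - Poly_Mapping.single i 1 + Poly_Mapping.single i 1 = m"
      using single_minus_add[OF False, of "Poly_Mapping.single i 1"] by simp
    also have "(\<Sum>j\<in>UNIV. Poly_Mapping.lookup m j) = n" using m assms by (simp add: homogeneous_iff)
    finally show ?thesis by (auto simp: homogeneous_iff)
  qed (simp add: homogeneous_0)
qed

lemma single_sum: "Poly_Mapping.single m (sum f S) = (\<Sum>i\<in>S. Poly_Mapping.single m (f i))"
  by (induction S rule: infinite_finite_induct) (simp_all add: single_add)

lemma euler_identity:
  assumes "homogeneous n F"
  shows "(\<Sum>i\<in>UNIV. pvar i * pdiff i F) = of_nat n * F"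
proof -
  have "(\<Sum>i\<in>UNIV. pvar i * pdiff i F) = (\<Sum>i\<in>UNIV. \<Sum>m\<in>Poly_Mapping.keys F. pvar i * pdiff i (Poly_Mapping.single m (Poly_Mapping.lookup F m)))"
    by (simp only: pdiff_def[of _ F] pdiff_single sum_distrib_left)
  also have "\<dots> = (\<Sum>m\<in>Poly_Mapping.keys F. \<Sum>i\<in>UNIV. pvar i * pdiff i (Poly_Mapping.single m (Poly_Mapping.lookup F m)))"
    by (rule sum.swap)
  also have "\<dots> = (\<Sum>m\<in>Poly_Mapping.keys F. of_nat n * Poly_Mapping.single m (Poly_Mapping.lookup F m))"
  proof (intro sum.cong refl)
    fix m assume m: "m \<in> Poly_Mapping.keys F"
    have "pvar i * pdiff i (Poly_Mapping.single m c) = Poly_Mapping.single m (of_nat (Poly_Mapping.lookup m i) * c)" for i c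
      using single_minus_add[of m i "Poly_Mapping.single i 1"]
      by (cases "Poly_Mapping.lookup m i = 0") (simp_all add: pdiff_single pvar_def mult_single add.commute)
    then have "(\<Sum>i\<in>UNIV. pvar i * pdiff i (Poly_Mapping.single m (Poly_Mapping.lookup F m)))
       = Poly_Mapping.single m ((\<Sum>i\<in>UNIV. of_nat (Poly_Mapping.lookup m i)) * Poly_Mapping.lookup F m)"
      by (simp add: sum_distrib_right single_sum)
    also have "(\<Sum>i\<in>UNIV. of_nat (Poly_Mapping.lookup m i)) = (of_nat n :: complex)"
      using m assms by (simp add: homogeneous_iff flip: of_nat_sum)
    also have "Poly_Mapping.single m (of_nat n * Poly_Mapping.lookup F m) = of_nat n * Poly_Mapping.single m (Poly_Mapping.lookup F m)"
      by (simp add: mult_single flip: single_of_nat)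
    finally show "(\<Sum>i\<in>UNIV. pvar i * pdiff i (Poly_Mapping.single m (Poly_Mapping.lookup F m))) = \<dots>" .
  qed
  also have "\<dots> = of_nat n * F"
    by (simp flip: sum_distrib_left poly_mapping_sum_single)
  finally show ?thesis .
qed

text \<open>The chain rule for an abstract derivation that kills scalars, so that both partial
  derivatives of a germ are covered at once.\<close>

lemma derivation_psubst:
  fixes c :: "complex \<Rightarrow> 'r::comm_ring_1" and x :: "'i::finite \<Rightarrow> 'r"
  assumes c: "ring_hom1 c" and add: "\<And>a b. E (a + b) = E a + E b"
    and mult: "\<And>a b. E (a * b) = a * E b + b * E a" and const: "\<And>a. E (c a) = 0"
  shows "E (psubst c x F) = (\<Sum>i\<in>UNIV. psubst c x (pdiff i F) * E (x i))"
proof (induction F rule: cpoly_ring_induct)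
  case (pconst a)
  then show ?case by (simp add: psubst_pconst[OF c] const hom_zero[OF ring_hom1_psubst[OF c]])
next
  case (pvar i)
  have "(\<Sum>j\<in>UNIV. psubst c x (pdiff j (pvar i)) * E (x j)) = (\<Sum>j\<in>UNIV. if j = i then E (x j) else 0)"
    by (intro sum.cong refl) (auto simp: pdiff_pvar hom_simps[OF ring_hom1_psubst[OF c]])
  then show ?case by (simp add: psubst_pvar[OF c])
next
  case (add F G)
  then show ?case
    by (simp add: hom_add[OF ring_hom1_psubst[OF c]] assms(2) pdiff_add distrib_right sum.distrib)
next
  case (mult F G)
  then show ?case
    by (simp add: hom_add[OF ring_hom1_psubst[OF c]] hom_mult[OF ring_hom1_psubst[OF c]] assms(3) pdiff_mult
        distrib_right distrib_left sum.distrib sum_distrib_left mult_ac)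
qed

lemma deriv_s_add: "deriv_s (F + G) = deriv_s F + deriv_s G"
  and deriv_t_add: "deriv_t (F + G) = deriv_t F + deriv_t G"
  by (auto simp: deriv_s_def deriv_t_def intro!: fps_ext)

lemma deriv_s_mult: "deriv_s (F * G) = F * deriv_s G + G * deriv_s F"
  by (simp add: deriv_s_def algebra_simps)

lemma deriv_t_mult: "deriv_t (F * G) = F * deriv_t G + G * deriv_t F"
proof (rule fps_ext)
  fix n
  have sum: "fps_deriv (\<Sum>i\<in>S. f i) = (\<Sum>i\<in>S. fps_deriv (f i))" for S :: "nat set" and f :: "nat \<Rightarrow> complex fps"
    by (induction S rule: infinite_finite_induct) auto
  have "fps_nth (deriv_t (F * G)) n = fps_nth (F * deriv_t G + deriv_t F * G) n"
    by (simp add: deriv_t_def fps_mult_nth sum sum.distrib)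
  then show "fps_nth (deriv_t (F * G)) n = fps_nth (F * deriv_t G + G * deriv_t F) n" by (simp add: mult.commute)
qed

lemma deriv_const: "deriv_s (ser_const c) = 0" "deriv_t (ser_const c) = 0"
  by (auto simp: deriv_s_def deriv_t_def ser_const_def intro!: fps_ext)

lemma deriv_s_t: "deriv_s ser_s = 1" "deriv_s ser_t = 0" "deriv_t ser_s = 0" "deriv_t ser_t = 1"
  by (auto simp: deriv_s_def deriv_t_def ser_s_def ser_t_def fps_X_def intro!: fps_ext)

section \<open>Derivatives of germs in a chart\<close>

lemma index3_neq: "k + 1 \<noteq> (k :: 3)" "k + 2 \<noteq> (k :: 3)" "k + 1 \<noteq> (k + 2 :: 3)"
  by simp_all

lemma UNIV_3_cyclic: "(UNIV :: 3 set) = {k, k + 1, k + 2}"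
proof -
  have "card {k, k + 1, k + 2} = 3" using index3_neq[of k] by (simp add: card_insert_if)
  then show ?thesis by (intro card_subset_eq[symmetric]) auto
qed

lemma sum_3_cyclic: "(\<Sum>i\<in>UNIV. f (i :: 3)) = f k + f (k + 1) + f (k + 2)"
  using index3_neq[of k] by (subst UNIV_3_cyclic[of k]) (simp add: add.assoc)

lemma ring_hom1_germ_at: "ring_hom1 (germ_at p k)"
  unfolding germ_at_def by (rule ring_hom1_psubst[OF ring_hom1_ser_const])

lemma germ_at_pconst: "germ_at p k (pconst c) = ser_const c"
  unfolding germ_at_def by (rule psubst_pconst[OF ring_hom1_ser_const])

lemma deriv_germ_at:
  "deriv_s (germ_at p k F) = germ_at p k (pdiff (k + 1) F)"
  "deriv_t (germ_at p k F) = germ_at p k (pdiff (k + 2) F)"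
proof -
  let ?x = "\<lambda>i. ser_const (p $ i / p $ k) + (if i = k + 1 then ser_s else if i = k + 2 then ser_t else 0)"
  have z: "deriv_s 0 = 0" "deriv_t 0 = 0" by (auto simp: deriv_s_def deriv_t_def intro!: fps_ext)
  have s: "deriv_s (?x i) = (if i = k + 1 then 1 else 0)" for i
    by (simp add: deriv_s_add deriv_const deriv_s_t z)
  have t: "deriv_t (?x i) = (if i = k + 2 then 1 else 0)" for i
    using index3_neq[of k] by (auto simp: deriv_t_add deriv_const deriv_s_t z)
  have "deriv_s (psubst ser_const ?x F) = (\<Sum>i\<in>UNIV. psubst ser_const ?x (pdiff i F) * deriv_s (?x i))"
    by (rule derivation_psubst[of ser_const deriv_s, OF ring_hom1_ser_const deriv_s_add deriv_s_mult deriv_const(1)])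
  then show "deriv_s (germ_at p k F) = germ_at p k (pdiff (k + 1) F)"
    unfolding s sum_3_cyclic[of _ k] germ_at_def using index3_neq[of k] by simp
  have "deriv_t (psubst ser_const ?x F) = (\<Sum>i\<in>UNIV. psubst ser_const ?x (pdiff i F) * deriv_t (?x i))"
    by (rule derivation_psubst[of ser_const deriv_t, OF ring_hom1_ser_const deriv_t_add deriv_t_mult deriv_const(2)])
  then show "deriv_t (germ_at p k F) = germ_at p k (pdiff (k + 2) F)"
    unfolding t sum_3_cyclic[of _ k] germ_at_def using index3_neq[of k] by simp
qed

text \<open>Write \<open>F = g ^ n * h\<close> with \<open>g\<close> not dividing \<open>h\<close>,
  and apply the derivation \<open>E\<close>. After division by \<open>g ^ (n - 1)\<close>,
  invariance of \<open>F\<close> makes \<open>of_nat n * h * E g\<close> divisible by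
  \<open>g\<close>, and \<open>of_nat n\<close> is a unit.\<close>

lemma separatrix_of_invariant:
  assumes g: "irreducible g" "g dvd F" and F: "F \<noteq> 0" "F dvd a * deriv_t F - b * deriv_s F"
  shows "g dvd a * deriv_t g - b * deriv_s g"
proof -
  define E where "E = (\<lambda>F. a * deriv_t F - b * deriv_s F)"
  have E_mult: "E (x * y) = x * E y + y * E x" for x y
    unfolding E_def deriv_s_mult deriv_t_mult by (simp add: algebra_simps)
  have E1: "E 1 = 0" using E_mult[of 1 1] by simp
  have E_power: "E (g ^ Suc n) = of_nat (Suc n) * g ^ n * E g" for n
    by (induction n) (simp_all add: E_mult E1 algebra_simps)
  have p: "prime_elem g" using g(1) by (rule fps_fps_irreducible_imp_prime)
  then have g0: "g \<noteq> 0" "\<not> g dvd 1" by (auto simp: prime_elem_def)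
  have "\<exists>n h. F = g ^ n * h \<and> \<not> g dvd h"
    using F(1)
  proof (induction "fps2_order F" arbitrary: F rule: less_induct)
    case less
    show ?case
    proof (cases "g dvd F")
      case True
      then obtain F1 where F1: "F = g * F1" by (rule dvdE)
      then have "F1 \<noteq> 0" using less.prems by auto
      then have "fps2_order F1 < fps2_order F"
        using F1 g0 fps2_order_mult[of g F1] fps2_order_pos[of g] by simp
      then obtain n h where "F1 = g ^ n * h" "\<not> g dvd h" using less.hyps \<open>F1 \<noteq> 0\<close> by blast
      then show ?thesis using F1 by (intro exI[of _ "Suc n"] exI[of _ h]) (simp add: mult.assoc)
    next
      case False
      then show ?thesis by (intro exI[of _ 0] exI[of _ F]) simp
    qed
  qed
  then obtain n h where nh: "F = g ^ n * h" "\<not> g dvd h" by blast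
  then obtain n' where n: "n = Suc n'" using g(2) by (cases n) auto
  obtain \<theta> where \<theta>: "E F = F * \<theta>" using F(2) unfolding E_def by (rule dvdE)
  have "g ^ n' * (g * E h + of_nat (Suc n') * h * E g) = E F"
    unfolding nh(1) n E_mult E_power by (simp add: algebra_simps)
  also have "\<dots> = g ^ n' * (g * (h * \<theta>))" using \<theta> by (simp add: nh(1) n mult_ac)
  finally have "g * E h + of_nat (Suc n') * h * E g = g * (h * \<theta>)" using g0 by simp
  then have "of_nat (Suc n') * h * E g = g * (h * \<theta> - E h)" by (simp add: algebra_simps)
  then have "g dvd of_nat (Suc n') * h * E g" by simp
  moreover have "\<not> g dvd of_nat (Suc n')"
  proof
    assume dv: "g dvd of_nat (Suc n')"
    have nz: "(of_nat (Suc n') :: complex) \<noteq> 0" by (rule of_nat_neq_0)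
    have "(of_nat (Suc n') :: series2) = ser_const (of_nat (Suc n'))" by (rule hom_of_nat[OF ring_hom1_ser_const, symmetric])
    also have "\<dots> dvd 1" using nz unfolding fps2_is_unit_iff by (simp add: ser_const_def del: of_nat_Suc)
    finally show False using dv g0(2) dvd_trans by blast
  qed
  ultimately have "g dvd E g" using p nh(2) by (metis prime_elem_dvd_mult_iff)
  then show ?thesis by (simp add: E_def)
qed

section \<open>Germs and projective curves\<close>

definition chart_point :: "complex ^ 3 \<Rightarrow> 3 \<Rightarrow> complex ^ 2 \<Rightarrow> complex ^ 3" where
  "chart_point p k z = (\<chi> i. p $ i / p $ k + (if i = k + 1 then z $ 1 else if i = k + 2 then z $ 2 else 0))"

text \<open>Dehomogenization centred at \<open>p\<close> as a polynomial: its expansion is the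
  formal germ and its values are those of the form in the chart, which connects algebra with
  estimates.\<close>

definition affine_part :: "complex ^ 3 \<Rightarrow> 3 \<Rightarrow> 3 cpoly \<Rightarrow> 2 cpoly" where
  "affine_part p k = psubst pconst
     (\<lambda>i. pconst (p $ i / p $ k) + (if i = k + 1 then pvar 1 else if i = k + 2 then pvar 2 else 0))"

lemma germ_at_affine_part: "germ_at p k F = subst2 ser_s ser_t (affine_part p k F)"
  unfolding germ_at_def affine_part_def hom_psubst[OF ring_hom1_subst2] subst2_pconst
  by (rule arg_cong[where f = "\<lambda>x. psubst ser_const x F"])
    (auto simp: hom_add[OF ring_hom1_subst2] subst2_pconst subst2_pvar hom_zero[OF ring_hom1_subst2])

lemma peval_affine_part: "peval (affine_part p k F) z = peval F (chart_point p k z)"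
  unfolding affine_part_def hom_psubst[OF ring_hom1_peval] peval_pconst
  unfolding peval_def[of F]
  by (rule arg_cong[where f = "\<lambda>x. psubst (\<lambda>a. a) x F"])
    (auto simp: hom_add[OF ring_hom1_peval] hom_zero[OF ring_hom1_peval] chart_point_def)

lemma chart_point_nth:
  assumes "p $ k \<noteq> 0"
  shows "chart_point p k z $ k = 1"
    "chart_point p k z $ (k + 1) = p $ (k + 1) / p $ k + z $ 1"
    "chart_point p k z $ (k + 2) = p $ (k + 2) / p $ k + z $ 2"
  using assms index3_neq[of k] by (auto simp: chart_point_def)

lemma all_3_cyclic: "(\<forall>i. P (i :: 3)) \<longleftrightarrow> P k \<and> P (k + 1) \<and> P (k + 2)"
  using UNIV_3_cyclic[of k] by (metis UNIV_I insertE singletonD)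

lemma chart_point_eq_scaled:
  assumes "p $ k \<noteq> 0" "chart_point p k z = c *s p"
  shows "z = 0"
proof -
  have "c = 1 / p $ k" using arg_cong[OF assms(2), of "\<lambda>v. v $ k"] assms(1) by (simp add: chart_point_nth field_simps)
  then have "z $ 1 = 0" "z $ 2 = 0"
    using arg_cong[OF assms(2), of "\<lambda>v. v $ (k + 1)"] arg_cong[OF assms(2), of "\<lambda>v. v $ (k + 2)"] assms(1)
    by (simp_all add: chart_point_nth)
  then show ?thesis by (simp add: vec_eq_iff forall_2)
qed

text \<open>The same dehomogenization in iterated univariate form, where pseudo-division in
  \<open>s\<close> is available.\<close>

definition nest2 :: "complex ^ 3 \<Rightarrow> 3 \<Rightarrow> 3 cpoly \<Rightarrow> complex poly poly" where
  "nest2 p k = psubst (\<lambda>c. [:[:c:]:])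
     (\<lambda>i. [:[:p $ i / p $ k:]:] + (if i = k + 1 then [:0, 1:] else if i = k + 2 then [:[:0, 1:]:] else 0))"

definition ser_of_poly :: "complex poly poly \<Rightarrow> series2" where
  "ser_of_poly G = Abs_fps (\<lambda>i. fps_of_poly (coeff G i))"

lemma ring_hom1_ser_of_poly: "ring_hom1 ser_of_poly"
proof (rule ring_hom1I)
  show "ser_of_poly 1 = 1" by (rule fps_ext) (auto simp: ser_of_poly_def)
  show "ser_of_poly (a + b) = ser_of_poly a + ser_of_poly b" for a b
    by (rule fps_ext) (simp add: ser_of_poly_def fps_of_poly_add)
  have sum: "fps_of_poly (\<Sum>i\<in>S. f i) = (\<Sum>i\<in>S. fps_of_poly (f i))" for S :: "nat set" and f :: "nat \<Rightarrow> complex poly"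
    by (induction S rule: infinite_finite_induct) (auto simp: fps_of_poly_add)
  show "ser_of_poly (a * b) = ser_of_poly a * ser_of_poly b" for a b
    by (rule fps_ext) (simp add: ser_of_poly_def coeff_mult fps_mult_nth sum fps_of_poly_mult atMost_atLeast0)
qed

lemma ser_of_poly_nest2: "ser_of_poly (nest2 p k F) = germ_at p k F"
proof -
  have c: "ser_of_poly [:[:c:]:] = ser_const c" for c
    by (rule fps_ext) (auto simp: ser_of_poly_def ser_const_def coeff_pCons split: nat.splits)
  have s: "ser_of_poly [:0, 1:] = ser_s"
    by (rule fps_ext) (auto simp: ser_of_poly_def ser_s_def coeff_pCons fps_X_def split: nat.splits)
  have t: "ser_of_poly [:[:0, 1:]:] = ser_t"
    by (rule fps_ext) (auto simp: ser_of_poly_def ser_t_def coeff_pCons fps_of_poly_pCons split: nat.splits)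
  show ?thesis
    unfolding germ_at_def nest2_def hom_psubst[OF ring_hom1_ser_of_poly] c
    by (rule arg_cong[where f = "\<lambda>x. psubst ser_const x F"])
      (auto simp: hom_add[OF ring_hom1_ser_of_poly] hom_zero[OF ring_hom1_ser_of_poly] c s t)
qed

lemma nest2_eval: "poly (poly (nest2 p k F) [:x:]) y = peval F (chart_point p k (vector [x, y]))"
proof -
  have h: "ring_hom1 (\<lambda>G. poly (poly G [:x:]) y)"
    by (intro ring_hom1_compose[OF ring_hom1_poly] ring_hom1_poly)
  show ?thesis
    unfolding nest2_def hom_psubst[OF h] peval_def
    by (rule arg_cong2[where f = "\<lambda>c x. psubst c x F"]) (auto simp: chart_point_def)
qed

lemma poly_map_poly_eval: "poly (map_poly (\<lambda>r. poly r y) h) x = poly (poly h [:x:]) y"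
  for h :: "complex poly poly"
  by (induction h) (simp_all add: map_poly_pCons)

text \<open>A nonzero polynomial in \<open>t\<close> alone is a power of \<open>t\<close> times a
  unit series, so \<open>g\<close> divides \<open>ser_t\<close>; since \<open>ser_t\<close> has
  order 1, the cofactor is a unit.\<close>

lemma ser_t_dvd_of_irreducible_dvd:
  assumes g: "irreducible g" "g dvd ser_of_poly [:D:]" and D: "D \<noteq> 0"
  shows "ser_t dvd g"
proof -
  obtain n q where q: "D = monom 1 n * q" "poly q 0 \<noteq> 0" using poly_split_zero[OF D] .
  have p: "prime_elem g" using g(1) by (rule fps_fps_irreducible_imp_prime)
  have "ser_of_poly [:monom 1 n:] = ser_t ^ n"
  proof -
    have "ser_of_poly [:monom 1 n:] = fps_const (fps_of_poly (monom 1 n))"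
      by (rule fps_ext) (auto simp: ser_of_poly_def coeff_pCons split: nat.splits)
    also have "\<dots> = ser_t ^ n" by (simp add: ser_t_def fps_of_poly_monom fps_const_power)
    finally show ?thesis .
  qed
  moreover have "[:D:] = [:monom 1 n:] * [:q:]" by (simp add: q(1))
  ultimately have "ser_of_poly [:D:] = ser_t ^ n * ser_of_poly [:q:]" by (simp only: hom_mult[OF ring_hom1_ser_of_poly])
  then have "g dvd ser_t ^ n \<or> g dvd ser_of_poly [:q:]" using g(2) p by (metis prime_elem_dvd_mult_iff)
  moreover have "ser_of_poly [:q:] dvd 1" using q(2) by (simp add: fps2_is_unit_iff ser_of_poly_def poly_0_coeff_0)
  ultimately have "g dvd ser_t ^ n" using p dvd_trans unfolding prime_elem_def by blast
  then have "g dvd ser_t"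
  proof (induction n)
    case 0
    then show ?case using prime_elem_not_unit[OF p] by simp
  next
    case (Suc n)
    then show ?case by (simp add: prime_elem_dvd_mult_iff[OF p]) blast
  qed
  then obtain h where h: "ser_t = g * h" by (rule dvdE)
  have t0: "ser_t \<noteq> 0" by (simp add: ser_t_def)
  have "fps2_order ser_t = 1" by (simp add: fps2_order_def ser_t_def)
  moreover have nz: "g \<noteq> 0" "h \<noteq> 0" using h t0 by auto
  ultimately have "fps2_order g + fps2_order h = 1" using fps2_order_mult[OF nz] h by simp
  moreover have "fps2_order g > 0" by (rule fps2_order_pos[OF nz(1) prime_elem_not_unit[OF p]])
  ultimately have "\<not> fps2_order h > 0" by linarith
  then have "h dvd 1" using fps2_order_pos[OF nz(2)] by metis
  then show ?thesis using h by (rule_tac dvd_of_eq_mult_unit)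
qed

text \<open>Eliminate \<open>s\<close> between the two affine polynomials. If the combination
  \<open>h\<close> of least degree is free of \<open>s\<close>, a common formal factor must be
  \<open>t\<close>, and both polynomials vanish along the axis \<open>t = 0\<close>. Otherwise
  \<open>h\<close> is a common factor up to polynomials in \<open>t\<close>, and has zeros on almost
  every line of constant \<open>t\<close>. Both contradict the isolated zero at the origin.\<close>

lemma germs_no_common_factor:
  fixes A :: "3 \<Rightarrow> 3 cpoly"
  assumes eu: "(\<Sum>i\<in>UNIV. pvar i * A i) = 0" and pk: "p $ k \<noteq> 0"
    and uniq: "\<And>v. v \<noteq> 0 \<Longrightarrow> (\<And>i. peval (A i) v = 0) \<Longrightarrow> \<exists>c. v = c *s p"
    and g: "irreducible g" "g dvd germ_at p k (A (k + 1))" "g dvd germ_at p k (A (k + 2))"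
  shows False
proof -
  define \<alpha> where "\<alpha> = nest2 p k (A (k + 1))"
  define \<beta> where "\<beta> = nest2 p k (A (k + 2))"
  \<comment> \<open>Where the two affine coefficients vanish, the Euler relation forces the third
    one to vanish, because the coordinate \<open>k\<close> is 1.\<close>
  have zero: "x = 0 \<and> y = 0" if xy: "poly (poly \<alpha> [:x:]) y = 0" "poly (poly \<beta> [:x:]) y = 0" for x y
  proof -
    define v where "v = chart_point p k (vector [x, y])"
    have v1: "v $ k = 1" unfolding v_def by (rule chart_point_nth[OF pk])
    have A12: "peval (A (k + 1)) v = 0" "peval (A (k + 2)) v = 0"
      using xy by (simp_all add: \<alpha>_def \<beta>_def nest2_eval v_def)
    have "peval (\<Sum>i\<in>UNIV. pvar i * A i) v = 0" by (simp add: eu peval_simps)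
    then have "(\<Sum>i\<in>UNIV. v $ i * peval (A i) v) = 0" by (simp add: peval_simps)
    then have "peval (A k) v = 0" using A12 v1 by (simp add: sum_3_cyclic[of _ k])
    then have "\<forall>i. peval (A i) v = 0" using A12 by (simp add: all_3_cyclic[of _ k])
    moreover have "v \<noteq> 0" using v1 by auto
    ultimately obtain c where "v = c *s p" using uniq by blast
    then have "(vector [x, y] :: complex ^ 2) = 0" using chart_point_eq_scaled[OF pk] unfolding v_def by blast
    then show ?thesis by (simp add: vec_eq_iff forall_2)
  qed
  have "\<alpha> \<noteq> 0 \<or> \<beta> \<noteq> 0" using zero[of 1 0] by auto
  then obtain h u v c d q r where h: "h \<noteq> 0" "h = u * \<alpha> + v * \<beta>" "c \<noteq> 0" "d \<noteq> 0"
      "smult c \<alpha> = h * q" "smult d \<beta> = h * r"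
    using poly_ideal_min_degree[of \<alpha> \<beta>] by blast
  show False
  proof (cases "degree h = 0")
    case True
    then obtain D where D: "h = [:D:]" by (rule degree_eq_zeroE)
    have g': "g dvd ser_of_poly \<alpha>" "g dvd ser_of_poly \<beta>" using g by (simp_all add: \<alpha>_def \<beta>_def ser_of_poly_nest2)
    then have "g dvd ser_of_poly [:D:]"
      unfolding D[symmetric] h(2) hom_add[OF ring_hom1_ser_of_poly] hom_mult[OF ring_hom1_ser_of_poly] by simp
    moreover have "D \<noteq> 0" using D h(1) by auto
    ultimately have "ser_t dvd g" using g(1) ser_t_dvd_of_irreducible_dvd by blast
    then have t: "ser_t dvd ser_of_poly \<alpha>" "ser_t dvd ser_of_poly \<beta>" using g' dvd_trans by blast+
    have "poly (poly G [:1:]) 0 = 0" if dv: "ser_t dvd ser_of_poly G" for G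
    proof -
      obtain F where F: "ser_of_poly G = ser_t * F" using dv by (rule dvdE)
      have c0: "poly (coeff G i) 0 = 0" for i
        using arg_cong[OF F, of "\<lambda>S. fps_nth (fps_nth S i) 0"] by (simp add: ser_of_poly_def ser_t_def poly_0_coeff_0)
      have "poly (poly G [:1:]) 0 = (\<Sum>i\<le>degree G. poly (coeff G i) 0)"
        by (simp add: poly_altdef poly_0_coeff_0 coeff_sum flip: one_pCons)
      then show ?thesis by (simp add: c0)
    qed
    then show False using zero[of 1 0] t by simp
  next
    case False
    \<comment> \<open>Bundles all conditions on the line \<open>t = y\<close>: the constants and the
      leading coefficient of \<open>h\<close> must not vanish there, and \<open>y\<close> must not
      be 0.\<close>
    define w where "w = c * d * lead_coeff h * [:0, 1:]"
    have "w \<noteq> 0" using h(1,3,4) by (simp add: w_def del: mult_pCons_right)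
    then have "finite {y. poly w y = 0}" by (rule poly_roots_finite)
    then obtain y where "poly w y \<noteq> 0"
      using infinite_UNIV_char_0[where ?'a = complex] by (metis (mono_tags, lifting) UNIV_eq_I mem_Collect_eq)
    then have y: "poly c y \<noteq> 0" "poly d y \<noteq> 0" "poly (lead_coeff h) y \<noteq> 0" "y \<noteq> 0" by (auto simp: w_def)
    define hy where "hy = map_poly (\<lambda>r. poly r y) h"
    have "coeff hy (degree h) \<noteq> 0" using y by (simp add: hy_def coeff_map_poly)
    then have "degree hy \<noteq> 0" using False by (metis le_degree le_zero_eq)
    then have "\<not> constant (poly hy)" by (simp add: constant_degree)
    then obtain x where "poly hy x = 0" using fundamental_theorem_of_algebra by blast
    then have hx: "poly (poly h [:x:]) y = 0" by (simp add: hy_def poly_map_poly_eval)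
    have "poly c y * poly (poly \<alpha> [:x:]) y = poly (poly (smult c \<alpha>) [:x:]) y" by simp
    also have "\<dots> = 0" unfolding h(5) by (simp add: hx)
    finally have 1: "poly (poly \<alpha> [:x:]) y = 0" using y by simp
    have "poly d y * poly (poly \<beta> [:x:]) y = poly (poly (smult d \<beta>) [:x:]) y" by simp
    also have "\<dots> = 0" unfolding h(6) by (simp add: hx)
    finally have "poly (poly \<beta> [:x:]) y = 0" using y by simp
    then show False using zero[OF 1] y by simp
  qed
qed

section \<open>Zeros and bounds of forms on a plane curve\<close>

lemma form_zero_on_line:
  fixes f :: "3 cpoly"
  assumes f: "homogeneous e f" "e > 0"
  obtains v where "v \<noteq> 0" "v $ s = 0" "peval f v = 0"
proof -
  define a :: "complex ^ 3" where "a = (\<chi> i. if i = s + 1 then 1 else 0)"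
  define b :: "complex ^ 3" where "b = (\<chi> i. if i = s + 2 then 1 else 0)"
  have nth: "a $ s = 0" "b $ s = 0" "a $ (s + 1) = 1" "b $ (s + 1) = 0" "b $ (s + 2) = 1"
    using index3_neq[of s] by (auto simp: a_def b_def)
  show thesis
  proof (cases "peval f b = 0")
    case True
    moreover have "b \<noteq> 0" using nth by auto
    ultimately show thesis using nth that[of b] by blast
  next
    case False
    define q where "q = psubst (\<lambda>c. [:c:]) (\<lambda>i. [:a $ i, b $ i:]) f"
    have "coeff q e \<noteq> 0" unfolding q_def psubst_line(2)[OF f(1)] by (rule False)
    then have "degree q \<noteq> 0" using f(2) by (metis le_degree le_zero_eq neq0_conv)
    then have "\<not> constant (poly q)" by (simp add: constant_degree)
    then obtain y where "poly q y = 0" using fundamental_theorem_of_algebra by blast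
    then have "peval f (\<chi> i. a $ i + y * b $ i) = 0" by (simp add: q_def psubst_peval_poly)
    moreover have "(\<chi> i. a $ i + y * b $ i) $ (s + 1) = 1" "(\<chi> i. a $ i + y * b $ i) $ s = 0" by (simp_all add: nth)
    moreover from this have "(\<chi> i. a $ i + y * b $ i) \<noteq> 0" by (metis one_neq_zero zero_index)
    ultimately show thesis using that by blast
  qed
qed

text \<open>The cofactor is not known to be homogeneous; instead, scaling the argument by
  \<open>t\<close> gives \<open>t ^ (e - n)\<close> times a factor that stays bounded as
  \<open>t\<close> tends to 0.\<close>

lemma homogeneous_dvd_degree:
  fixes f J :: "3 cpoly"
  assumes "homogeneous e f" "homogeneous n J" "f dvd J" "n < e"
  shows "J = 0"
proof (rule peval_eq_0_imp_eq_0)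
  fix v
  obtain K where K: "J = f * K" using assms(3) by (rule dvdE)
  have eq: "peval J v = t ^ (e - n) * peval f v * peval K (t *s v)" if "t \<noteq> 0" for t
  proof -
    have "t ^ n * peval J v = t ^ e * peval f v * peval K (t *s v)"
      unfolding peval_scale[OF assms(2), symmetric] peval_scale[OF assms(1), symmetric] by (simp add: K peval_simps)
    also have "t ^ e = t ^ n * t ^ (e - n)" using assms(4) by (simp flip: power_add)
    finally show ?thesis using that by (simp add: mult.assoc)
  qed
  have "isCont (\<lambda>t. t ^ (e - n) * peval f v * peval K (t *s v)) 0"
  proof -
    have "continuous_on UNIV (\<lambda>t. t *s v)"
      unfolding vector_scalar_mult_def by (intro continuous_intros)
    then have "continuous_on UNIV (\<lambda>t. peval K (t *s v))"
      by (rule continuous_on_compose2[OF continuous_on_peval[of UNIV]]) auto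
    then have "isCont (\<lambda>t. peval K (t *s v)) 0" by (simp add: continuous_on_eq_continuous_at)
    then show ?thesis by (intro continuous_intros)
  qed
  then have "(\<lambda>t. t ^ (e - n) * peval f v * peval K (t *s v)) \<midarrow>0\<rightarrow> 0"
    using assms(4) by (simp add: isCont_def zero_power)
  moreover have "(\<lambda>t. t ^ (e - n) * peval f v * peval K (t *s v)) \<midarrow>0\<rightarrow> peval J v"
    by (rule Lim_transform_eventually[OF tendsto_const]) (auto simp: eventually_at eq intro!: exI[of _ 1])
  ultimately show "peval J v = 0" using LIM_unique by blast
qed

lemma continuous_bound_on_sphere:
  fixes P P' :: "3 cpoly" and T :: "(complex ^ 3) set"
  assumes "closed T" and nz: "\<And>v. v \<in> T \<Longrightarrow> norm v = 1 \<Longrightarrow> peval P' v \<noteq> 0"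
  obtains K where "\<And>v. v \<in> T \<Longrightarrow> norm v = 1 \<Longrightarrow> norm (peval P v) \<le> K * norm (peval P' v)"
proof -
  define S where "S = T \<inter> sphere 0 1"
  have "compact S" unfolding S_def using assms(1) by (intro closed_Int_compact) auto
  moreover have "continuous_on S (\<lambda>v. norm (peval P v / peval P' v))"
    using nz by (intro continuous_intros continuous_on_peval) (auto simp: S_def)
  ultimately have "bounded ((\<lambda>v. norm (peval P v / peval P' v)) ` S)"
    by (intro compact_imp_bounded compact_continuous_image)
  then obtain K where K: "\<And>v. v \<in> S \<Longrightarrow> norm (peval P v / peval P' v) \<le> K"
    by (force simp: bounded_iff)
  show thesis
  proof (rule that)
    fix v assume v: "v \<in> T" "norm v = 1"
    then show "norm (peval P v) \<le> K * norm (peval P' v)"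
      using K[of v] nz[OF v] by (simp add: S_def norm_divide pos_divide_le_eq)
  qed
qed

lemma closed_form_zero_set: "closed {v. peval f v = 0}"
  by (rule closed_Collect_eq) (rule continuous_on_peval, rule continuous_on_const)

lemma homogeneous_bound_from_sphere:
  fixes P P' :: "3 cpoly"
  assumes P: "homogeneous D P" "homogeneous D P'" and v: "v \<noteq> 0"
    and le: "norm (peval P ((1 / of_real (norm v)) *s v)) \<le> K * norm (peval P' ((1 / of_real (norm v)) *s v))"
  shows "norm (peval P v) \<le> K * norm (peval P' v)"
proof -
  define t where "t = (1 / norm v) ^ D"
  have t: "t > 0" using v by (simp add: t_def)
  have "norm ((1 / of_real (norm v)) ^ D :: complex) = t" by (simp add: t_def norm_power norm_divide)
  then have "t * norm (peval P v) \<le> t * (K * norm (peval P' v))"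
    using le unfolding peval_scale[OF P(1)] peval_scale[OF P(2)] norm_mult by (simp add: mult_ac)
  then show ?thesis using t by simp
qed

lemma norm_scaled_unit:
  fixes v :: "complex ^ 3"
  assumes "v \<noteq> 0"
  shows "norm ((1 / of_real (norm v)) *s v) = 1"
proof -
  have "(1 / of_real (norm v)) *s v = (1 / norm v) *\<^sub>R v"
    by (simp add: vec_eq_iff scaleR_conv_of_real[where ?'a = complex])
  then show ?thesis using assms by simp
qed

text \<open>The weak form of Bezout's theorem, from the Liouville theorem. If \<open>h\<close> had
  no zero on the curve, \<open>pvar s ^ D / h\<close> would be bounded by compactness, hence
  constant. The curve meets the line where coordinate \<open>s\<close> is 0, so the constant is 0
  and \<open>f\<close> divides a power of every coordinate; but \<open>f\<close> has a nonzero
  zero.\<close>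

lemma forms_have_common_zero:
  fixes f h :: "3 cpoly"
  assumes f: "irreducible f" "homogeneous e f" "e > 0" and h: "homogeneous D h" "D > 0"
  shows "\<exists>v. v \<noteq> 0 \<and> peval f v = 0 \<and> peval h v = 0"
proof (rule ccontr)
  assume "\<not> ?thesis"
  then have nz: "\<And>v. v \<noteq> 0 \<Longrightarrow> peval f v = 0 \<Longrightarrow> peval h v \<noteq> 0" by blast
  obtain v1 where v1: "v1 \<noteq> 0" "v1 $ 1 = 0" "peval f v1 = 0" using form_zero_on_line[OF f(2,3)] by metis
  have dv: "f dvd pvar s ^ D" for s
  proof -
    have hom: "homogeneous D (pvar s ^ D :: 3 cpoly)" using homogeneous_power[OF homogeneous_pvar, of D s] by simp
    have nz': "peval h v \<noteq> 0" if "v \<in> {v. peval f v = 0}" "norm v = 1" for v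
      using that by (intro nz) auto
    obtain K where K: "\<And>v. v \<in> {v. peval f v = 0} \<Longrightarrow> norm v = 1 \<Longrightarrow> norm (peval (pvar s ^ D) v) \<le> K * norm (peval h v)"
      using continuous_bound_on_sphere[OF closed_form_zero_set nz', where P = "pvar s ^ D"] by blast
    have le: "norm (peval (pvar s ^ D) v) \<le> K * norm (peval h v)" if "peval f v = 0" "v \<noteq> 0" for v
    proof (rule homogeneous_bound_from_sphere[OF hom h(1) that(2)])
      show "norm (peval (pvar s ^ D) ((1 / of_real (norm v)) *s v)) \<le> K * norm (peval h ((1 / of_real (norm v)) *s v))"
        using that norm_scaled_unit[OF that(2)] by (intro K) (simp_all add: peval_scale[OF f(2)])
    qed
    have v0: "v \<noteq> 0" if "\<And>c. v \<noteq> c *s v1" for v :: "complex ^ 3"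
      using that[of 0] by auto
    have "\<exists>c. f dvd pvar s ^ D - pconst c * h"
    proof (rule curve_liouville[OF f v1(1,3) hom h(1)])
      show "peval h v \<noteq> 0" if "peval f v = 0" "\<And>c. v \<noteq> c *s v1" for v
        using nz v0 that by blast
      show "norm (peval (pvar s ^ D) v) \<le> K * norm (peval h v)" if "peval f v = 0" "\<And>c. v \<noteq> c *s v1" for v
        using le v0 that by blast
    qed
    then obtain c where c: "f dvd pvar s ^ D - pconst c * h" by blast
    obtain w where w: "w \<noteq> 0" "w $ s = 0" "peval f w = 0" using form_zero_on_line[OF f(2,3)] by metis
    have "peval (pvar s ^ D - pconst c * h) w = 0"
      using hom_dvd[OF ring_hom1_peval c, of w] w(3) by (simp only: dvd_0_left_iff)
    then have "c * peval h w = 0" using w h(2) by (simp add: peval_simps zero_power)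
    then have "c = 0" using nz[OF w(1,3)] by simp
    then show ?thesis using c by (simp add: hom_zero[OF ring_hom1_pconst])
  qed
  have "v1 $ s = 0" for s
    using hom_dvd[OF ring_hom1_peval dv, of v1 s] v1(3) by (simp add: peval_simps)
  then show False using v1(1) by (simp add: vec_eq_iff)
qed

section \<open>Logarithmic foliations with one singular point\<close>

text \<open>Coefficient of the 2-form \<open>da \<and> db\<close> that survives in the chart
  \<open>k\<close>.\<close>

definition wedge :: "3 \<Rightarrow> 3 cpoly \<Rightarrow> 3 cpoly \<Rightarrow> 3 cpoly" where
  "wedge k a b = pdiff (k + 1) a * pdiff (k + 2) b - pdiff (k + 2) a * pdiff (k + 1) b"

definition jacobian :: "3 \<Rightarrow> 3 cpoly \<Rightarrow> 3 cpoly \<Rightarrow> 3 cpoly \<Rightarrow> 3 cpoly" where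
  "jacobian k a b c = pdiff k a * wedge k b c - pdiff k b * wedge k a c + pdiff k c * wedge k a b"

lemma jacobian_swap12: "jacobian k b a c = - jacobian k a b c"
  and jacobian_swap23: "jacobian k a c b = - jacobian k a b c"
  and jacobian_same: "jacobian k a a c = 0" "jacobian k a c c = 0"
  by (simp_all add: jacobian_def wedge_def algebra_simps)

lemma jacobian_mult: "jacobian k a (b * b') c = b * jacobian k a b' c + b' * jacobian k a b c"
  unfolding jacobian_def wedge_def pdiff_mult by (simp add: algebra_simps)

lemma jacobian_power: "jacobian k a (b ^ n) c = of_nat n * b ^ (n - 1) * jacobian k a b c"
  unfolding jacobian_def wedge_def pdiff_power by (simp add: algebra_simps)

lemma jacobian_diff_cmult: "jacobian k a (b - pconst t * b') c = jacobian k a b c - pconst t * jacobian k a b' c"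
  unfolding jacobian_def wedge_def pdiff_diff pdiff_mult by (simp add: algebra_simps)

lemma homogeneous_diff: "homogeneous n F \<Longrightarrow> homogeneous n G \<Longrightarrow> homogeneous n (F - G)"
  using homogeneous_diff_cmult[of n F G 1] by (simp add: hom_one[OF ring_hom1_pconst])

lemma homogeneous_jacobian:
  assumes "homogeneous d1 a" "homogeneous d2 b" "homogeneous d3 c"
  shows "homogeneous ((d1 - 1) + (d2 - 1) + (d3 - 1)) (jacobian k a b c)"
proof -
  have w: "homogeneous ((n - 1) + (n' - 1)) (wedge k x y)" if "homogeneous n x" "homogeneous n' y" for n n' x y
    unfolding wedge_def using that
    by (intro homogeneous_diff homogeneous_mult homogeneous_pdiff)
  have e: "(d2 - 1) + ((d1 - 1) + (d3 - 1)) = (d1 - 1) + ((d2 - 1) + (d3 - 1))"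
    "(d3 - 1) + ((d1 - 1) + (d2 - 1)) = (d1 - 1) + ((d2 - 1) + (d3 - 1))" by simp_all
  have "homogeneous ((d1 - 1) + ((d2 - 1) + (d3 - 1))) (pdiff k a * wedge k b c)"
    "homogeneous ((d2 - 1) + ((d1 - 1) + (d3 - 1))) (pdiff k b * wedge k a c)"
    "homogeneous ((d3 - 1) + ((d1 - 1) + (d2 - 1))) (pdiff k c * wedge k a b)"
    by (intro homogeneous_mult homogeneous_pdiff w assms)+
  then show ?thesis unfolding e jacobian_def add.assoc by (intro homogeneous_add homogeneous_diff)
qed

text \<open>Contraction of \<open>da \<and> db \<and> dc\<close> with the Euler vector field.\<close>

lemma euler_contraction:
  assumes "homogeneous d1 a" "homogeneous d2 b" "homogeneous d3 c"
  shows "of_nat d1 * a * wedge k b c - of_nat d2 * b * wedge k a c + of_nat d3 * c * wedge k a b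
    = pvar k * jacobian k a b c"
  unfolding euler_identity[OF assms(1), symmetric] euler_identity[OF assms(2), symmetric]
    euler_identity[OF assms(3), symmetric] sum_3_cyclic[of _ k] jacobian_def wedge_def
  by (simp add: algebra_simps)

text \<open>Differentiate the congruence: the Jacobian with \<open>f\<close> and \<open>h\<close>
  kills \<open>h ^ l\<close> and sends multiples of \<open>f\<close> to multiples of
  \<open>f\<close>. What remains is \<open>of_nat n * g ^ (n - 1)\<close> times the wanted
  determinant, and the prime \<open>f\<close> divides neither factor in front.\<close>

lemma dvd_jacobian:
  assumes f: "prime_elem f" "\<not> f dvd g" and n: "n > 0" and dv: "f dvd g ^ n - pconst t * h ^ l"
  shows "f dvd jacobian k f g h"
proof -
  obtain S where S: "g ^ n - pconst t * h ^ l = f * S" using dv by (rule dvdE)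
  have "jacobian k f (h ^ l) h = 0" by (simp add: jacobian_power jacobian_same)
  then have "of_nat n * g ^ (n - 1) * jacobian k f g h = jacobian k f (g ^ n - pconst t * h ^ l) h"
    by (simp add: jacobian_diff_cmult jacobian_power)
  also have "\<dots> = f * jacobian k f S h" unfolding S by (simp add: jacobian_mult jacobian_same)
  finally have "f dvd of_nat n * g ^ (n - 1) * jacobian k f g h" by simp
  moreover have "\<not> f dvd of_nat n"
  proof
    assume fn: "f dvd of_nat n"
    have "of_nat n * pconst (inverse (of_nat n)) = (1 :: 3 cpoly)"
      unfolding hom_of_nat[OF ring_hom1_pconst, symmetric] hom_mult[OF ring_hom1_pconst, symmetric]
      using n by (simp add: hom_one[OF ring_hom1_pconst])
    then have "f dvd 1" using fn by (metis dvd_mult2)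
    then show False using f(1) by (simp add: prime_elem_not_unit)
  qed
  moreover have "\<not> f dvd g ^ j" for j
  proof (induction j)
    case 0
    then show ?case using f(1) by (simp add: prime_elem_not_unit)
  next
    case (Suc j)
    then show ?case using f by (simp add: prime_elem_dvd_mult_iff)
  qed
  ultimately show ?thesis using f(1) by (metis prime_elem_dvd_mult_iff)
qed

text \<open>Outside a polydisc around \<open>p\<close> the unit vectors on the curve form a compact
  set on which \<open>P'\<close> has no zero; inside it the local estimate applies. Equal degrees
  let both bounds pass to all multiples.\<close>

lemma curve_bound:
  fixes f P P' :: "3 cpoly"
  assumes f: "homogeneous e f" and P: "homogeneous D P" "homogeneous D P'" and pk: "p $ k \<noteq> 0"
    and nz: "\<And>v. v \<noteq> 0 \<Longrightarrow> peval f v = 0 \<Longrightarrow> peval P' v = 0 \<Longrightarrow> \<exists>c. v = c *s p"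
    and r: "r > 0" and local: "\<And>z. z \<noteq> 0 \<Longrightarrow> norm (z $ 1) < r \<Longrightarrow> norm (z $ 2) < r \<Longrightarrow> peval f (chart_point p k z) = 0 \<Longrightarrow>
      norm (peval P (chart_point p k z)) \<le> C * norm (peval P' (chart_point p k z))"
  obtains K where "\<And>v. peval f v = 0 \<Longrightarrow> (\<And>c. v \<noteq> c *s p) \<Longrightarrow> norm (peval P v) \<le> K * norm (peval P' v)"
proof -
  define q1 where "q1 = p $ (k + 1) / p $ k"
  define q2 where "q2 = p $ (k + 2) / p $ k"
  \<comment> \<open>The complement of the polydisc, written without division so that it is closed
    and contains the points at infinity. A multiple of \<open>p\<close> in \<open>T\<close> has
    coordinate \<open>k\<close> equal to 0 and is therefore 0.\<close>
  define T where "T = {v. peval f v = 0} \<inter> ({v. r * norm (v $ k) \<le> norm (v $ (k + 1) - q1 * v $ k)} \<union>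
      {v. r * norm (v $ k) \<le> norm (v $ (k + 2) - q2 * v $ k)})"
  have "closed T"
    unfolding T_def by (intro closed_Int closed_form_zero_set closed_Un closed_Collect_le continuous_intros)
  moreover have "peval P' v \<noteq> 0" if v: "v \<in> T" "norm v = 1" for v
  proof
    assume "peval P' v = 0"
    moreover have v0: "v \<noteq> 0" using v(2) by auto
    ultimately obtain c where c: "v = c *s p" using nz v(1) by (auto simp: T_def)
    then have "v $ (k + 1) - q1 * v $ k = 0" "v $ (k + 2) - q2 * v $ k = 0" using pk by (simp_all add: q1_def q2_def)
    then have "r * norm (v $ k) \<le> 0" using v(1) by (auto simp: T_def)
    then have "v $ k = 0" using r by (simp add: mult_le_0_iff)
    then show False using v0 c pk by simp
  qed
  ultimately obtain K1 where K1: "\<And>v. v \<in> T \<Longrightarrow> norm v = 1 \<Longrightarrow> norm (peval P v) \<le> K1 * norm (peval P' v)"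
    using continuous_bound_on_sphere[of T P' P] by blast
  show thesis
  proof (rule that)
    fix v assume v: "peval f v = 0" "\<And>c. v \<noteq> c *s p"
    have v0: "v \<noteq> 0" using v(2)[of 0] by auto
    define t :: complex where "t = 1 / of_real (norm v)"
    define u where "u = t *s v"
    have t0: "t \<noteq> 0" using v0 by (simp add: t_def)
    have nu: "norm u = 1" unfolding u_def t_def by (rule norm_scaled_unit[OF v0])
    have fu: "peval f u = 0" unfolding u_def by (simp add: peval_scale[OF f] v)
    have up: "u \<noteq> c *s p" for c
    proof
      assume "u = c *s p"
      then have "v = (c / t) *s p" using t0 by (auto simp: u_def vec_eq_iff field_simps)
      then show False using v(2) by blast
    qed
    have "norm (peval P u) \<le> max K1 C * norm (peval P' u)"
    proof (cases "u \<in> T")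
      case True
      have "norm (peval P u) \<le> K1 * norm (peval P' u)" by (rule K1[OF True nu])
      also have "\<dots> \<le> max K1 C * norm (peval P' u)" by (intro mult_right_mono) auto
      finally show ?thesis .
    next
      case False
      then have lt: "norm (u $ (k + 1) - q1 * u $ k) < r * norm (u $ k)" "norm (u $ (k + 2) - q2 * u $ k) < r * norm (u $ k)"
        using fu by (auto simp: T_def)
      then have uk: "u $ k \<noteq> 0" by auto
      define z :: "complex ^ 2" where "z = vector [u $ (k + 1) / u $ k - q1, u $ (k + 2) / u $ k - q2]"
      have cz: "chart_point p k z = (1 / u $ k) *s u"
      proof -
        have "\<forall>i. chart_point p k z $ i = ((1 / u $ k) *s u) $ i"
          unfolding all_3_cyclic[of _ k] using uk by (simp add: chart_point_nth[OF pk] z_def q1_def q2_def)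
        then show ?thesis by (simp add: vec_eq_iff)
      qed
      have "norm (z $ 1) = norm (u $ (k + 1) - q1 * u $ k) / norm (u $ k)"
        "norm (z $ 2) = norm (u $ (k + 2) - q2 * u $ k) / norm (u $ k)"
        using uk by (simp_all add: z_def diff_divide_distrib flip: norm_divide)
      then have zr: "norm (z $ 1) < r" "norm (z $ 2) < r" using lt uk by (simp_all add: pos_divide_less_eq)
      have "z \<noteq> 0"
      proof
        assume "z = 0"
        then have "(1 / u $ k) *s u = (1 / p $ k) *s p"
          unfolding cz[symmetric] by (auto simp: chart_point_def vec_eq_iff)
        then have e: "u $ i / u $ k = p $ i / p $ k" for i by (simp add: vec_eq_iff)
        have "u $ i = ((u $ k / p $ k) *s p) $ i" for i
        proof -
          have "u $ i = (u $ i / u $ k) * u $ k" using uk by simp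
          then show ?thesis unfolding e by simp
        qed
        then have "u = (u $ k / p $ k) *s p" unfolding vec_eq_iff by blast
        then show False using up by blast
      qed
      moreover have "peval f (chart_point p k z) = 0" unfolding cz by (simp add: peval_scale[OF f] fu)
      ultimately have "norm (peval P (chart_point p k z)) \<le> C * norm (peval P' (chart_point p k z))"
        by (intro local zr)
      then have "norm ((1 / u $ k) ^ D) * norm (peval P u) \<le> norm ((1 / u $ k) ^ D) * (C * norm (peval P' u))"
        unfolding cz peval_scale[OF P(1)] peval_scale[OF P(2)] norm_mult by (simp add: mult_ac)
      moreover have "norm ((1 / u $ k) ^ D) > 0" using uk by simp
      ultimately have "norm (peval P u) \<le> C * norm (peval P' u)" by (simp only: mult_le_cancel_left_pos)
      also have "\<dots> \<le> max K1 C * norm (peval P' u)" by (intro mult_right_mono) auto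
      finally show ?thesis .
    qed
    then show "norm (peval P v) \<le> max K1 C * norm (peval P' v)"
      unfolding u_def t_def by (rule homogeneous_bound_from_sphere[OF P v0])
  qed
qed

section \<open>Components of a logarithmic form with one singular point\<close>

locale logarithmic_foliation =
  fixes A :: "3 \<Rightarrow> 3 cpoly" and p :: "complex ^ 3" and k :: 3
    and m :: nat and f :: "nat \<Rightarrow> 3 cpoly" and \<delta> :: "nat \<Rightarrow> nat" and \<mu> :: "nat \<Rightarrow> complex"
  assumes irr: "i < m \<Longrightarrow> irreducible (f i)" and hom: "i < m \<Longrightarrow> homogeneous (\<delta> i) (f i)"
    and mu: "i < m \<Longrightarrow> \<mu> i \<noteq> 0" and residues: "(\<Sum>i<m. \<mu> i * of_nat (\<delta> i)) = 0"
    and A: "A j = (\<Sum>i<m. pconst (\<mu> i) * (\<Prod>l\<in>{..<m} - {i}. f l) * pdiff j (f i))"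
    and euler: "(\<Sum>i\<in>UNIV. pvar i * A i) = 0"
    and pk: "p $ k \<noteq> 0" and sing: "singular_points A = {proj_point p}"
begin

lemma singular_imp:
  assumes "v \<noteq> 0" "\<And>i. peval (A i) v = 0"
  shows "\<exists>c. v = c *s p"
proof -
  have "proj_point v \<in> singular_points A" using assms by (auto simp: singular_points_def)
  then have "proj_point v = proj_point p" using sing by simp
  moreover have "v \<in> proj_point v" unfolding proj_point_def by (auto intro!: exI[of _ 1])
  ultimately show ?thesis by (auto simp: proj_point_def)
qed

lemma prime: "i < m \<Longrightarrow> prime_elem (f i)"
  using irr by (rule irreducible_imp_prime_elem_cpoly3)

lemma degree_pos:
  assumes "i < m"
  shows "\<delta> i > 0"
proof (rule ccontr)
  assume "\<not> \<delta> i > 0"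
  then have "Poly_Mapping.keys (f i) \<subseteq> {0}"
    using hom[OF assms] by (auto simp: homogeneous_iff intro!: poly_mapping_eqI)
  then have "f i = pconst (Poly_Mapping.lookup (f i) 0)"
    by (intro poly_mapping_eqI) (auto simp: pconst_def lookup_single when_def in_keys_iff)
  then obtain c where c: "f i = pconst c" by blast
  show False
  proof (cases "c = 0")
    case True
    then show False using irr[OF assms] c by (simp add: hom_zero[OF ring_hom1_pconst])
  next
    case False
    then have "f i * pconst (inverse c) = 1"
      using hom_mult[OF ring_hom1_pconst, of c "inverse c"] by (simp add: c hom_one[OF ring_hom1_pconst])
    then have "f i dvd 1" by (metis dvd_triv_left)
    then show False using irr[OF assms] by (simp add: irreducible_def)
  qed
qed

text \<open>Without components the form is 0 and every point is singular; with a single one the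
  residue relation reads \<open>\<mu> 0 * of_nat (\<delta> 0) = 0\<close>.\<close>

lemma two_components: "m \<ge> 2"
proof (rule ccontr)
  assume "\<not> m \<ge> 2"
  then consider "m = 0" | "m = 1" by linarith
  then show False
  proof cases
    case 1
    have A0: "A j = 0" for j using A[of j] 1 by simp
    define v :: "complex ^ 3" where "v = (\<chi> i. if i = k then 0 else 1)"
    have v: "v $ k = 0" "v $ (k + 1) = 1" using index3_neq[of k] by (simp_all add: v_def)
    then have "v \<noteq> 0" by auto
    then obtain c where "v = c *s p" using singular_imp[of v] by (auto simp: A0 peval_simps)
    then show False using v pk by auto
  next
    case 2
    then show False using residues mu[of 0] degree_pos[of 0] by simp
  qed
qed

text \<open>Each summand of \<open>A s\<close> omits one factor only, so it contains
  \<open>f i\<close> or \<open>f j\<close>.\<close>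

lemma common_zero:
  assumes ij: "i < m" "j < m" "i \<noteq> j" and v: "v \<noteq> 0" "peval (f i) v = 0" "peval (f j) v = 0"
  shows "\<exists>c. v = c *s p"
proof (rule singular_imp[OF v(1)])
  fix s
  have pr: "(\<Prod>l\<in>{..<m} - {r}. peval (f l) v) = 0" for r
    using ij v by (cases "r = i") (auto intro!: prod_zero)
  show "peval (A s) v = 0" unfolding A by (simp add: peval_simps pr)
qed

lemma ex_other: "i < m \<Longrightarrow> \<exists>j<m. j \<noteq> i"
  using two_components by (metis less_le_trans one_less_numeral_iff pos2 semiring_norm(76) zero_neq_one)

lemma through_p:
  assumes i: "i < m"
  shows "peval (f i) p = 0"
proof -
  obtain j where j: "j < m" "j \<noteq> i" using ex_other[OF i] by blast
  obtain v where v: "v \<noteq> 0" "peval (f i) v = 0" "peval (f j) v = 0"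
    using forms_have_common_zero[OF irr hom degree_pos hom degree_pos, OF i i i j(1) j(1)] by blast
  then obtain c where c: "v = c *s p" using common_zero[OF i j(1)] j(2) by blast
  then have "c \<noteq> 0" using v(1) by auto
  then show ?thesis using v(2) by (simp add: c peval_scale[OF hom[OF i]])
qed

text \<open>\<open>f i\<close> has a zero on the line at infinity of the chart, away from
  \<open>p\<close>, and \<open>f j\<close> cannot vanish there too.\<close>

lemma not_dvd:
  assumes ij: "i < m" "j < m" "i \<noteq> j"
  shows "\<not> f i dvd f j"
proof
  assume dv: "f i dvd f j"
  obtain v where v: "v \<noteq> 0" "v $ k = 0" "peval (f i) v = 0"
    using form_zero_on_line[OF hom degree_pos, OF ij(1) ij(1)] by metis
  have "peval (f j) v = 0" using hom_dvd[OF ring_hom1_peval dv, of v] v(3) by (simp only: dvd_0_left_iff)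
  then obtain c where "v = c *s p" using common_zero[OF ij v(1) v(3)] by blast
  then show False using v pk by auto
qed

section \<open>Germs of the components at the singular point\<close>

abbreviation "F i \<equiv> germ_at p k (f i)"

lemma no_common_factor: "irreducible g \<Longrightarrow> g dvd germ_at p k (A (k + 1)) \<Longrightarrow> g dvd germ_at p k (A (k + 2)) \<Longrightarrow> False"
  by (rule germs_no_common_factor[OF euler pk singular_imp])

lemma germ_A: "germ_at p k (A j) = (\<Sum>i<m. ser_const (\<mu> i) * (\<Prod>l\<in>{..<m} - {i}. F l) * germ_at p k (pdiff j (f i)))"
  unfolding A hom_sum[OF ring_hom1_germ_at] hom_mult[OF ring_hom1_germ_at] hom_prod[OF ring_hom1_germ_at] germ_at_pconst ..

lemma germs_coprime:
  assumes g: "irreducible g" and ij: "i < m" "j < m" "i \<noteq> j" and dv: "g dvd F i" "g dvd F j"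
  shows False
proof -
  have "g dvd (\<Prod>l\<in>{..<m} - {r}. F l)" for r
  proof (cases "r = i")
    case True
    then have "F j dvd (\<Prod>l\<in>{..<m} - {r}. F l)" using ij by (intro dvd_prodI) auto
    then show ?thesis using dv dvd_trans by blast
  next
    case False
    then have "F i dvd (\<Prod>l\<in>{..<m} - {r}. F l)" using ij by (intro dvd_prodI) auto
    then show ?thesis using dv dvd_trans by blast
  qed
  then have "g dvd germ_at p k (A j)" for j unfolding germ_A by (intro dvd_sum dvd_mult2 dvd_mult)
  then show False using no_common_factor[OF g] by blast
qed

text \<open>A squared factor of \<open>F i\<close> still divides its derivatives once; the summand
  \<open>i\<close> then contains \<open>g\<close> through the derivative and all others through
  \<open>F i\<close>, so \<open>g\<close> divides both local coefficients.\<close>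

lemma germs_squarefree:
  assumes g: "irreducible g" and i: "i < m" and dv: "g ^ 2 dvd F i"
  shows False
proof -
  obtain h where h: "F i = g ^ 2 * h" using dv by (rule dvdE)
  have gF: "g dvd F i" unfolding h by (simp add: power2_eq_square)
  have ds: "g dvd deriv_s (F i)" and dt: "g dvd deriv_t (F i)"
    unfolding h power2_eq_square deriv_s_mult deriv_t_mult by simp_all
  have *: "g dvd ser_const (\<mu> r) * (\<Prod>l\<in>{..<m} - {r}. F l) * X r" if "r < m" "g dvd X i" for r X
  proof (cases "r = i")
    case False
    then have "F i dvd (\<Prod>l\<in>{..<m} - {r}. F l)" using i by (intro dvd_prodI) auto
    then have "g dvd (\<Prod>l\<in>{..<m} - {r}. F l)" using gF dvd_trans by blast
    then show ?thesis by simp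
  qed (use that in simp)
  have "g dvd germ_at p k (A (k + 1))" unfolding germ_A deriv_germ_at[symmetric] using ds by (intro dvd_sum *) auto
  moreover have "g dvd germ_at p k (A (k + 2))" unfolding germ_A deriv_germ_at[symmetric] using dt by (intro dvd_sum *) auto
  ultimately show False by (rule no_common_factor[OF g])
qed

lemma irreducible_ser_s: "irreducible ser_s"
  unfolding ser_s_def by (rule idom_prime_elem_imp_irreducible[OF prime_elem_fps_X])

text \<open>The zero series would be divisible by the square of \<open>ser_s\<close>.\<close>

lemma F_nonzero: "i < m \<Longrightarrow> F i \<noteq> 0"
  using germs_squarefree[OF irreducible_ser_s, of i] by auto

lemma prime_dvd_prod:
  assumes "prime_elem (g :: series2)" "g dvd (\<Prod>l\<in>S. h l)" "finite S"
  shows "\<exists>l\<in>S. g dvd h l"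
  using assms(3,2)
proof (induction S)
  case empty
  then show ?case using prime_elem_not_unit[OF assms(1)] by simp
next
  case (insert x S)
  then show ?case using assms(1) by (auto simp: prime_elem_dvd_mult_iff)
qed

lemma prod_squarefree:
  assumes g: "irreducible g"
  shows "\<not> g ^ 2 dvd (\<Prod>l<m. F l)"
proof
  assume sq: "g ^ 2 dvd (\<Prod>l<m. F l)"
  have p: "prime_elem g" using g by (rule fps_fps_irreducible_imp_prime)
  then have g0: "g \<noteq> 0" by (simp add: prime_elem_def)
  have "g dvd (\<Prod>l<m. F l)" using sq by (metis dvd_mult_left power2_eq_square)
  then obtain i where i: "i < m" "g dvd F i" using prime_dvd_prod[OF p] by blast
  obtain h where h: "F i = g * h" using i(2) by (rule dvdE)
  have "(\<Prod>l<m. F l) = g * (h * (\<Prod>l\<in>{..<m} - {i}. F l))"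
    using i(1) h by (simp add: prod.remove[of "{..<m}" i] mult.assoc)
  then have "g * g dvd g * (h * (\<Prod>l\<in>{..<m} - {i}. F l))" using sq by (simp add: power2_eq_square)
  then have "g dvd h * (\<Prod>l\<in>{..<m} - {i}. F l)" using g0 by (simp only: dvd_mult_cancel_left) simp
  then consider "g dvd h" | "g dvd (\<Prod>l\<in>{..<m} - {i}. F l)" using p by (auto simp: prime_elem_dvd_mult_iff)
  then show False
  proof cases
    case 1
    then have "g ^ 2 dvd F i" unfolding h power2_eq_square by (rule mult_dvd_mono[OF dvd_refl])
    then show False using germs_squarefree[OF g i(1)] by blast
  next
    case 2
    then obtain j where "j \<in> {..<m} - {i}" "g dvd F j" using prime_dvd_prod[OF p] by blast
    then show False using germs_coprime[OF g i(1) _ _ i(2)] by auto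
  qed
qed

lemma wedge_A: "A (k + 1) * pdiff (k + 2) h - A (k + 2) * pdiff (k + 1) h
    = (\<Sum>i<m. pconst (\<mu> i) * (\<Prod>l\<in>{..<m} - {i}. f l) * wedge k (f i) h)"
  unfolding A sum_distrib_right sum_subtractf[symmetric]
  by (intro sum.cong refl) (simp add: wedge_def algebra_simps)

text \<open>The summand \<open>l\<close> is annihilated by the antisymmetry of \<open>wedge\<close>;
  all others contain the factor \<open>f l\<close>.\<close>

lemma component_invariant:
  assumes l: "l < m"
  shows "f l dvd A (k + 1) * pdiff (k + 2) (f l) - A (k + 2) * pdiff (k + 1) (f l)"
proof -
  have "f l dvd pconst (\<mu> i) * (\<Prod>l\<in>{..<m} - {i}. f l) * wedge k (f i) (f l)" for i
  proof (cases "i = l")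
    case True
    then show ?thesis by (simp add: wedge_def mult.commute)
  next
    case False
    then have "f l dvd (\<Prod>l\<in>{..<m} - {i}. f l)" using l by (intro dvd_prodI) auto
    then show ?thesis by simp
  qed
  then show ?thesis unfolding wedge_A by (intro dvd_sum)
qed

lemma invariant_germ_separatrix:
  assumes inv: "h dvd A (k + 1) * pdiff (k + 2) h - A (k + 2) * pdiff (k + 1) h"
    and g: "irreducible g" "g dvd germ_at p k h" "germ_at p k h \<noteq> 0"
  shows "separatrix A p k g"
proof -
  have "germ_at p k h dvd germ_at p k (A (k + 1)) * deriv_t (germ_at p k h) - germ_at p k (A (k + 2)) * deriv_s (germ_at p k h)"
    using hom_dvd[OF ring_hom1_germ_at inv, of p k]
    by (simp add: hom_diff[OF ring_hom1_germ_at] hom_mult[OF ring_hom1_germ_at] deriv_germ_at)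
  from separatrix_of_invariant[OF g(1,2,3) this] show ?thesis using g(1) by (simp add: separatrix_def)
qed

lemma factor_separatrix:
  assumes g: "irreducible g" "g dvd (\<Prod>l<m. F l)"
  shows "separatrix A p k g"
proof -
  obtain l where l: "l < m" "g dvd F l"
    using prime_dvd_prod[OF fps_fps_irreducible_imp_prime[OF g(1)] g(2)] by auto
  show ?thesis
    by (rule invariant_germ_separatrix[OF component_invariant g(1) l(2) F_nonzero]) (rule l(1))+
qed

text \<open>The exponent depends only on \<open>j\<close> and the function \<open>\<rho>\<close> on
  neither index, so two components can be compared with each other along a third.\<close>

definition comparable :: "(complex ^ 2 \<Rightarrow> real) \<Rightarrow> (nat \<Rightarrow> nat) \<Rightarrow> nat \<Rightarrow> nat \<Rightarrow> bool" where
  "comparable \<rho> e i j \<longleftrightarrow> (\<exists>r>0. \<exists>c>0. \<exists>C>0. \<forall>z. z \<noteq> 0 \<longrightarrow> norm (z $ 1) < r \<longrightarrow> norm (z $ 2) < r \<longrightarrow>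
    peval (f i) (chart_point p k z) = 0 \<longrightarrow> 0 < \<rho> z \<and> \<rho> z \<le> 1 \<and>
    c * \<rho> z ^ e j \<le> norm (peval (f j) (chart_point p k z)) \<and> norm (peval (f j) (chart_point p k z)) \<le> C * \<rho> z ^ (e j :: nat))"

text \<open>The product of the component germs is squarefree and its irreducible factors are
  separatrices; it therefore divides the quasi-homogeneous equation, and its factors have leading
  forms without common zeros.\<close>

lemma local_dichotomy:
  assumes qh: "quasi_homogeneous_at A p k"
  shows "\<exists>\<rho> e. \<forall>i<m. \<forall>j<m. i \<noteq> j \<longrightarrow> comparable \<rho> e i j"
proof -
  obtain Q u v where Q: "quasi_homogeneous_poly Q" and uv: "local_coordinates u v"
    and sq: "squarefree (subst2 u v Q)"
    and sep: "\<And>g. irreducible g \<Longrightarrow> g dvd subst2 u v Q \<longleftrightarrow> separatrix A p k g"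
    using qh unfolding quasi_homogeneous_at_def Let_def subst2_def pair2_def by blast
  obtain w n where w: "\<And>i. w i > 0" and n: "n > 0" and wh: "weighted_homogeneous w n Q"
    using Q unfolding quasi_homogeneous_poly_def by blast
  have fc: "formal_coordinates u v (fps_nth (fps_nth u 1) 0) (fps_nth (fps_nth u 0) 1)
      (fps_nth (fps_nth v 1) 0) (fps_nth (fps_nth v 0) 1)"
    using uv by unfold_locales (auto simp: local_coordinates_def ser_ord_ge_def)
  have dv: "(\<Prod>l<m. F l) dvd subst2 u v Q"
  proof (rule fps2_squarefree_dvd)
    show "(\<Prod>l<m. F l) \<noteq> 0" using F_nonzero by simp
    show "g dvd subst2 u v Q" if "irreducible g" "g dvd (\<Prod>l<m. F l)" for g
      using sep that factor_separatrix by blast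
    show "\<not> g ^ 2 dvd (\<Prod>l<m. F l)" if "irreducible g" for g using prod_squarefree[OF that] .
  qed
  obtain T q e where T: "\<And>l. l < m \<Longrightarrow> ser_ord_ge (n + 1) (F l - subst2 u v (T l))"
    "\<And>l. l < m \<Longrightarrow> e l \<le> n"
    "\<And>l. l < m \<Longrightarrow> weighted_homogeneous w (e l) (q l)"
    "\<And>l \<mu>. l < m \<Longrightarrow> \<mu> \<in> Poly_Mapping.keys (T l - q l) \<Longrightarrow> e l < weight w \<mu>"
    "\<And>i j. i < m \<Longrightarrow> j < m \<Longrightarrow> i \<noteq> j \<Longrightarrow> common_zero_free (q i) (q j)"
    by (rule leading_forms[OF fc w wh sq dv], rule that, assumption+)
  show ?thesis
    unfolding comparable_def
    by (rule exE[OF formal_coordinates.local_comparison[OF fc w n, where m = m and P = "\<lambda>l. affine_part p k (f l)" and T = T and e = e and q = q,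
          folded germ_at_affine_part, unfolded peval_affine_part]],
        erule T(1), erule T(2), erule T(3), erule (1) T(4), erule (2) T(5), intro exI, assumption)
qed

text \<open>The exponents \<open>\<delta> l\<close> and \<open>\<delta> j\<close> equalize the
  degrees. Near \<open>p\<close> the quotient behaves like \<open>\<rho>\<close> to the power
  \<open>e j * \<delta> l - e l * \<delta> j\<close>; as \<open>\<rho> \<le> 1\<close>, it is
  bounded if this is nonnegative, and its inverse is bounded otherwise.\<close>

lemma curve_bound_dichotomy:
  assumes qh: "quasi_homogeneous_at A p k"
    and ijl: "i < m" "j < m" "l < m" "i \<noteq> j" "i \<noteq> l" "j \<noteq> l"
  shows "(\<exists>K. \<forall>v. peval (f i) v = 0 \<longrightarrow> (\<forall>c. v \<noteq> c *s p) \<longrightarrow> norm (peval (f j ^ \<delta> l) v) \<le> K * norm (peval (f l ^ \<delta> j) v))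
    \<or> (\<exists>K. \<forall>v. peval (f i) v = 0 \<longrightarrow> (\<forall>c. v \<noteq> c *s p) \<longrightarrow> norm (peval (f l ^ \<delta> j) v) \<le> K * norm (peval (f j ^ \<delta> l) v))"
proof -
  obtain \<rho> e where *: "\<And>i j. i < m \<Longrightarrow> j < m \<Longrightarrow> i \<noteq> j \<Longrightarrow> comparable \<rho> e i j"
    using local_dichotomy[OF qh] by blast
  have main: "\<exists>K. \<forall>v. peval (f i) v = 0 \<longrightarrow> (\<forall>c. v \<noteq> c *s p) \<longrightarrow> norm (peval (f j ^ \<delta> l) v) \<le> K * norm (peval (f l ^ \<delta> j) v)"
    if jl: "j < m" "l < m" "i \<noteq> j" "i \<noteq> l" and le: "e l * \<delta> j \<le> e j * \<delta> l" for j l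
  proof -
    obtain r1 C1 where 1: "r1 > 0" "C1 > 0" "\<And>z. z \<noteq> 0 \<Longrightarrow> norm (z $ 1) < r1 \<Longrightarrow> norm (z $ 2) < r1 \<Longrightarrow>
      peval (f i) (chart_point p k z) = 0 \<Longrightarrow> 0 < \<rho> z \<and> \<rho> z \<le> 1 \<and> norm (peval (f j) (chart_point p k z)) \<le> C1 * \<rho> z ^ e j"
      using *[OF ijl(1) jl(1,3)] unfolding comparable_def by blast
    obtain r2 c2 where 2: "r2 > 0" "c2 > 0" "\<And>z. z \<noteq> 0 \<Longrightarrow> norm (z $ 1) < r2 \<Longrightarrow> norm (z $ 2) < r2 \<Longrightarrow>
      peval (f i) (chart_point p k z) = 0 \<Longrightarrow> c2 * \<rho> z ^ e l \<le> norm (peval (f l) (chart_point p k z))"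
      using *[OF ijl(1) jl(2,4)] unfolding comparable_def by blast
    have homs: "homogeneous (\<delta> j * \<delta> l) (f j ^ \<delta> l)" "homogeneous (\<delta> j * \<delta> l) (f l ^ \<delta> j)"
      using homogeneous_power[OF hom[OF jl(1)], of "\<delta> l"] homogeneous_power[OF hom[OF jl(2)], of "\<delta> j"]
      by (simp_all add: mult.commute)
    have nz: "\<exists>c. v = c *s p" if "v \<noteq> 0" "peval (f i) v = 0" "peval (f l ^ \<delta> j) v = 0" for v
      using common_zero[OF ijl(1) jl(2,4) that(1,2)] that(3) by (simp add: peval_simps)
    have loc: "norm (peval (f j ^ \<delta> l) (chart_point p k z)) \<le> C1 ^ \<delta> l / c2 ^ \<delta> j * norm (peval (f l ^ \<delta> j) (chart_point p k z))"
      if z: "z \<noteq> 0" "norm (z $ 1) < min r1 r2" "norm (z $ 2) < min r1 r2" "peval (f i) (chart_point p k z) = 0" for z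
    proof -
      let ?x = "chart_point p k z"
      have b1: "0 < \<rho> z" "\<rho> z \<le> 1" "norm (peval (f j) ?x) \<le> C1 * \<rho> z ^ e j" using 1(3)[of z] z by auto
      have b2: "c2 * \<rho> z ^ e l \<le> norm (peval (f l) ?x)" using 2(3)[of z] z by auto
      have "norm (peval (f j ^ \<delta> l) ?x) \<le> (C1 * \<rho> z ^ e j) ^ \<delta> l"
        unfolding hom_power[OF ring_hom1_peval] norm_power by (intro power_mono b1) auto
      also have "\<dots> = C1 ^ \<delta> l * \<rho> z ^ (e j * \<delta> l)" by (simp add: power_mult_distrib power_mult)
      also have "\<dots> \<le> C1 ^ \<delta> l * \<rho> z ^ (e l * \<delta> j)"
        using b1 1(2) le by (intro mult_left_mono power_decreasing) auto
      also have "\<dots> = C1 ^ \<delta> l / c2 ^ \<delta> j * (c2 * \<rho> z ^ e l) ^ \<delta> j"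
        using 2(2) by (simp add: power_mult_distrib power_mult)
      also have "\<dots> \<le> C1 ^ \<delta> l / c2 ^ \<delta> j * norm (peval (f l ^ \<delta> j) ?x)"
        unfolding hom_power[OF ring_hom1_peval] norm_power using 1(2) 2(2) b1
        by (intro mult_left_mono power_mono b2) auto
      finally show ?thesis .
    qed
    have r0: "min r1 r2 > 0" using 1 2 by simp
    show ?thesis
      by (rule curve_bound[OF hom[OF ijl(1)] homs pk], erule (2) nz, rule r0, erule (3) loc, blast)
  qed
  show ?thesis
    using main[OF ijl(2,3,4,5)] main[OF ijl(3,2,5,4)] by (metis linear)
qed

text \<open>Whichever quotient is bounded is constant along \<open>f i = 0\<close>; exchanging
  \<open>j\<close> and \<open>l\<close> only changes the sign of the determinant.\<close>

lemma dvd_jacobian_components: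
  assumes qh: "quasi_homogeneous_at A p k"
    and ijl: "i < m" "j < m" "l < m" "i \<noteq> j" "i \<noteq> l" "j \<noteq> l"
  shows "f i dvd jacobian k (f i) (f j) (f l)"
proof -
  have p0: "p \<noteq> 0" using pk by auto
  have liou: "f i dvd jacobian k (f i) (f j) (f l)"
    if jl: "j < m" "l < m" "i \<noteq> j" "i \<noteq> l"
      and K: "\<And>v. peval (f i) v = 0 \<Longrightarrow> (\<And>c. v \<noteq> c *s p) \<Longrightarrow> norm (peval (f j ^ \<delta> l) v) \<le> K * norm (peval (f l ^ \<delta> j) v)"
    for j l K
  proof -
    have homs: "homogeneous (\<delta> j * \<delta> l) (f j ^ \<delta> l)" "homogeneous (\<delta> j * \<delta> l) (f l ^ \<delta> j)"
      using homogeneous_power[OF hom[OF jl(1)], of "\<delta> l"] homogeneous_power[OF hom[OF jl(2)], of "\<delta> j"]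
      by (simp_all add: mult.commute)
    have nz: "peval (f l ^ \<delta> j) v \<noteq> 0" if v: "peval (f i) v = 0" "\<And>c. v \<noteq> c *s p" for v
    proof -
      have "v \<noteq> 0" using v(2)[of 0] by auto
      then have "peval (f l) v \<noteq> 0" using common_zero[OF ijl(1) jl(2,4)] v by blast
      then show ?thesis by (simp add: peval_simps)
    qed
    have "\<exists>c. f i dvd f j ^ \<delta> l - pconst c * f l ^ \<delta> j"
    proof (rule curve_liouville[OF irr[OF ijl(1)] hom[OF ijl(1)] degree_pos[OF ijl(1)] p0 through_p[OF ijl(1)] homs])
      fix v assume v: "peval (f i) v = 0" "\<And>c. v \<noteq> c *s p"
      show "peval (f l ^ \<delta> j) v \<noteq> 0" by (rule nz[OF v])
      show "norm (peval (f j ^ \<delta> l) v) \<le> K * norm (peval (f l ^ \<delta> j) v)" by (rule K[OF v])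
    qed
    then obtain c where "f i dvd f j ^ \<delta> l - pconst c * f l ^ \<delta> j" by blast
    then show ?thesis
      by (rule dvd_jacobian[OF prime[OF ijl(1)] not_dvd[OF ijl(1) jl(1,3)] degree_pos[OF jl(2)]])
  qed
  from curve_bound_dichotomy[OF qh ijl] show ?thesis
  proof
    assume "\<exists>K. \<forall>v. peval (f i) v = 0 \<longrightarrow> (\<forall>c. v \<noteq> c *s p) \<longrightarrow> norm (peval (f j ^ \<delta> l) v) \<le> K * norm (peval (f l ^ \<delta> j) v)"
    then show ?thesis using liou[OF ijl(2,3,4,5)] by metis
  next
    assume "\<exists>K. \<forall>v. peval (f i) v = 0 \<longrightarrow> (\<forall>c. v \<noteq> c *s p) \<longrightarrow> norm (peval (f l ^ \<delta> j) v) \<le> K * norm (peval (f j ^ \<delta> l) v)"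
    then have "f i dvd jacobian k (f i) (f l) (f j)" using liou[OF ijl(3,2,5,4)] by metis
    then show ?thesis by (simp add: jacobian_swap23[of k "f i" "f l" "f j"])
  qed
qed

text \<open>The Jacobian determinant is divisible by the product of the three forms, whose degree is larger.\<close>

lemma jacobian_components_eq_0:
  assumes qh: "quasi_homogeneous_at A p k"
    and ijl: "i < m" "j < m" "l < m" "i \<noteq> j" "i \<noteq> l" "j \<noteq> l"
  shows "jacobian k (f i) (f j) (f l) = 0"
proof -
  let ?J = "jacobian k (f i) (f j) (f l)"
  have di: "f i dvd ?J" by (rule dvd_jacobian_components[OF qh ijl])
  have "f j dvd jacobian k (f j) (f i) (f l)" by (rule dvd_jacobian_components[OF qh]) (use ijl in auto)
  then have dj: "f j dvd ?J" by (simp add: jacobian_swap12[of k "f j" "f i"])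
  have "f l dvd jacobian k (f l) (f i) (f j)" by (rule dvd_jacobian_components[OF qh]) (use ijl in auto)
  then have dl: "f l dvd ?J" by (simp add: jacobian_swap12[of k "f l" "f i"] jacobian_swap23[of k "f i" "f l" "f j"])
  obtain K1 where K1: "?J = f i * K1" using di by (rule dvdE)
  have "f j dvd K1" using dj not_dvd[of j i] ijl prime[of j] by (auto simp: K1 prime_elem_dvd_mult_iff)
  then obtain K2 where K2: "K1 = f j * K2" by (rule dvdE)
  have "f l dvd K2" using dl not_dvd[of l i] not_dvd[of l j] ijl prime[of l] by (auto simp: K1 K2 prime_elem_dvd_mult_iff)
  then obtain K3 where "K2 = f l * K3" by (rule dvdE)
  then have "f i * f j * f l dvd ?J" by (simp add: K1 K2 mult.assoc)
  moreover have "homogeneous (\<delta> i + \<delta> j + \<delta> l) (f i * f j * f l)"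
    using ijl by (intro homogeneous_mult hom)
  moreover have "homogeneous ((\<delta> i - 1) + (\<delta> j - 1) + (\<delta> l - 1)) ?J"
    using ijl by (intro homogeneous_jacobian hom)
  moreover have "(\<delta> i - 1) + (\<delta> j - 1) + (\<delta> l - 1) < \<delta> i + \<delta> j + \<delta> l" using degree_pos[OF ijl(1)] by linarith
  ultimately show ?thesis by (intro homogeneous_dvd_degree[of "\<delta> i + \<delta> j + \<delta> l"])
qed

section \<open>The invariant pencil\<close>

definition "along h = A (k + 1) * pdiff (k + 2) h - A (k + 2) * pdiff (k + 1) h"

lemma along_power: "along (a ^ n) = of_nat n * a ^ (n - 1) * along a"
  by (simp add: along_def pdiff_power algebra_simps)

lemma along_diff_cmult: "along (a - pconst c * b) = along a - pconst c * along b"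
  by (simp add: along_def pdiff_diff pdiff_mult algebra_simps)

text \<open>Where the Jacobian of \<open>f i\<close>, \<open>f 0\<close>, \<open>f 1\<close>
  vanishes, the Euler contraction turns the summand \<open>i\<close> of the difference into
  \<open>- \<mu> i * \<delta> i\<close> times a factor independent of \<open>i\<close>; the residue
  relation then makes the sum 0.\<close>

lemma pencil_relation:
  assumes qh: "quasi_homogeneous_at A p k"
  shows "of_nat (\<delta> 1) * f 1 * along (f 0) = of_nat (\<delta> 0) * f 0 * along (f 1)"
proof -
  have m: "0 < m" "1 < m" using two_components by auto
  \<comment> \<open>For \<open>i\<close> equal to 0 or 1 two arguments coincide, so a foliation with
    only two components is covered as well.\<close>
  have J: "jacobian k (f i) (f 0) (f 1) = 0" if "i < m" for i
  proof (cases "i = 0 \<or> i = 1")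
    case True
    then show ?thesis
      using jacobian_swap23[of k "f 1" "f 1" "f 0"] by (auto simp: jacobian_same)
  next
    case False
    then show ?thesis using jacobian_components_eq_0[OF qh that m] by auto
  qed
  let ?c = "\<lambda>i. pconst (\<mu> i) * (\<Prod>l\<in>{..<m} - {i}. f l)"
  have "of_nat (\<delta> 1) * f 1 * along (f 0) - of_nat (\<delta> 0) * f 0 * along (f 1)
    = (\<Sum>i<m. ?c i * (of_nat (\<delta> 1) * f 1 * wedge k (f i) (f 0) - of_nat (\<delta> 0) * f 0 * wedge k (f i) (f 1)))"
    unfolding along_def wedge_A sum_distrib_left sum_subtractf[symmetric]
    by (intro sum.cong refl) (simp add: algebra_simps)
  also have "\<dots> = (\<Sum>i<m. pconst (\<mu> i * of_nat (\<delta> i)) * (- (\<Prod>l<m. f l) * wedge k (f 0) (f 1)))"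
  proof (intro sum.cong refl)
    fix i assume i: "i \<in> {..<m}"
    have "of_nat (\<delta> i) * f i * wedge k (f 0) (f 1) - of_nat (\<delta> 0) * f 0 * wedge k (f i) (f 1)
        + of_nat (\<delta> 1) * f 1 * wedge k (f i) (f 0) = 0"
      using euler_contraction[OF hom hom hom, of i 0 1 k] i m J[of i] by simp
    then have e: "of_nat (\<delta> 1) * f 1 * wedge k (f i) (f 0) - of_nat (\<delta> 0) * f 0 * wedge k (f i) (f 1)
      = - (of_nat (\<delta> i) * f i * wedge k (f 0) (f 1))" by (simp add: algebra_simps add_eq_0_iff)
    have "(\<Prod>l<m. f l) = f i * (\<Prod>l\<in>{..<m} - {i}. f l)" using i by (simp add: prod.remove[of "{..<m}" i])
    then show "?c i * (of_nat (\<delta> 1) * f 1 * wedge k (f i) (f 0) - of_nat (\<delta> 0) * f 0 * wedge k (f i) (f 1))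
      = pconst (\<mu> i * of_nat (\<delta> i)) * (- (\<Prod>l<m. f l) * wedge k (f 0) (f 1))"
      unfolding e hom_mult[OF ring_hom1_pconst] hom_of_nat[OF ring_hom1_pconst] by (simp add: mult_ac)
  qed
  also have "\<dots> = pconst (\<Sum>i<m. \<mu> i * of_nat (\<delta> i)) * (- (\<Prod>l<m. f l) * wedge k (f 0) (f 1))"
    unfolding hom_sum[OF ring_hom1_pconst] sum_distrib_right ..
  also have "\<dots> = 0" by (simp add: residues hom_zero[OF ring_hom1_pconst])
  finally show ?thesis by simp
qed

definition "pencil c = f 0 ^ \<delta> 1 - pconst c * f 1 ^ \<delta> 0"

text \<open>With \<open>along (f 0) = f 0 * \<sigma>\<close>, the pencil relation gives both powers
  the same cofactor \<open>of_nat (\<delta> 1) * \<sigma>\<close>, and so all their linear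
  combinations.\<close>

lemma pencil_invariant:
  assumes qh: "quasi_homogeneous_at A p k"
  shows "pencil c dvd along (pencil c)"
proof -
  have m: "0 < m" "1 < m" using two_components by auto
  have unit: "of_nat n * pconst (inverse (of_nat n)) = (1 :: 3 cpoly)" if "n > 0" for n
    unfolding hom_of_nat[OF ring_hom1_pconst, symmetric] hom_mult[OF ring_hom1_pconst, symmetric]
    using that by (simp add: hom_one[OF ring_hom1_pconst])
  obtain \<sigma> where \<sigma>: "along (f 0) = f 0 * \<sigma>" using component_invariant[OF m(1)] unfolding along_def by (rule dvdE)
  have f0: "f 0 \<noteq> 0" using prime[OF m(1)] by (simp add: prime_elem_def)
  have "f 0 * (of_nat (\<delta> 1) * f 1 * \<sigma>) = f 0 * (of_nat (\<delta> 0) * along (f 1))"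
    using pencil_relation[OF qh] by (simp add: \<sigma> mult_ac)
  then have rel: "of_nat (\<delta> 0) * along (f 1) = of_nat (\<delta> 1) * f 1 * \<sigma>" using f0 by simp
  have pow: "x ^ n = x ^ (n - 1) * x" if "n > 0" for x :: "3 cpoly" and n
    using that by (cases n) simp_all
  have "along (f 0 ^ \<delta> 1) = of_nat (\<delta> 1) * f 0 ^ \<delta> 1 * \<sigma>"
  proof -
    have "along (f 0 ^ \<delta> 1) = of_nat (\<delta> 1) * (f 0 ^ (\<delta> 1 - 1) * f 0) * \<sigma>"
      unfolding along_power \<sigma> by (simp add: mult_ac)
    then show ?thesis using pow[OF degree_pos[OF m(2)], of "f 0"] by simp
  qed
  moreover have "along (f 1 ^ \<delta> 0) = of_nat (\<delta> 1) * f 1 ^ \<delta> 0 * \<sigma>"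
  proof -
    have "along (f 1 ^ \<delta> 0) = f 1 ^ (\<delta> 0 - 1) * (of_nat (\<delta> 0) * along (f 1))" by (simp add: along_power mult_ac)
    also have "\<dots> = of_nat (\<delta> 1) * (f 1 ^ (\<delta> 0 - 1) * f 1) * \<sigma>" unfolding rel by (simp add: mult_ac)
    finally show ?thesis using pow[OF degree_pos[OF m(1)], of "f 1"] by simp
  qed
  ultimately have "along (pencil c) = pencil c * (of_nat (\<delta> 1) * \<sigma>)"
    unfolding pencil_def along_diff_cmult by (simp add: algebra_simps)
  then show ?thesis by simp
qed

lemma germ_not_unit:
  assumes i: "i < m"
  shows "\<not> F i dvd 1"
proof -
  have h: "ring_hom1 (\<lambda>S :: series2. fps_nth (fps_nth S 0) 0)" by (rule ring_hom1I) auto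
  have "fps_nth (fps_nth (F i) 0) 0 = peval (f i) ((1 / p $ k) *s p)"
    unfolding germ_at_def hom_psubst[OF h] peval_def
    by (rule arg_cong2[where f = "\<lambda>c x. psubst c x (f i)"]) (auto simp: ser_const_def ser_s_def ser_t_def)
  also have "\<dots> = 0" by (simp add: peval_scale[OF hom[OF i]] through_p[OF i])
  finally show ?thesis by (simp add: fps2_is_unit_iff)
qed

text \<open>Each member with \<open>c \<noteq> 0\<close> has a nonzero germ vanishing at
  \<open>p\<close>, hence an irreducible factor, which is a separatrix. Different members share no
  factor, because it would divide the coprime germs \<open>F 0\<close> and \<open>F 1\<close>;
  infinitely many parameters thus give infinitely many separatrices.\<close>

lemma dicritical:
  assumes qh: "quasi_homogeneous_at A p k"
  shows "\<not> non_dicritical A p k"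
proof
  assume nd: "non_dicritical A p k"
  have m: "0 < m" "1 < m" using two_components by auto
  have \<delta>: "\<delta> 0 > 0" "\<delta> 1 > 0" using degree_pos m by auto
  have germ: "germ_at p k (pencil c) = F 0 ^ \<delta> 1 - ser_const c * F 1 ^ \<delta> 0" for c
    by (simp add: pencil_def hom_simps[OF ring_hom1_germ_at] germ_at_pconst)
  have power: "g dvd x" if "irreducible g" "g dvd x ^ n" for g x :: series2 and n
    using that(2)
  proof (induction n)
    case 0
    then show ?case using that(1) by (simp add: irreducible_def)
  next
    case (Suc n)
    then show ?case using fps_fps_irreducible_imp_prime[OF that(1)] by (auto simp: prime_elem_dvd_mult_iff)
  qed
  have const: "\<not> g dvd ser_const c" if "irreducible g" "c \<noteq> 0" for g c
  proof
    assume "g dvd ser_const c"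
    moreover have "ser_const c dvd 1" using that by (simp add: fps2_is_unit_iff ser_const_def)
    ultimately have "g dvd 1" by (rule dvd_trans)
    then show False using that(1) by (simp add: irreducible_def)
  qed
  have cmult: "g dvd x" if "irreducible g" "c \<noteq> 0" "g dvd ser_const c * x ^ n" for g c x n
    using fps_fps_irreducible_imp_prime[OF that(1)] const[OF that(1,2)] power[OF that(1)] that(3)
    by (auto simp: prime_elem_dvd_mult_iff)
  have copr: False if "irreducible g" "g dvd F 0" "g dvd F 1" for g
    by (rule germs_coprime[OF that(1) m _ that(2,3)]) simp
  have nz: "germ_at p k (pencil c) \<noteq> 0" if "c \<noteq> 0" for c
  proof
    assume "germ_at p k (pencil c) = 0"
    then have eq: "F 0 ^ \<delta> 1 = ser_const c * F 1 ^ \<delta> 0" by (simp add: germ)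
    obtain g where g: "irreducible g" "g dvd F 0"
      using fps2_irreducible_factor_exists[OF F_nonzero germ_not_unit, OF m(1) m(1)] by blast
    have "g dvd F 0 ^ \<delta> 1" using g(2) \<delta>(2) by (metis dvd_power dvd_trans)
    then have "g dvd F 1" unfolding eq by (rule cmult[OF g(1) that])
    then show False using copr[OF g] by blast
  qed
  have "\<exists>g. irreducible g \<and> g dvd germ_at p k (pencil c)" if "c \<noteq> 0" for c
  proof (rule fps2_irreducible_factor_exists[OF nz[OF that]])
    have "fps_nth (fps_nth (F i) 0) 0 = 0" if "i < m" for i
      using germ_not_unit[OF that] by (simp add: fps2_is_unit_iff)
    then have z: "fps_nth (fps_nth (F 0) 0) 0 = 0" "fps_nth (fps_nth (F 1) 0) 0 = 0" using m by auto
    have h: "ring_hom1 (\<lambda>S :: series2. fps_nth (fps_nth S 0) 0)" by (rule ring_hom1I) auto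
    have "fps_nth (fps_nth (germ_at p k (pencil c)) 0) 0 = 0"
      unfolding germ hom_diff[OF h] hom_mult[OF h] hom_power[OF h] z using \<delta> by (simp add: zero_power)
    then show "\<not> germ_at p k (pencil c) dvd 1" by (simp add: fps2_is_unit_iff)
  qed
  then obtain g where g: "\<And>c. c \<noteq> 0 \<Longrightarrow> irreducible (g c)" "\<And>c. c \<noteq> 0 \<Longrightarrow> g c dvd germ_at p k (pencil c)"
    by metis
  \<comment> \<open>Separatrices are counted by ideals, so the chosen factor is replaced by the
    ideal it generates; finiteness would make two parameters share one.\<close>
  define I where "I = (\<lambda>c. {h. g c dvd h})"
  have "separatrix A p k (g c)" if "c \<noteq> 0" for c
    by (rule invariant_germ_separatrix[OF _ g(1,2) nz])
      (use that pencil_invariant[OF qh, of c] in \<open>simp_all add: along_def\<close>)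
  then have "I ` (- {0}) \<subseteq> {{h. g dvd h} | g. separatrix A p k g}" by (auto simp: I_def)
  then have "finite (I ` (- {0}))" using nd unfolding non_dicritical_def by (rule finite_subset)
  moreover have "infinite (- {0 :: complex})" by (simp add: infinite_UNIV_char_0)
  ultimately have "\<not> inj_on I (- {0})" using finite_imageD by blast
  then obtain c c' where c: "c \<noteq> 0" "c' \<noteq> 0" "c \<noteq> c'" "I c = I c'" by (auto simp: inj_on_def)
  have "g c' \<in> I c'" by (simp add: I_def)
  then have "g c dvd g c'" unfolding c(4)[symmetric] by (simp add: I_def)
  then have "g c dvd germ_at p k (pencil c')" using g(2)[OF c(2)] dvd_trans by blast
  \<comment> \<open>The difference of two members is a nonzero scalar times
    \<open>F 1 ^ \<delta> 0\<close>, which isolates \<open>F 1\<close>; either member then yields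
    \<open>F 0\<close>.\<close>
  then have "g c dvd germ_at p k (pencil c) - germ_at p k (pencil c')" using g(2)[OF c(1)] by (rule dvd_diff[rotated])
  also have "germ_at p k (pencil c) - germ_at p k (pencil c') = ser_const (c' - c) * F 1 ^ \<delta> 0"
    by (simp add: germ hom_diff[OF ring_hom1_ser_const] algebra_simps)
  finally have "g c dvd ser_const (c' - c) * F 1 ^ \<delta> 0" .
  moreover have "c' - c \<noteq> 0" using c(3) by simp
  ultimately have g1: "g c dvd F 1" by (rule cmult[OF g(1)[OF c(1)], rotated])
  then have "g c dvd F 1 ^ \<delta> 0" using \<delta>(1) by (metis dvd_power dvd_trans)
  then have "g c dvd germ_at p k (pencil c) + ser_const c * F 1 ^ \<delta> 0" using g(2)[OF c(1)] by (intro dvd_add dvd_mult)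
  then have "g c dvd F 0 ^ \<delta> 1" by (simp add: germ)
  then have "g c dvd F 0" by (rule power[OF g(1)[OF c(1)]])
  then show False using copr[OF g(1)[OF c(1)]] g1 by blast
qed

end

theorem theorem7p7:
  fixes d :: nat
  shows "\<not> (\<exists>(A :: 3 \<Rightarrow> 3 cpoly) (p :: complex ^ 3) (k :: 3).
    foliation d A \<and> logarithmic A \<and>
    p $ k \<noteq> 0 \<and> singular_points A = {proj_point p} \<and>
    non_dicritical A p k \<and> quasi_homogeneous_at A p k \<and>
    (\<exists>(d\<^sub>0 :: nat) (G :: 3 cpoly).
      d\<^sub>0 \<ge> 2 \<and> reduced_curve d\<^sub>0 G \<and> invariant_curve A G \<and>
      (\<forall>g. separatrix A p k g \<longrightarrow> g dvd germ_at p k G)))"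
proof
  assume "\<exists>(A :: 3 \<Rightarrow> 3 cpoly) (p :: complex ^ 3) (k :: 3).
    foliation d A \<and> logarithmic A \<and>
    p $ k \<noteq> 0 \<and> singular_points A = {proj_point p} \<and>
    non_dicritical A p k \<and> quasi_homogeneous_at A p k \<and>
    (\<exists>(d\<^sub>0 :: nat) (G :: 3 cpoly).
      d\<^sub>0 \<ge> 2 \<and> reduced_curve d\<^sub>0 G \<and> invariant_curve A G \<and>
      (\<forall>g. separatrix A p k g \<longrightarrow> g dvd germ_at p k G))"
  then obtain A p k where *: "foliation d A" "logarithmic A" "p $ k \<noteq> 0" "singular_points A = {proj_point p}"
    "non_dicritical A p k" "quasi_homogeneous_at A p k" by blast
  obtain m f \<delta> \<mu> where "\<forall>i<(m::nat). irreducible (f i) \<and> homogeneous (\<delta> i) (f i) \<and> \<mu> i \<noteq> (0::complex)"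
    "(\<Sum>i<m. \<mu> i * of_nat (\<delta> i)) = 0"
    "\<forall>j. A j = (\<Sum>i<m. pconst (\<mu> i) * (\<Prod>l\<in>{..<m} - {i}. f l) * pdiff j (f i))"
    using *(2) unfolding logarithmic_def by blast
  then interpret logarithmic_foliation A p k m f \<delta> \<mu>
    using * by unfold_locales (auto simp: foliation_def)
  show False using dicritical *(5,6) by blast
qed

end
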